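(* Let $p$ be a prime. Assume that a finite $p'$-group $H$ acts faithfully on a finite $p$-group $P$ with $|P|=p^n$, and let $G=H\ltimes P$. Write $\overline{G}=G/\Phi(G)$, let $\overline{P}$ be the image of $P$ in $\overline{G}$, and write $|\overline{P}|=p^{n-s}$. If $G$ is a nontrivial $\mathfrak{C}(p^d)$-group for a fixed positive integer $d<n$, then one of the following statements holds. (1) $\overline{G}$ is supersolvable. (2) $H$ is cyclic and $\overline{P}$ is a homogeneous $\mathbb{F}_p[H]$-module all of whose irreducible $\mathbb{F}_p[H]$-submodules have dimension $e>1$ over $\mathbb{F}_p$, with $e\mid \gcd(d-s,n-s)$.
   Context: All groups are finite. A $p'$-group is a group of order prime to $p$; $|G|_p$ denotes the $p$-part of $|G|$; $\Phi(G)$ is the Frattini subgroup of $G$. $H\ltimes P$ denotes the semidirect product with $P$ normal. A subgroup $X$ of $G$ is complemented in $G$ if there is a subgroup $K\leq G$ with $G=XK$ and $X\cap K=1$. $G$ is a $\mathfrak{C}(p^d)$-group if every subgroup of $G$ of order $p^d$ is complemented in $G$; it is a nontrivial $\mathfrak{C}(p^d)$-group if in addition $p^d\leq |G|_p$. In (2), $\overline{P}$ is elementary abelian and is regarded as an $\mathbb{F}_p[H]$-module via the action of $H$ induced by conjugation. A module is homogeneous if it is a direct sum of isomorphic irreducible modules. *)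

theory Defs
  imports
    "HOL-Algebra.Bij"
    "HOL-Algebra.Elementary_Groups"
    "HOL-Number_Theory.Residues"
    "Jordan_Normal_Form.Missing_VectorSpace"
begin

section \<open>Groups\<close>

definition maximal_subgroup :: "'a set \<Rightarrow> ('a, 'm) monoid_scheme \<Rightarrow> bool" where
  "maximal_subgroup M G \<longleftrightarrow> subgroup M G \<and> M \<noteq> carrier G \<and>
     (\<forall>K. subgroup K G \<longrightarrow> M \<subseteq> K \<longrightarrow> K = M \<or> K = carrier G)"

text \<open>The intersection with the carrier gives the usual value for a group that has no
  maximal subgroups, namely the whole group.\<close>

definition frattini :: "('a, 'm) monoid_scheme \<Rightarrow> 'a set" where
  "frattini G = carrier G \<inter> \<Inter> {M. maximal_subgroup M G}"

definition complemented_in :: "'a set \<Rightarrow> ('a, 'm) monoid_scheme \<Rightarrow> bool" where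
  "complemented_in X G \<longleftrightarrow>
     (\<exists>K. subgroup K G \<and> carrier G = X <#>\<^bsub>G\<^esub> K \<and> X \<inter> K = {\<one>\<^bsub>G\<^esub>})"

definition C_group :: "nat \<Rightarrow> nat \<Rightarrow> ('a, 'm) monoid_scheme \<Rightarrow> bool" where
  "C_group p d G \<longleftrightarrow> (\<forall>X. subgroup X G \<and> card X = p ^ d \<longrightarrow> complemented_in X G)"

definition nontrivial_C_group :: "nat \<Rightarrow> nat \<Rightarrow> ('a, 'm) monoid_scheme \<Rightarrow> bool" where
  "nontrivial_C_group p d G \<longleftrightarrow> C_group p d G \<and> p ^ d \<le> p ^ multiplicity p (order G)"

definition supersolvable :: "('a, 'm) monoid_scheme \<Rightarrow> bool" where
  "supersolvable G \<longleftrightarrow> (\<exists>(k::nat) N. N 0 = {\<one>\<^bsub>G\<^esub>} \<and> N k = carrier G \<and>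
     (\<forall>i\<le>k. N i \<lhd> G) \<and>
     (\<forall>i<k. N i \<subseteq> N (Suc i) \<and> cyclic_group (G\<lparr>carrier := N (Suc i)\<rparr> Mod N i)))"

text \<open>The pair \<open>(h, x)\<close> stands for the product \<open>x h\<close>, so that
  \<open>(x h) (y k) = (x (h y h\<inverse>)) (h k)\<close>, where \<open>h y h\<inverse> = \<phi> h y\<close>.\<close>

definition semidirect ::
    "('a, 'm) monoid_scheme \<Rightarrow> ('b, 'n) monoid_scheme \<Rightarrow> ('a \<Rightarrow> 'b \<Rightarrow> 'b) \<Rightarrow> ('a \<times> 'b) monoid" where
  "semidirect H P \<phi> =
     \<lparr>carrier = carrier H \<times> carrier P,
      monoid.mult = (\<lambda>(h, x) (k, y). (h \<otimes>\<^bsub>H\<^esub> k, x \<otimes>\<^bsub>P\<^esub> \<phi> h y)),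
      one = (\<one>\<^bsub>H\<^esub>, \<one>\<^bsub>P\<^esub>)\<rparr>"

lemma hom_AutoGroup:
  assumes "group_hom H (AutoGroup P) \<phi>" "h \<in> carrier H" "x \<in> carrier P"
  shows "\<phi> h x \<in> carrier P"
    and "y \<in> carrier P \<Longrightarrow> \<phi> h (x \<otimes>\<^bsub>P\<^esub> y) = \<phi> h x \<otimes>\<^bsub>P\<^esub> \<phi> h y"
    and "k \<in> carrier H \<Longrightarrow> \<phi> (h \<otimes>\<^bsub>H\<^esub> k) x = \<phi> h (\<phi> k x)"
    and "\<phi> \<one>\<^bsub>H\<^esub> x = x"
proof -
  interpret group_hom H "AutoGroup P" \<phi> by (rule assms(1))
  have auto: "\<phi> g \<in> hom P P" "\<phi> g \<in> Bij (carrier P)" if "g \<in> carrier H" for g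
    using hom_closed[OF that] by (auto simp: AutoGroup_def auto_def)
  show "\<phi> h x \<in> carrier P"
    using auto(1)[OF assms(2)] assms(3) by (auto simp: hom_def)
  show "\<phi> h (x \<otimes>\<^bsub>P\<^esub> y) = \<phi> h x \<otimes>\<^bsub>P\<^esub> \<phi> h y" if "y \<in> carrier P"
    using auto(1)[OF assms(2)] assms(3) that by (auto simp: hom_def)
  show "\<phi> (h \<otimes>\<^bsub>H\<^esub> k) x = \<phi> h (\<phi> k x)" if "k \<in> carrier H"
    using hom_mult[OF assms(2) that] auto(2)[OF assms(2)] auto(2)[OF that] assms(3)
    by (simp add: AutoGroup_def BijGroup_def compose_def)
  show "\<phi> \<one>\<^bsub>H\<^esub> x = x"
    using hom_one assms(3) by (simp add: AutoGroup_def BijGroup_def)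
qed

lemma group_semidirect:
  assumes "group H" "group P" "group_hom H (AutoGroup P) \<phi>"
  shows "group (semidirect H P \<phi>)"
proof -
  interpret H: group H by fact
  interpret P: group P by fact
  note act = hom_AutoGroup[OF assms(3)]
  have one: "\<phi> h \<one>\<^bsub>P\<^esub> = \<one>\<^bsub>P\<^esub>" if "h \<in> carrier H" for h
    using act(1,2)[OF that P.one_closed] P.one_closed by (metis P.l_one P.r_cancel_one')
  show ?thesis
  proof (rule groupI)
    fix g assume "g \<in> carrier (semidirect H P \<phi>)"
    then obtain h x where g: "g = (h, x)" and hx: "h \<in> carrier H" "x \<in> carrier P"
      by (auto simp: semidirect_def)
    have "\<phi> (inv\<^bsub>H\<^esub> h) (inv\<^bsub>P\<^esub> x) \<otimes>\<^bsub>P\<^esub> \<phi> (inv\<^bsub>H\<^esub> h) x = \<one>\<^bsub>P\<^esub>"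
      using hx one by (simp flip: act(2))
    then show "\<exists>g'\<in>carrier (semidirect H P \<phi>).
        g' \<otimes>\<^bsub>semidirect H P \<phi>\<^esub> g = \<one>\<^bsub>semidirect H P \<phi>\<^esub>"
      using hx act(1)
      by (intro bexI[of _ "(inv\<^bsub>H\<^esub> h, \<phi> (inv\<^bsub>H\<^esub> h) (inv\<^bsub>P\<^esub> x))"])
         (auto simp: semidirect_def g)
  qed (auto simp: semidirect_def act H.m_assoc P.m_assoc)
qed

lemma semidirect_conj:
  assumes "group H" "group P" "group_hom H (AutoGroup P) \<phi>"
    and "h \<in> carrier H" "x \<in> carrier P"
  shows "(h, \<one>\<^bsub>P\<^esub>) \<otimes>\<^bsub>semidirect H P \<phi>\<^esub> (\<one>\<^bsub>H\<^esub>, x) =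
    (\<one>\<^bsub>H\<^esub>, \<phi> h x) \<otimes>\<^bsub>semidirect H P \<phi>\<^esub> (h, \<one>\<^bsub>P\<^esub>)"
proof -
  interpret H: group H by fact
  interpret P: group P by fact
  show ?thesis
    using assms by (simp add: semidirect_def hom_AutoGroup)
qed

section \<open>Modules over a group algebra\<close>

text \<open>For a field \<open>K\<close> and a group \<open>H\<close>, a \<open>K[H]\<close>-module is given by a \<open>K\<close>-vector space \<open>V\<close>
  and a map \<open>\<rho>\<close> describing the action of the elements of \<open>H\<close> as \<open>K\<close>-linear maps; the action of
  the group algebra is the \<open>K\<close>-linear extension of \<open>\<rho>\<close>.  Submodules, homomorphisms and
  direct sums are those of \<open>K\<close>-spaces that respect \<open>\<rho>\<close>.\<close>

locale group_module = vectorspace K V + H: group H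
  for K :: "('k, 'r) ring_scheme" and H :: "('a, 'm) monoid_scheme"
    and V :: "('k, 'v, 'n) module_scheme" (structure)
    and \<rho> :: "'a \<Rightarrow> 'v \<Rightarrow> 'v" +
  assumes act_linear: "h \<in> carrier H \<Longrightarrow> \<rho> h \<in> module_hom K V V"
    and act_mult: "\<lbrakk>h \<in> carrier H; k \<in> carrier H; v \<in> carrier V\<rbrakk> \<Longrightarrow>
          \<rho> (h \<otimes>\<^bsub>H\<^esub> k) v = \<rho> h (\<rho> k v)"
    and act_one: "v \<in> carrier V \<Longrightarrow> \<rho> \<one>\<^bsub>H\<^esub> v = v"

definition group_submodule ::
    "('k, 'r) ring_scheme \<Rightarrow> ('a, 'm) monoid_scheme \<Rightarrow> ('k, 'v, 'n) module_scheme \<Rightarrow>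
     ('a \<Rightarrow> 'v \<Rightarrow> 'v) \<Rightarrow> 'v set \<Rightarrow> bool" where
  "group_submodule K H V \<rho> W \<longleftrightarrow>
     subspace K W V \<and> (\<forall>h\<in>carrier H. \<forall>w\<in>W. \<rho> h w \<in> W)"

definition irreducible_group_module ::
    "('k, 'r) ring_scheme \<Rightarrow> ('a, 'm) monoid_scheme \<Rightarrow> ('k, 'v, 'n) module_scheme \<Rightarrow>
     ('a \<Rightarrow> 'v \<Rightarrow> 'v) \<Rightarrow> bool" where
  "irreducible_group_module K H V \<rho> \<longleftrightarrow>
     group_module K H V \<rho> \<and> carrier V \<noteq> {\<zero>\<^bsub>V\<^esub>} \<and>
     (\<forall>W. group_submodule K H V \<rho> W \<longrightarrow> W = {\<zero>\<^bsub>V\<^esub>} \<or> W = carrier V)"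

definition irreducible_submodule ::
    "('k, 'r) ring_scheme \<Rightarrow> ('a, 'm) monoid_scheme \<Rightarrow> ('k, 'v, 'n) module_scheme \<Rightarrow>
     ('a \<Rightarrow> 'v \<Rightarrow> 'v) \<Rightarrow> 'v set \<Rightarrow> bool" where
  "irreducible_submodule K H V \<rho> W \<longleftrightarrow>
     group_submodule K H V \<rho> W \<and> irreducible_group_module K H (V\<lparr>carrier := W\<rparr>) \<rho>"

definition isomorphic_group_modules ::
    "('k, 'r) ring_scheme \<Rightarrow> ('a, 'm) monoid_scheme \<Rightarrow> ('k, 'v, 'n) module_scheme \<Rightarrow>
     ('a \<Rightarrow> 'v \<Rightarrow> 'v) \<Rightarrow> ('k, 'w, 'q) module_scheme \<Rightarrow> ('a \<Rightarrow> 'w \<Rightarrow> 'w) \<Rightarrow> bool" where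
  "isomorphic_group_modules K H V \<rho> V' \<rho>' \<longleftrightarrow>
     (\<exists>f \<in> module_hom K V V'. bij_betw f (carrier V) (carrier V') \<and>
        (\<forall>h\<in>carrier H. \<forall>v\<in>carrier V. f (\<rho> h v) = \<rho>' h (f v)))"

definition internal_direct_sum ::
    "('k, 'v, 'n) module_scheme \<Rightarrow> 'i set \<Rightarrow> ('i \<Rightarrow> 'v set) \<Rightarrow> bool" where
  "internal_direct_sum V I W \<longleftrightarrow>
     (\<forall>v\<in>carrier V. \<exists>!w. w \<in> (\<Pi>\<^sub>E i\<in>I. W i) \<and> v = (\<Oplus>\<^bsub>V\<^esub>i\<in>I. w i))"

text \<open>Only finite direct sums are allowed, which is no restriction for finite modules.\<close>

definition homogeneous ::
    "('k, 'r) ring_scheme \<Rightarrow> ('a, 'm) monoid_scheme \<Rightarrow> ('k, 'v, 'n) module_scheme \<Rightarrow>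
     ('a \<Rightarrow> 'v \<Rightarrow> 'v) \<Rightarrow> bool" where
  "homogeneous K H V \<rho> \<longleftrightarrow> group_module K H V \<rho> \<and>
     (\<exists>(k::nat) W. (\<forall>i<k. irreducible_submodule K H V \<rho> (W i)) \<and>
        (\<forall>i<k. \<forall>j<k. isomorphic_group_modules K H
            (V\<lparr>carrier := W i\<rparr>) \<rho> (V\<lparr>carrier := W j\<rparr>) \<rho>) \<and>
        internal_direct_sum V {..<k} W)"

section \<open>Elementary abelian sections as modules\<close>

abbreviation prime_field :: "nat \<Rightarrow> int ring" where
  "prime_field p \<equiv> residue_ring (int p)"

text \<open>An elementary abelian \<open>p\<close>-group, written additively, as a vector space over
  \<open>prime_field p\<close>, whose elements are the integers \<open>0, \<dots>, p - 1\<close>.  The ring multiplication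
  and unit contained in module records play no role.\<close>

definition additive_module :: "('a, 'm) monoid_scheme \<Rightarrow> (int, 'a) module" where
  "additive_module A =
     \<lparr>carrier = carrier A, monoid.mult = undefined, one = undefined,
      zero = \<one>\<^bsub>A\<^esub>, add = monoid.mult A, smult = (\<lambda>k x. x [^]\<^bsub>A\<^esub> k)\<rparr>"

definition conj_action :: "('g, 'm) monoid_scheme \<Rightarrow> ('a \<Rightarrow> 'g) \<Rightarrow> 'a \<Rightarrow> 'g \<Rightarrow> 'g" where
  "conj_action G \<iota> h x = \<iota> h \<otimes>\<^bsub>G\<^esub> x \<otimes>\<^bsub>G\<^esub> inv\<^bsub>G\<^esub> (\<iota> h)"

end

theory Submission
  imports
    "Jordan_Normal_Form.Char_Poly"
    "HOL-Algebra.Group_Action"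
    "HOL-Algebra.Multiplicative_Group"
    "HOL-Algebra.Sylow"
    "HOL-Algebra.Zassenhaus"
    Defs
begin

text \<open>Everything is reduced to a statement about one module. The quotient
\<open>V = P / (\<Phi>(G) \<inter> P)\<close> is an elementary abelian group on which \<open>H\<close> acts faithfully, and a
subgroup of \<open>V\<close> of order \<open>p^(d-s)\<close> has a preimage \<open>X\<close> in \<open>P\<close> of order \<open>p^d\<close>. If \<open>K\<close> complements
\<open>X\<close> in \<open>G\<close>, then the image of \<open>K \<inter> P\<close> is normalised by \<open>K\<close> and by the abelian group \<open>V\<close>, hence by
\<open>H\<close>. So every subspace of \<open>V\<close> of dimension \<open>m = d - s\<close> has an \<open>H\<close>-invariant complement
(\<open>complement_descends\<close>, \<open>complemented\<close>), and \<open>0 < m < dim V\<close>.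

The crucial consequence concerns pairs of irreducible submodules \<open>S\<close>, \<open>T\<close> with \<open>S\<close> of largest
dimension. Some invariant \<open>R\<close> can be split off so that the complement property survives on \<open>S T\<close>
for a dimension strictly between 0 and \<open>dim (S T)\<close> (\<open>complements_in_product\<close>). But \<open>S T\<close> has very few
submodules. If \<open>S\<close> and \<open>T\<close> are not isomorphic there are only the four obvious ones, and a subspace
containing a vector of \<open>S\<close> and a vector of \<open>T\<close> defeats all of them unless both have dimension 1
(\<open>nonisomorphic_imp_card\<close>). Hence either all irreducible submodules are one-dimensional, or all
are isomorphic, of one dimension \<open>e > 1\<close>; in the second case dimensions of submodules are multiples
of \<open>e\<close>, which gives the divisibilities (\<open>dichotomy\<close>, \<open>dimension_dvd\<close>).

In the one-dimensional case \<open>H\<close> acts by commuting scalars on the irreducible submodules, so \<open>H\<close> is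
abelian and adding one irreducible submodule, then one element of \<open>H\<close>, at a time gives a normal series
with cyclic factors (\<open>supersolvable_quotient\<close>).

In the isomorphic case let \<open>E\<close> be the endomorphism ring of \<open>S\<close>. After \<open>T\<close> is
identified with \<open>S\<close>, a nontrivial proper submodule of \<open>S T\<close> is \<open>T\<close> or the graph of an element of \<open>E\<close>,
and in each case it meets \<open>E s \<times> E s\<close> nontrivially for every nontrivial \<open>s\<close> in \<open>S\<close>. If \<open>E s\<close> were
smaller than \<open>S\<close>, this product would fit into a subspace of the dimension of \<open>S\<close>, which then could
have no invariant complement; so \<open>E s = S\<close> (\<open>endo_orbit\<close>). By Schur's lemma \<open>E\<close> is a finite division ring
and by Wedderburn's theorem (\<open>wedderburn_little\<close>) a field, so that \<open>S\<close> is a line over \<open>E\<close>, the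
elements of \<open>H\<close> act on it as scalars, and \<open>H\<close> embeds into the cyclic group of units of \<open>E\<close>
(\<open>cyclic_acting_group\<close>).

For the reduction, Maschke's theorem on \<open>P / \<Phi>(P)\<close> yields \<open>\<Phi>(G) \<inter> P = \<Phi>(P)\<close>, so that a subgroup of \<open>P\<close>
supplementing \<open>\<Phi>(G) \<inter> P\<close> is \<open>P\<close> (\<open>P_nongenerator\<close>). An element of prime order \<open>q\<close> acting trivially
on \<open>V\<close> fixes a point in every coset of \<open>\<Phi>(G) \<inter> P\<close>, because \<open>q\<close> does not divide the size of the coset;
its centraliser is such a supplement, and so \<open>H\<close> acts faithfully on \<open>V\<close> (\<open>faithful_quotient\<close>).\<close>

section \<open>Wedderburn's little theorem\<close>

lemma int_poly_prime_factor_with_root: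
  fixes f :: "int poly" and z :: complex
  assumes "f \<noteq> 0" "poly (map_poly of_int f) z = 0"
  shows "\<exists>g. prime_elem g \<and> g dvd f \<and> poly (map_poly of_int g) z = 0"
  using assms
proof (induction f rule: prime_divisors_induct)
  case (unit u)
  then obtain c where "u = [:c:]" "c dvd 1"
    by (auto simp: is_unit_poly_iff)
  then show ?case using unit by (auto simp: map_poly_pCons)
next
  case (factor g f)
  have "map_poly of_int (g * f) = (map_poly of_int g * map_poly of_int f :: complex poly)"
    by (rule of_int_poly_hom.hom_mult)
  then consider "poly (map_poly of_int g) z = 0" | "poly (map_poly of_int f) z = 0"
    using factor by auto
  then show ?case
  proof cases
    case 1
    then show ?thesis using factor by (intro exI[of _ g]) auto
  next
    case 2
    then show ?thesis using factor by (metis dvd_mult mult_zero_right)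
  qed
qed simp

lemma prod_mset_gt:
  fixes c :: real
  assumes "c \<ge> 1" "M \<noteq> {#}" "\<And>x. x \<in># M \<Longrightarrow> f x > c"
  shows "(\<Prod>x\<in>#M. f x) > c"
  using assms(2,3)
proof (induction M rule: multiset_induct)
  case (add x M)
  show ?case
  proof (cases "M = {#}")
    case False
    then have "(\<Prod>x\<in>#M. f x) > c" using add by auto
    moreover have "f x > c" using add by auto
    ultimately have "c * 1 < f x * (\<Prod>x\<in>#M. f x)"
      using assms(1) by (intro mult_strict_mono') auto
    then show ?thesis by simp
  qed (use add in auto)
qed simp

lemma dist_root_of_unity_gt:
  fixes x :: complex and q :: real
  assumes "norm x = 1" "x \<noteq> 1" "q > 0"
  shows "norm (of_real q - x) > q - 1"
proof -
  have sq: "(Re x)\<^sup>2 + (Im x)\<^sup>2 = 1"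
    using assms(1) by (metis cmod_power2 one_power2)
  have "Re x < 1"
  proof (rule ccontr)
    assume "\<not> Re x < 1"
    then have a: "Re x \<ge> 1" by simp
    then have "(Re x)\<^sup>2 \<ge> 1" by (simp add: one_le_power)
    moreover have "(Im x)\<^sup>2 \<ge> 0" by simp
    ultimately have "(Im x)\<^sup>2 = 0" "(Re x)\<^sup>2 = 1" using sq by linarith+
    then have "Im x = 0" "Re x = 1" using a by (auto simp: power2_eq_1_iff)
    then show False using assms(2) by (simp add: complex_eq_iff)
  qed
  then have "q * Re x < q" using assms(3) by simp
  have "(q - 1)\<^sup>2 = q\<^sup>2 - 2 * q + 1" by (simp add: power2_diff)
  also have "\<dots> < q\<^sup>2 - 2 * (q * Re x) + 1" using \<open>q * Re x < q\<close> by simp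
  also have "\<dots> = (q - Re x)\<^sup>2 + (Im x)\<^sup>2" using sq by (simp add: power2_diff algebra_simps)
  also have "\<dots> = (norm (of_real q - x))\<^sup>2" by (simp add: cmod_power2)
  finally show ?thesis
    by (meson norm_ge_zero not_less power_mono_even power_mono abs_le_square_iff power2_less_imp_less)
qed

text \<open>The number \<open>N\<close> is the absolute value at \<open>q\<close> of an irreducible integer polynomial \<open>g\<close> vanishing at a
primitive \<open>n\<close>-th root of unity, that is, of the \<open>n\<close>-th cyclotomic polynomial. Being prime and no factor of
\<open>X^k - 1\<close>, it divides the cofactor of \<open>X^k - 1\<close> in \<open>X^n - 1\<close>. Its complex roots are roots of unity
other than 1, so each factor of \<open>|g(q)|\<close> exceeds \<open>q - 1\<close>.\<close>

lemma cyclotomic_value_factor: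
  fixes q n :: nat
  assumes "q \<ge> 2" "n \<ge> 2"
  shows "\<exists>N::nat. N > q - 1 \<and> N dvd q ^ n - 1 \<and>
    (\<forall>k. 0 < k \<longrightarrow> k < n \<longrightarrow> k dvd n \<longrightarrow> N * (q ^ k - 1) dvd q ^ n - 1)"
proof -
  define X :: "nat \<Rightarrow> int poly" where "X = (\<lambda>k. Polynomial.monom 1 k - 1)"
  define \<zeta> where "\<zeta> = cis (2 * pi / n)"
  have X_at: "poly (map_poly of_int (X k)) z = z ^ k - (1::complex)" for k z
    by (simp add: X_def of_int_poly_hom.hom_minus poly_monom)
  have X_int: "poly (X k) (int q) = int (q ^ k - 1)" for k
    using assms by (simp add: X_def poly_monom of_nat_diff)
  have \<zeta>_pow: "\<zeta> ^ n = 1" using assms by (simp add: \<zeta>_def DeMoivre)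
  have \<zeta>_ne: "\<zeta> ^ k \<noteq> 1" if "0 < k" "k < n" for k
  proof
    assume "\<zeta> ^ k = 1"
    then have "cos (2 * pi * k / n) = 1"
      by (simp add: \<zeta>_def DeMoivre complex_eq_iff mult.commute)
    then obtain j :: int where "2 * pi * k / n = of_int j * 2 * pi"
      by (metis cos_one_2pi_int)
    then have "real k = of_int j * n" using assms by (simp add: field_simps)
    then have "int k = j * int n" by (metis of_int_eq_iff of_int_mult of_int_of_nat_eq)
    then have "int n dvd int k" by simp
    then show False using that zdvd_not_zless by fastforce
  qed
  have X0: "X n \<noteq> 0"
    using X_at[of n 0] assms by (auto simp: power_0_left)
  have deg: "Polynomial.lead_coeff (X n) = 1"
  proof -
    have "Polynomial.degree (Polynomial.monom 1 n + (-1) :: int poly) = Polynomial.degree (Polynomial.monom (1::int) n)"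
      by (rule degree_add_eq_left) (use assms in \<open>simp add: degree_monom_eq\<close>)
    then have "Polynomial.degree (X n) = n" by (simp add: X_def degree_monom_eq)
    then show ?thesis using assms by (simp add: X_def)
  qed
  obtain g where g: "prime_elem g" "g dvd X n" "poly (map_poly of_int g) \<zeta> = 0"
    using int_poly_prime_factor_with_root[OF X0, of \<zeta>] X_at \<zeta>_pow by auto
  let ?g = "map_poly of_int g :: complex poly"
  obtain h where h: "X n = g * h" using g(2) by blast
  have lc: "\<bar>Polynomial.lead_coeff g\<bar> = 1"
    using deg h by (metis lead_coeff_mult dvdI zdvd1_eq)
  have degg: "Polynomial.degree g \<noteq> 0"
  proof
    assume "Polynomial.degree g = 0"
    then obtain c where "g = [:c:]" by (meson degree_eq_zeroE)
    then show False using g lc by (auto simp: map_poly_pCons)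
  qed
  have cofactor: "\<exists>f. X n = f * X k \<and> g dvd f" if k: "0 < k" "k < n" "k dvd n" for k
  proof -
    obtain m where m: "n = k * m" using k(3) by (auto simp: dvd_def)
    have "X n = (Polynomial.monom 1 k) ^ m - 1" by (simp add: X_def monom_power m)
    then have f: "X n = (\<Sum>i<m. Polynomial.monom 1 k ^ i) * X k"
      by (simp add: X_def power_diff_1_eq mult.commute)
    have "\<not> g dvd X k"
    proof
      assume "g dvd X k"
      then have "?g dvd map_poly of_int (X k)" by (rule of_int_poly_hom.hom_dvd)
      then have "poly (map_poly of_int (X k)) \<zeta> = 0" using g(3) by auto
      then show False using X_at \<zeta>_ne k by simp
    qed
    then show ?thesis using f g prime_elem_dvd_multD by metis
  qed
  have roots: "norm x = 1" "x \<noteq> 1" if "poly ?g x = 0" for x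
  proof -
    have "?g dvd map_poly of_int (X n)" by (rule of_int_poly_hom.hom_dvd[OF g(2)])
    then have "poly (map_poly of_int (X n)) x = 0" using that by auto
    then have "x ^ n = 1" by (simp add: X_at)
    then have "norm x ^ n = 1" by (metis norm_one norm_power)
    then show "norm x = 1" using assms power_eq_imp_eq_base[of "norm x" n 1] by simp
    obtain f where f: "X n = f * X 1" "g dvd f" using cofactor[of 1] assms by auto
    have "X n = X 1 * (\<Sum>i<n. Polynomial.monom 1 1 ^ i)"
      using power_diff_1_eq[of "Polynomial.monom (1::int) 1" n] by (simp add: X_def monom_power)
    moreover have "X 1 \<noteq> 0" using X_at[of 1 0] by auto
    ultimately have fe: "f = (\<Sum>i<n. Polynomial.monom 1 1 ^ i)" using f(1)
      by (metis mult.commute mult_cancel_left)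
    have "poly (map_poly of_int f) (1::complex) = of_int (poly f 1)"
      using of_int_hom.poly_map_poly[where ?'a = complex, of f 1] by (simp only: of_int_1)
    also have "poly f 1 = int n" by (simp add: fe poly_sum poly_monom monom_power)
    finally have n: "poly (map_poly of_int f) (1::complex) \<noteq> 0" using assms by simp
    obtain u where "map_poly of_int f = ?g * u"
      using of_int_poly_hom.hom_dvd[OF f(2)] by (elim dvdE)
    then have "poly (map_poly of_int f) x = 0" using that by simp
    then show "x \<noteq> 1" using n by metis
  qed
  define N where "N = nat \<bar>poly g (int q)\<bar>"
  have N: "int N dvd poly g (int q)" by (simp add: N_def)
  have "real q - 1 < norm (poly ?g (of_nat q))"
  proof -
    have ne: "?g \<noteq> 0" using degg by (auto)
    obtain M where M: "size M = Polynomial.degree ?g" "?g = Polynomial.smult (Polynomial.lead_coeff ?g) (\<Prod>x\<in>#M. [:- x, 1:])"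
      using alg_closed_imp_factorization[OF ne] by blast
    have "Polynomial.lead_coeff ?g = of_int (Polynomial.lead_coeff g)" by simp
    then have lcg: "norm (Polynomial.lead_coeff ?g) = 1" using lc by (metis norm_of_int of_int_1 of_int_abs)
    have "\<And>z. poly ?g z = Polynomial.lead_coeff ?g * (\<Prod>x\<in>#M. z - x)"
      by (subst M(2)) (simp add: poly_prod_mset image_mset.compositionality o_def)
    note ev = this
    have "norm (\<Prod>x\<in>#M. of_nat q - x) = (\<Prod>x\<in>#M. norm (of_nat q - x))"
      by (induction M) (auto simp: norm_mult)
    then have "norm (poly ?g (of_nat q)) = (\<Prod>x\<in>#M. norm (of_nat q - x))"
      using ev lcg by (simp add: norm_mult)
    moreover have "(\<Prod>x\<in>#M. norm (of_nat q - x)) > real q - 1"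
    proof (rule prod_mset_gt)
      show "M \<noteq> {#}" using M(1) degg by auto
      fix x assume "x \<in># M"
      then have "poly ?g x = 0" using ev by (auto simp: prod_mset_zero_iff)
      then show "norm (of_nat q - x) > real q - 1"
        using dist_root_of_unity_gt[of x "real q"] roots assms by simp
    qed (use assms in auto)
    ultimately show ?thesis by simp
  qed
  moreover have "poly ?g (of_nat q) = of_int (poly g (int q))"
    using of_int_hom.poly_map_poly[where ?'a = complex, of g "int q"] by (simp only: of_int_of_nat_eq)
  ultimately have "real q - 1 < \<bar>of_int (poly g (int q))\<bar>" by simp
  then have "N > q - 1" using assms by (simp add: N_def of_nat_diff)
  moreover have "N dvd q ^ n - 1"
  proof -
    have "int N dvd poly (X n) (int q)" using N g(2) by (metis h dvd_mult2 poly_mult)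
    then show ?thesis by (simp only: X_int int_dvd_int_iff)
  qed
  moreover have "N * (q ^ k - 1) dvd q ^ n - 1" if k: "0 < k" "k < n" "k dvd n" for k
  proof -
    obtain f where f: "X n = f * X k" "g dvd f" using cofactor[OF k] by blast
    have "int N dvd poly f (int q)" using N f(2) by (metis dvdE dvd_mult2 poly_mult)
    then have "int N * poly (X k) (int q) dvd poly (X n) (int q)"
      by (simp add: f(1))
    then show ?thesis by (metis X_int int_dvd_int_iff of_nat_mult)
  qed
  ultimately show ?thesis by blast
qed


lemma power_minus_one_dvd_imp_dvd:
  fixes q k n :: nat
  assumes "q \<ge> 2" "k > 0" "q ^ k - 1 dvd q ^ n - 1"
  shows "k dvd n"
  using assms(3)
proof (induction n rule: less_induct)
  case (less n)
  show ?case
  proof (cases "n < k")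
    case True
    have "q ^ n < q ^ k" using True assms by (simp add: power_strict_increasing)
    then have "q ^ n - 1 < q ^ k - 1" using assms by (simp add: diff_less_mono)
    then have "q ^ n - 1 = 0" using less.prems by (metis dvd_imp_le gr0I not_less)
    then have "q ^ n \<le> 1" by simp
    then have "n = 0" using one_less_power[of q n] assms(1) by (cases "n = 0") auto
    then show ?thesis by simp
  next
    case False
    then have e: "q ^ n - 1 = q ^ (n - k) * (q ^ k - 1) + (q ^ (n - k) - 1)"
      using assms by (simp add: algebra_simps power_add[symmetric])
    have "q ^ k - 1 dvd q ^ (n - k) - 1"
      using less.prems unfolding e using dvd_add_right_iff[of "q ^ k - 1" "q ^ (n - k) * (q ^ k - 1)"] by simp
    then have "k dvd n - k" using less.IH[of "n - k"] False assms by simp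
    then show ?thesis using False dvd_diffD1[of k n k] by (auto simp: not_less dvd_minus_self)
  qed
qed

text \<open>This is the count of a vector space over the division ring \<open>Z\<close>, done without bases: a subspace
\<open>L\<close> maximal among those of the right size is \<open>M\<close>, since \<open>L + Z x\<close> has \<open>|Z|\<close> times as many elements.\<close>

lemma (in ring) card_power_of_division_subring:
  assumes fin: "finite (carrier R)"
    and Z: "Z \<subseteq> carrier R" "\<one> \<in> Z" "\<And>a b. a \<in> Z \<Longrightarrow> b \<in> Z \<Longrightarrow> a \<oplus> b \<in> Z"
      "\<And>a. a \<in> Z \<Longrightarrow> \<ominus> a \<in> Z"
      "\<And>a b. a \<in> Z \<Longrightarrow> b \<in> Z \<Longrightarrow> a \<otimes> b \<in> Z"
      "\<And>a. a \<in> Z \<Longrightarrow> a \<noteq> \<zero> \<Longrightarrow> \<exists>b\<in>Z. b \<otimes> a = \<one>"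
    and M: "M \<subseteq> carrier R" "\<zero> \<in> M" "\<And>a b. a \<in> M \<Longrightarrow> b \<in> M \<Longrightarrow> a \<oplus> b \<in> M"
      "\<And>a b. a \<in> Z \<Longrightarrow> b \<in> M \<Longrightarrow> a \<otimes> b \<in> M"
  shows "\<exists>k. card M = card Z ^ k"
proof -
  define good where "good = (\<lambda>L. L \<subseteq> M \<and> \<zero> \<in> L \<and> (\<forall>a\<in>L. \<forall>b\<in>L. a \<oplus> b \<in> L) \<and>
    (\<forall>a\<in>Z. \<forall>b\<in>L. a \<otimes> b \<in> L) \<and> (\<exists>k. card L = card Z ^ k))"
  have finM: "finite M" using fin M(1) finite_subset by blast
  have "good {\<zero>}" using M Z(1) by (auto simp: good_def intro: exI[of _ 0])
  then obtain L where L: "good L" "\<And>L'. good L' \<Longrightarrow> card L' \<le> card L"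
    using ex_has_greatest_nat[of good "{\<zero>}" card "Suc (card M)"] finM
    by (metis good_def card_mono less_Suc_eq_le)
  have LR: "L \<subseteq> carrier R" using L(1) M(1) by (auto simp: good_def)
  have neg: "\<ominus> b \<in> L" if "b \<in> L" for b
  proof -
    have "\<ominus> \<one> \<otimes> b \<in> L" using L(1) Z that by (auto simp: good_def)
    then show ?thesis using that LR by (simp add: subset_iff l_minus)
  qed
  have "L = M"
  proof (rule ccontr)
    assume "L \<noteq> M"
    then obtain x where x: "x \<in> M" "x \<notin> L" using L(1) by (auto simp: good_def)
    then have xR: "x \<in> carrier R" using M by auto
    define f where "f = (\<lambda>(l, z). l \<oplus> z \<otimes> x)"
    have "inj_on f (L \<times> Z)"
    proof (rule inj_onI, clarify)
      fix l z l' z' assume *: "l \<in> L" "z \<in> Z" "l' \<in> L" "z' \<in> Z" "f (l, z) = f (l', z')"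
      note R = subsetD[OF LR *(1)] subsetD[OF LR *(3)] subsetD[OF Z(1) *(2)] subsetD[OF Z(1) *(4)] xR
      have "l \<oplus> z \<otimes> x = l' \<oplus> z' \<otimes> x" using * by (simp add: f_def)
      then have "z \<otimes> x = \<ominus> l \<oplus> (l' \<oplus> z' \<otimes> x)"
        using R r_neg1[of l "z \<otimes> x"] by simp
      also have "\<dots> = (l' \<ominus> l) \<oplus> z' \<otimes> x"
        using R by (simp add: minus_eq a_ac)
      finally have "z \<otimes> x \<ominus> z' \<otimes> x = l' \<ominus> l"
        using R by (simp add: minus_eq a_assoc r_neg)
      then have eq: "(z \<ominus> z') \<otimes> x = l' \<ominus> l"
        using R by (simp add: minus_eq l_distr l_minus)
      have "z = z'"
      proof (rule ccontr)
        assume "z \<noteq> z'"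
        then have "z \<ominus> z' \<noteq> \<zero>" using R by simp
        moreover have "z \<ominus> z' \<in> Z" using Z(3,4) * by (simp add: minus_eq)
        ultimately obtain b where b: "b \<in> Z" "b \<otimes> (z \<ominus> z') = \<one>" using Z(6) by blast
        have "b \<otimes> ((z \<ominus> z') \<otimes> x) = x" using b R Z(1) by (subst m_assoc[symmetric]) auto
        moreover have "l' \<ominus> l \<in> L" using L(1) neg * by (simp add: minus_eq good_def)
        ultimately have "x \<in> L" using eq L(1) b(1) by (metis good_def)
        then show False using x by simp
      qed
      then have "l' \<ominus> l = \<zero>" using eq R by (simp add: minus_eq r_neg)
      then show "l = l' \<and> z = z'" using \<open>z = z'\<close> R by simp
    qed
    then have "card (f ` (L \<times> Z)) = card L * card Z"
      by (simp add: card_image card_cartesian_product)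
    moreover have "good (f ` (L \<times> Z))"
    proof -
      have sub: "f ` (L \<times> Z) \<subseteq> M" using L(1) M x by (auto simp: good_def f_def)
      have "f (\<zero>, \<zero>) = \<zero>" using xR by (simp add: f_def)
      moreover have "\<zero> \<in> Z" using Z(2-4) by (metis (full_types) Z(1) r_neg subset_iff)
      ultimately have 0: "\<zero> \<in> f ` (L \<times> Z)"
        using L(1) by (metis good_def SigmaI image_eqI)
      have add: "f (l, z) \<oplus> f (l', z') \<in> f ` (L \<times> Z)"
        if "l \<in> L" "z \<in> Z" "l' \<in> L" "z' \<in> Z" for l z l' z'
      proof -
        have "f (l, z) \<oplus> f (l', z') = f (l \<oplus> l', z \<oplus> z')"
          using that LR Z(1) xR by (simp add: f_def subset_iff l_distr a_ac)
        then show ?thesis using that L(1) Z(3) by (auto simp: good_def)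
      qed
      have mul: "c \<otimes> f (l, z) \<in> f ` (L \<times> Z)" if "c \<in> Z" "l \<in> L" "z \<in> Z" for c l z
      proof -
        have "c \<otimes> f (l, z) = f (c \<otimes> l, c \<otimes> z)"
          using that LR Z(1) xR by (simp add: f_def subset_iff r_distr m_assoc)
        then show ?thesis using that L(1) Z(5) by (auto simp: good_def)
      qed
      obtain k where "card L = card Z ^ k" using L(1) by (auto simp: good_def)
      then have "card (f ` (L \<times> Z)) = card Z ^ Suc k"
        using \<open>card (f ` (L \<times> Z)) = card L * card Z\<close> by simp
      then show ?thesis using sub 0 add mul unfolding good_def by blast
    qed
    ultimately have "card L * card Z \<le> card L" using L(2) by metis
    moreover have "card L > 0" using L(1) finM by (metis card_gt_0_iff emptyE finite_subset good_def)
    moreover have "card Z \<ge> 2"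
    proof -
      have "\<one> \<noteq> \<zero>" using x xR L(1) by (metis good_def l_null l_one)
      moreover have "\<zero> \<in> Z" using Z(2-4) by (metis (full_types) Z(1) r_neg subset_iff)
      ultimately have "card {\<zero>, \<one>} = 2" "{\<zero>, \<one>} \<subseteq> Z" using Z(2) by auto
      then show ?thesis using fin Z(1) by (metis card_mono finite_subset)
    qed
    ultimately show False by simp
  qed
  then show ?thesis using L(1) by (auto simp: good_def)
qed

text \<open>Witt's proof. With \<open>q\<close> the order of the centre, the class equation of the unit group writes
\<open>q^n - 1\<close> as \<open>q - 1\<close> plus class sizes \<open>(q^n - 1) / (q^k - 1)\<close> with \<open>k < n\<close>. The number \<open>N\<close> of
\<open>cyclotomic_value_factor\<close> divides \<open>q^n - 1\<close> and all of these, hence \<open>q - 1\<close>, which is smaller than \<open>N\<close>.\<close>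

theorem (in ring) wedderburn_little:
  assumes fin: "finite (carrier R)" and ne: "\<one> \<noteq> \<zero>"
    and division: "carrier R - {\<zero>} \<subseteq> Units R"
    and xy: "x \<in> carrier R" "y \<in> carrier R"
  shows "x \<otimes> y = y \<otimes> x"
proof (rule ccontr)
  assume noncomm: "x \<otimes> y \<noteq> y \<otimes> x"
  define Z where "Z = {z \<in> carrier R. \<forall>y\<in>carrier R. z \<otimes> y = y \<otimes> z}"
  define C where "C = (\<lambda>x. {y \<in> carrier R. y \<otimes> x = x \<otimes> y})"
  define q where "q = card Z"
  let ?U = "carrier R - {\<zero>}"
  have U: "Units R = ?U"
    using division ne by (auto simp: Units_def)
  have ZR: "Z \<subseteq> carrier R" by (auto simp: Z_def)
  have inv_comm: "inv z \<otimes> y = y \<otimes> inv z"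
    if "z \<in> ?U" "y \<in> carrier R" "z \<otimes> y = y \<otimes> z" for z y
  proof -
    have z: "z \<in> Units R" using that U by simp
    have "inv z \<otimes> (z \<otimes> y) \<otimes> inv z = inv z \<otimes> (y \<otimes> z) \<otimes> inv z" using that by simp
    moreover have "inv z \<otimes> (z \<otimes> y) = y"
      using z that(1,2) by (simp add: m_assoc[symmetric])
    moreover have "inv z \<otimes> (y \<otimes> z) \<otimes> inv z = inv z \<otimes> y"
      using z that(1,2) by (simp add: m_assoc)
    ultimately show ?thesis by simp
  qed
  have Z_one: "\<one> \<in> Z" by (simp add: Z_def)
  have Z_add: "a \<oplus> b \<in> Z" and Z_mult: "a \<otimes> b \<in> Z" if "a \<in> Z" "b \<in> Z" for a b
  proof -
    have R: "a \<in> carrier R" "b \<in> carrier R" using that ZR by auto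
    have comm: "a \<otimes> y = y \<otimes> a" "b \<otimes> y = y \<otimes> b" if "y \<in> carrier R" for y
      using \<open>a \<in> Z\<close> \<open>b \<in> Z\<close> that by (simp_all add: Z_def)
    have "(a \<oplus> b) \<otimes> y = y \<otimes> (a \<oplus> b)" if y: "y \<in> carrier R" for y
      using R y comm[OF y] by (simp only: l_distr r_distr)
    then show "a \<oplus> b \<in> Z" using R by (simp add: Z_def)
    have "a \<otimes> b \<otimes> y = y \<otimes> (a \<otimes> b)" if y: "y \<in> carrier R" for y
    proof -
      have "a \<otimes> b \<otimes> y = a \<otimes> (y \<otimes> b)" using R y comm(2)[OF y] by (simp only: m_assoc)
      also have "\<dots> = y \<otimes> a \<otimes> b" using R y comm(1)[OF y] by (simp only: m_assoc[symmetric])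
      finally show ?thesis using R y by (simp only: m_assoc)
    qed
    then show "a \<otimes> b \<in> Z" using R by (simp add: Z_def)
  qed
  have Z_neg: "\<ominus> a \<in> Z" if "a \<in> Z" for a
    using that by (simp add: Z_def l_minus r_minus)
  have Z_inv: "\<exists>b\<in>Z. b \<otimes> a = \<one>" if "a \<in> Z" "a \<noteq> \<zero>" for a
  proof (rule bexI[of _ "inv a"])
    have a: "a \<in> Units R" using that U ZR by auto
    then show "inv a \<otimes> a = \<one>" by simp
    show "inv a \<in> Z" using that a inv_comm[of a] ZR by (auto simp: Z_def)
  qed
  note card_power = card_power_of_division_subring[OF fin ZR Z_one Z_add Z_neg Z_mult Z_inv]
  have finZ: "finite Z" using fin ZR finite_subset by blast
  have zero_Z: "\<zero> \<in> Z" by (simp add: Z_def)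
  have q2: "q \<ge> 2"
  proof -
    have "card {\<zero>, \<one>} \<le> card Z" using zero_Z Z_one finZ by (intro card_mono) auto
    then show ?thesis using ne by (simp add: q_def)
  qed
  obtain n where n: "card (carrier R) = q ^ n"
    using card_power[of "carrier R"] ZR by (auto simp: q_def)
  have "x \<notin> Z" using noncomm xy by (auto simp: Z_def)
  then have "card Z < card (carrier R)"
    using ZR xy fin by (intro psubset_card_mono) auto
  then have "q ^ 1 < q ^ n" using n by (simp add: q_def)
  then have n2: "n \<ge> 2" using power_less_imp_less_exp[of q 1 n] q2 by simp
  obtain N where N: "N > q - 1" "N dvd q ^ n - 1"
    "\<And>k. 0 < k \<Longrightarrow> k < n \<Longrightarrow> k dvd n \<Longrightarrow> N * (q ^ k - 1) dvd q ^ n - 1"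
    using cyclotomic_value_factor[OF q2 n2] by blast
  define G where "G = units_of R"
  interpret G: group G unfolding G_def by (rule units_group)
  define \<phi> where "\<phi> = (\<lambda>g. \<lambda>h\<in>carrier G. g \<otimes>\<^bsub>G\<^esub> h \<otimes>\<^bsub>G\<^esub> inv\<^bsub>G\<^esub> g)"
  interpret act: group_action G "carrier G" \<phi>
    unfolding \<phi>_def by (rule G.action_by_conjugation)
  have G_carrier: "carrier G = ?U" by (simp add: G_def units_of_def U)
  have G_mult: "a \<otimes>\<^bsub>G\<^esub> b = a \<otimes> b" for a b by (simp add: G_def units_of_def)
  have orderG: "Coset.order G = q ^ n - 1"
    using fin n by (simp add: Coset.order_def G_carrier card_Diff_singleton)
  have fixes_iff: "\<phi> g z = z \<longleftrightarrow> g \<otimes> z = z \<otimes> g" if "g \<in> ?U" "z \<in> ?U" for g z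
  proof -
    have gz: "g \<in> carrier G" "z \<in> carrier G" using that by (simp_all add: G_carrier)
    then have "\<phi> g z = z \<longleftrightarrow> g \<otimes>\<^bsub>G\<^esub> z = z \<otimes>\<^bsub>G\<^esub> g"
      by (simp add: \<phi>_def G.inv_solve_right')
    then show ?thesis by (simp add: G_mult)
  qed
  define \<C> where "\<C> = {orbit G \<phi> z |z. z \<in> ?U - Z}"
  have "N dvd card c" if c: "c \<in> \<C>" for c
  proof -
    obtain z where z: "z \<in> ?U" "z \<notin> Z" "c = orbit G \<phi> z"
      using c by (auto simp: \<C>_def)
    have zR: "z \<in> carrier R" using z by simp
    obtain k where k: "card (C z) = q ^ k"
    proof -
      have "\<exists>k. card (C z) = card Z ^ k"
      proof (rule card_power)
        show "a \<otimes> b \<in> C z" if "a \<in> Z" "b \<in> C z" for a b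
        proof -
          have ab: "a \<in> carrier R" "b \<in> carrier R" using that by (auto simp: Z_def C_def)
          have "a \<otimes> b \<otimes> z = a \<otimes> (z \<otimes> b)" using that ab zR by (simp add: C_def m_assoc)
          also have "\<dots> = (a \<otimes> z) \<otimes> b" using ab zR by (simp add: m_assoc)
          also have "\<dots> = (z \<otimes> a) \<otimes> b" using that zR by (simp add: Z_def)
          finally show ?thesis using ab zR by (simp add: C_def m_assoc)
        qed
      qed (use zR in \<open>auto simp: C_def l_distr r_distr\<close>)
      then show ?thesis using that by (auto simp: q_def)
    qed
    have "stabilizer G \<phi> z = C z - {\<zero>}"
      using fixes_iff z by (auto simp: stabilizer_def G_carrier C_def)
    moreover have "\<zero> \<in> C z" "finite (C z)" using zR fin by (auto simp: C_def)
    ultimately have "card (stabilizer G \<phi> z) = q ^ k - 1" using k by (simp add: card_Diff_singleton)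
    then have orb: "card c * (q ^ k - 1) = q ^ n - 1"
      using act.orbit_stabilizer_theorem[of z] z orderG by (simp add: G_carrier)
    have "{\<zero>, \<one>} \<subseteq> C z" using zR by (auto simp: C_def)
    then have "card {\<zero>, \<one>} \<le> q ^ k" using \<open>finite (C z)\<close> k by (metis card_mono)
    then have kpos: "k > 0" using ne by (cases k) auto
    obtain w where "w \<in> carrier R" "w \<notin> C z" using z by (auto simp: Z_def C_def)
    then have "card (C z) < card (carrier R)"
      using fin by (intro psubset_card_mono) (auto simp: C_def)
    then have "q ^ k < q ^ n" using k n by simp
    then have kn: "k < n" using power_less_imp_less_exp[of q k n] q2 by simp
    have "k dvd n"
      using power_minus_one_dvd_imp_dvd[OF q2 kpos] orb by (metis dvd_triv_right)
    then have "N * (q ^ k - 1) dvd card c * (q ^ k - 1)" using N(3) kpos kn orb by simp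
    moreover have "q ^ k - 1 \<noteq> 0" using q2 kpos one_less_power[of q k] by simp
    ultimately show ?thesis by (simp add: dvd_mult_cancel2)
  qed
  moreover have "c1 \<inter> c2 = {}" if "c1 \<in> \<C>" "c2 \<in> \<C>" "c1 \<noteq> c2" for c1 c2
  proof -
    have "c1 \<in> orbits G (carrier G) \<phi>" "c2 \<in> orbits G (carrier G) \<phi>"
      using that by (auto simp: \<C>_def orbits_def G_carrier)
    then show ?thesis using act.orbit_partition that(3) unfolding partition_def by blast
  qed
  moreover have union: "\<Union> \<C> = ?U - Z"
  proof
    show "?U - Z \<subseteq> \<Union> \<C>"
      using act.orbit_refl by (fastforce simp: \<C>_def G_carrier)
    show "\<Union> \<C> \<subseteq> ?U - Z"
    proof
      fix w assume "w \<in> \<Union> \<C>"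
      then obtain z g where z: "z \<in> ?U" "z \<notin> Z" and g: "g \<in> ?U" and w: "w = \<phi> g z"
        by (auto simp: \<C>_def orbit_def G_carrier)
      have wU: "w \<in> ?U" using act.element_image[of g z w] z g w by (simp add: G_carrier)
      have "w \<notin> Z"
      proof
        assume "w \<in> Z"
        have gz: "g \<in> carrier G" "z \<in> carrier G" "w \<in> carrier G"
          using z g wU by (simp_all add: G_carrier)
        then have "w \<otimes>\<^bsub>G\<^esub> g = g \<otimes>\<^bsub>G\<^esub> z"
          by (simp add: w \<phi>_def G.m_assoc)
        moreover have "w \<otimes> g = g \<otimes> w" using \<open>w \<in> Z\<close> g by (simp add: Z_def)
        ultimately have "g \<otimes>\<^bsub>G\<^esub> w = g \<otimes>\<^bsub>G\<^esub> z" by (simp add: G_mult)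
        then have "w = z" using gz by simp
        then show False using \<open>w \<in> Z\<close> z by simp
      qed
      then show "w \<in> ?U - Z" using wU by simp
    qed
  qed
  ultimately have "N dvd card (?U - Z)"
    using dvd_partition[of \<C> N] fin by auto
  moreover have "card ?U = card (?U - Z) + card (Z - {\<zero>})"
  proof -
    have "?U = (?U - Z) \<union> (Z - {\<zero>})" using ZR by auto
    then show ?thesis using fin finZ by (metis card_Un_disjoint Diff_disjoint Int_Diff finite_Diff inf_commute)
  qed
  moreover have "card (Z - {\<zero>}) = q - 1" using zero_Z finZ by (simp add: q_def card_Diff_singleton)
  moreover have "card ?U = q ^ n - 1" using orderG by (simp add: Coset.order_def G_carrier)
  ultimately have "N dvd q - 1" using N(2) by (metis dvd_add_right_iff)
  then show False using N(1) q2 by (auto dest: dvd_imp_le)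
qed

section \<open>Elementary abelian groups\<close>

context comm_group
begin

lemma set_mult_mem: "x \<in> X <#> Y \<longleftrightarrow> (\<exists>a\<in>X. \<exists>b\<in>Y. x = a \<otimes> b)"
  by (auto simp: set_mult_def)

lemma set_multI: "a \<in> X \<Longrightarrow> b \<in> Y \<Longrightarrow> a \<otimes> b \<in> X <#> Y"
  by (auto simp: set_mult_def)

lemma subset_set_mult:
  assumes "subgroup X G" "subgroup Y G"
  shows "X \<subseteq> X <#> Y" "Y \<subseteq> X <#> Y"
proof -
  note X = subgroup.mem_carrier[OF assms(1)] and Y = subgroup.mem_carrier[OF assms(2)]
  show "X \<subseteq> X <#> Y"
  proof
    fix x assume "x \<in> X"
    then show "x \<in> X <#> Y"
      using set_multI[OF \<open>x \<in> X\<close> subgroup.one_closed[OF assms(2)]] X by simp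
  qed
  show "Y \<subseteq> X <#> Y"
  proof
    fix y assume "y \<in> Y"
    then show "y \<in> X <#> Y"
      using set_multI[OF subgroup.one_closed[OF assms(1)] \<open>y \<in> Y\<close>] Y by simp
  qed
qed

lemma set_mult_least:
  assumes "subgroup Y G" "X \<subseteq> Y" "Z \<subseteq> Y"
  shows "X <#> Z \<subseteq> Y"
  using assms subgroup.m_closed[OF assms(1)] by (fastforce simp: set_mult_mem)

text \<open>Dedekind's modular law; it takes the place of linear algebra when complements are intersected
with larger subgroups.\<close>

lemma subgroup_dedekind:
  assumes "subgroup X G" "subgroup Y G" "subgroup Z G" "X \<subseteq> Z"
  shows "X <#> (Y \<inter> Z) = (X <#> Y) \<inter> Z"
proof
  show "X <#> (Y \<inter> Z) \<subseteq> (X <#> Y) \<inter> Z"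
    using assms set_mult_least[of Z X "Y \<inter> Z"] by (auto simp: set_multI)
      (auto simp: set_mult_def)
  show "(X <#> Y) \<inter> Z \<subseteq> X <#> (Y \<inter> Z)"
  proof
    fix z assume "z \<in> (X <#> Y) \<inter> Z"
    then obtain a b where ab: "a \<in> X" "b \<in> Y" "z = a \<otimes> b" "z \<in> Z" by (auto simp: set_mult_mem)
    have C: "a \<in> carrier G" "b \<in> carrier G"
      using ab assms subgroup.mem_carrier by metis+
    have "inv a \<otimes> z \<in> Z"
      using ab assms by (meson subgroup.m_closed subgroup.m_inv_closed subsetD)
    then have "b \<in> Z" using ab C by (simp add: m_assoc[symmetric])
    then show "z \<in> X <#> (Y \<inter> Z)" using ab by (auto simp: set_mult_mem)
  qed
qed

lemma disjoint_unique:
  assumes "subgroup X G" "subgroup Y G" "X \<inter> Y = {\<one>}"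
    and "a \<in> X" "a' \<in> X" "b \<in> Y" "b' \<in> Y" "a \<otimes> b = a' \<otimes> b'"
  shows "a = a'" "b = b'"
proof -
  have C: "a \<in> carrier G" "a' \<in> carrier G" "b \<in> carrier G" "b' \<in> carrier G"
    using assms subgroup.mem_carrier by metis+
  have "inv a' \<otimes> a \<otimes> b = b'" using assms(8) C by (simp add: m_assoc) (simp add: m_assoc[symmetric])
  then have eq: "inv a' \<otimes> a = b' \<otimes> inv b" using C by (metis inv_closed inv_solve_right m_closed)
  have "inv a' \<otimes> a \<in> X" "b' \<otimes> inv b \<in> Y"
    using assms by (meson subgroup.m_closed subgroup.m_inv_closed)+
  then have "inv a' \<otimes> a = \<one>" using eq assms(3) by auto
  then show "a = a'" using C by (metis inv_equality inv_inv inv_closed)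
  then show "b = b'" using assms(8) C by simp
qed

lemma card_set_mult_disjoint:
  assumes "subgroup X G" "subgroup Y G" "X \<inter> Y = {\<one>}"
  shows "card (X <#> Y) = card X * card Y"
proof -
  have "X <#> Y = (\<lambda>(a, b). a \<otimes> b) ` (X \<times> Y)" by (auto simp: set_mult_def)
  moreover have "inj_on (\<lambda>(a, b). a \<otimes> b) (X \<times> Y)"
    using disjoint_unique[OF assms] by (auto intro!: inj_onI)
  ultimately show ?thesis by (simp add: card_image card_cartesian_product)
qed

lemma card_subgroup_dvd:
  assumes "subgroup X G" "subgroup Y G" "X \<subseteq> Y"
  shows "card X dvd card Y"
proof -
  interpret Y: group "G\<lparr>carrier := Y\<rparr>" by (rule subgroup.subgroup_is_group[OF assms(2) is_group])
  have "subgroup X (G\<lparr>carrier := Y\<rparr>)" using subgroup_incl[OF assms] .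
  then have "card X dvd Coset.order (G\<lparr>carrier := Y\<rparr>)"
    using Y.lagrange by (metis dvd_triv_right)
  then show ?thesis by (simp add: Coset.order_def)
qed

end

text \<open>Subspaces over the prime field are just subgroups, and dimensions are read off from orders, so
that linear algebra over \<open>prime_field p\<close> can be done in the language of groups.\<close>

locale elementary_abelian = comm_group +
  fixes p :: nat
  assumes prime_p: "prime p"
    and finite_carrier: "finite (carrier G)"
    and exponent: "x \<in> carrier G \<Longrightarrow> x [^] p = \<one>"
begin

lemma p_gt1: "p > 1"
  using prime_p by (rule prime_gt_1_nat)

lemma finite_sub: "subgroup X G \<Longrightarrow> finite X"
  using finite_carrier finite_subset subgroup.subset by blast

lemma card_sub_pos: "subgroup X G \<Longrightarrow> card X > 0"
  using finite_carrier subgroup.finite_imp_card_positive by blast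

lemma card_generate_singleton:
  assumes "x \<in> carrier G" "x \<noteq> \<one>"
  shows "card (generate G {x}) = p"
proof -
  have "ord x dvd p" using assms exponent pow_eq_id by simp
  then have "ord x = 1 \<or> ord x = p" using prime_p by (auto simp: prime_nat_iff)
  then have "ord x = p" using assms ord_eq_1 by auto
  then show ?thesis using assms generate_pow_card by simp
qed

lemma generate_singleton_sub:
  assumes "subgroup X G" "x \<in> X"
  shows "generate G {x} \<subseteq> X"
  using assms generate_subgroup_incl by auto

lemma generate_singleton_disjoint:
  assumes "subgroup X G" "x \<in> carrier G" "x \<notin> X"
  shows "X \<inter> generate G {x} = {\<one>}"
proof -
  let ?C = "generate G {x}"
  have C: "subgroup ?C G" using assms by (intro generate_is_subgroup) auto
  have I: "subgroup (X \<inter> ?C) G" using assms(1) C by (rule subgroups_Inter_pair)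
  have "card (X \<inter> ?C) dvd card ?C" using card_subgroup_dvd[OF I C] by simp
  moreover have x1: "x \<noteq> \<one>" using assms subgroup.one_closed by blast
  ultimately have "card (X \<inter> ?C) = 1 \<or> card (X \<inter> ?C) = p"
    using card_generate_singleton[OF assms(2)] prime_p by (auto simp: prime_nat_iff)
  moreover have "card (X \<inter> ?C) \<noteq> p"
  proof
    assume "card (X \<inter> ?C) = p"
    then have "X \<inter> ?C = ?C"
      using card_generate_singleton[OF assms(2) x1] finite_sub[OF C] by (intro card_subset_eq) auto
    then show False using assms(3) generate.incl[of x "{x}" G] by auto
  qed
  ultimately obtain y where "X \<inter> ?C = {y}" using card_1_singletonE by metis
  then show ?thesis using subgroup.one_closed[OF I] by auto
qed

lemma extend_by_one:
  assumes "subgroup X G" "x \<in> carrier G" "x \<notin> X"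
  shows "subgroup (X <#> generate G {x}) G" "x \<in> X <#> generate G {x}"
    "card (X <#> generate G {x}) = card X * p"
proof -
  have C: "subgroup (generate G {x}) G" using assms by (intro generate_is_subgroup) auto
  show "subgroup (X <#> generate G {x}) G" using assms(1) C by (rule mult_subgroups)
  show "x \<in> X <#> generate G {x}"
    using subset_set_mult(2)[OF assms(1) C] generate.incl[of x "{x}" G] by auto
  have "x \<noteq> \<one>" using assms subgroup.one_closed by blast
  then show "card (X <#> generate G {x}) = card X * p"
    using card_set_mult_disjoint[OF assms(1) C generate_singleton_disjoint[OF assms]]
      card_generate_singleton[OF assms(2)] by simp
qed

lemma subgroup_chain:
  assumes "subgroup X G" "subgroup Y G" "X \<subseteq> Y"
  shows "\<exists>j. card Y = card X * p ^ j \<and>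
    (\<forall>i\<le>j. \<exists>Z. subgroup Z G \<and> X \<subseteq> Z \<and> Z \<subseteq> Y \<and> card Z = card X * p ^ i)"
  using assms(1,3)
proof (induction "card Y - card X" arbitrary: X rule: less_induct)
  case less
  show ?case
  proof (cases "X = Y")
    case True
    then show ?thesis using less.prems by (intro exI[of _ 0]) auto
  next
    case False
    then obtain x where x: "x \<in> Y" "x \<notin> X" using less.prems by auto
    have xc: "x \<in> carrier G" using x assms(2) subgroup.mem_carrier by metis
    let ?X = "X <#> generate G {x}"
    note ext = extend_by_one[OF less.prems(1) xc x(2)]
    have sub: "X \<subseteq> ?X"
      using less.prems(1) generate_is_subgroup[of "{x}"] xc by (intro subset_set_mult) auto
    have subY: "?X \<subseteq> Y"
      using generate_singleton_sub[OF assms(2) x(1)] less.prems(2) assms(2)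
      by (intro set_mult_least) auto
    have "card X < card ?X" using ext(3) p_gt1 card_sub_pos[OF less.prems(1)] by simp
    moreover have "card ?X \<le> card Y" using subY finite_sub[OF assms(2)] by (rule card_mono[rotated])
    ultimately have "card Y - card ?X < card Y - card X" by simp
    from less.hyps[OF this ext(1) subY] obtain j where j: "card Y = card ?X * p ^ j"
      "\<And>i. i \<le> j \<Longrightarrow> \<exists>Z. subgroup Z G \<and> ?X \<subseteq> Z \<and> Z \<subseteq> Y \<and> card Z = card ?X * p ^ i" by blast
    show ?thesis
    proof (intro exI[of _ "Suc j"] conjI allI impI)
      show "card Y = card X * p ^ Suc j" using j(1) ext(3) by simp
      fix i assume i: "i \<le> Suc j"
      show "\<exists>Z. subgroup Z G \<and> X \<subseteq> Z \<and> Z \<subseteq> Y \<and> card Z = card X * p ^ i"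
      proof (cases i)
        case 0
        then show ?thesis using less.prems by (intro exI[of _ X]) auto
      next
        case (Suc i')
        then obtain Z where "subgroup Z G" "?X \<subseteq> Z" "Z \<subseteq> Y" "card Z = card ?X * p ^ i'"
          using j(2)[of i'] i by auto
        then show ?thesis using sub ext(3) Suc by (intro exI[of _ Z]) auto
      qed
    qed
  qed
qed

lemma card_subgroup_power:
  assumes "subgroup X G"
  shows "\<exists>k. card X = p ^ k"
  using subgroup_chain[OF triv_subgroup assms] subgroup.one_closed[OF assms] by auto

text \<open>Used to enlarge a small subgroup that meets unwanted submodules to one of prescribed order.\<close>

lemma subgroup_between:
  assumes "subgroup X G" "subgroup Y G" "X \<subseteq> Y" "card X \<le> p ^ i" "p ^ i \<le> card Y"
  shows "\<exists>Z. subgroup Z G \<and> X \<subseteq> Z \<and> Z \<subseteq> Y \<and> card Z = p ^ i"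
proof -
  obtain k where k: "card X = p ^ k" using card_subgroup_power[OF assms(1)] by blast
  obtain j where j: "card Y = card X * p ^ j"
    "\<And>i. i \<le> j \<Longrightarrow> \<exists>Z. subgroup Z G \<and> X \<subseteq> Z \<and> Z \<subseteq> Y \<and> card Z = card X * p ^ i"
    using subgroup_chain[OF assms(1-3)] by blast
  have "k \<le> i" using assms(4) k p_gt1 by simp
  moreover have "p ^ i \<le> p ^ (k + j)" using assms(5) j(1) k by (simp add: power_add)
  then have "i \<le> k + j" using p_gt1 by simp
  ultimately have "card X * p ^ (i - k) = p ^ i" "i - k \<le> j"
    using k by (simp_all add: power_add[symmetric])
  then show ?thesis using j(2)[of "i - k"] by auto
qed

lemma complement_exists:
  assumes "subgroup B G"
  shows "\<exists>C. subgroup C G \<and> B \<inter> C = {\<one>} \<and> B <#> C = carrier G"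
proof -
  define good where "good = (\<lambda>C. subgroup C G \<and> B \<inter> C = {\<one>})"
  have "good {\<one>}" using triv_subgroup subgroup.one_closed[OF assms] by (auto simp: good_def)
  moreover have "\<forall>C. good C \<longrightarrow> card C < Suc (card (carrier G))"
    using finite_carrier subgroup.subset by (auto simp: good_def less_Suc_eq_le intro: card_mono)
  ultimately obtain C where C: "good C" "\<And>C'. good C' \<Longrightarrow> card C' \<le> card C"
    using ex_has_greatest_nat[of good "{\<one>}" card] by metis
  have sC: "subgroup C G" and BC1: "B \<inter> C = {\<one>}" using C(1) by (auto simp: good_def)
  have BC: "subgroup (B <#> C) G" using mult_subgroups[OF assms sC] .
  have "B <#> C = carrier G"
  proof (rule ccontr)
    assume "B <#> C \<noteq> carrier G"
    then obtain x where x: "x \<in> carrier G" "x \<notin> B <#> C"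
      using subgroup.subset[OF BC] by auto
    then have xC: "x \<notin> C" using subset_set_mult(2)[OF assms sC] by auto
    note ext = extend_by_one[OF sC x(1) xC]
    have gx: "subgroup (generate G {x}) G" using x by (intro generate_is_subgroup) auto
    have "B \<inter> (C <#> generate G {x}) \<subseteq> {\<one>}"
    proof
      fix b assume "b \<in> B \<inter> (C <#> generate G {x})"
      then obtain c y where bc: "b \<in> B" "c \<in> C" "y \<in> generate G {x}" "b = c \<otimes> y"
        by (auto simp: set_mult_mem)
      have cc: "b \<in> carrier G" "c \<in> carrier G" "y \<in> carrier G"
        using bc assms sC gx subgroup.mem_carrier by metis+
      have "y = b \<otimes> inv c" using bc cc by (metis inv_closed inv_solve_right m_comm m_closed)
      then have "y \<in> B <#> C" using bc sC by (metis set_multI subgroup.m_inv_closed)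
      then have "y = \<one>" using generate_singleton_disjoint[OF BC x] bc by auto
      then have "b = c" using bc cc by simp
      then show "b \<in> {\<one>}" using bc BC1 by auto
    qed
    then have "good (C <#> generate G {x})"
      using ext(1) assms subgroup.one_closed by (fastforce simp: good_def)
    then have "card C * p \<le> card C" using C(2) ext(3) by metis
    then show False using card_sub_pos[OF sC] p_gt1 by simp
  qed
  then show ?thesis using sC BC1 by blast
qed

lemma pow_mod_p: "x \<in> carrier G \<Longrightarrow> x [^] (k mod p) = x [^] (k :: nat)"
proof -
  assume x: "x \<in> carrier G"
  have "x [^] (p * (k div p) + k mod p) = (x [^] p) [^] (k div p) \<otimes> x [^] (k mod p)"
    using x by (simp add: nat_pow_mult nat_pow_pow)
  then show ?thesis using x exponent by simp
qed

end

section \<open>Coprime group actions on elementary abelian groups\<close>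

text \<open>The module \<open>A\<close> is written multiplicatively.\<close>

locale coprime_action = elementary_abelian A p + H: group H
  for A (structure) and p and H :: "('h, 'n) monoid_scheme" +
  fixes \<rho> :: "'h \<Rightarrow> 'a \<Rightarrow> 'a"
  assumes finite_H: "finite (carrier H)"
    and coprime_H: "coprime (Coset.order H) p"
    and act_closed: "h \<in> carrier H \<Longrightarrow> x \<in> carrier A \<Longrightarrow> \<rho> h x \<in> carrier A"
    and act_mult: "h \<in> carrier H \<Longrightarrow> x \<in> carrier A \<Longrightarrow> y \<in> carrier A \<Longrightarrow>
      \<rho> h (x \<otimes> y) = \<rho> h x \<otimes> \<rho> h y"
    and act_comp: "h \<in> carrier H \<Longrightarrow> k \<in> carrier H \<Longrightarrow> x \<in> carrier A \<Longrightarrow>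
      \<rho> (h \<otimes>\<^bsub>H\<^esub> k) x = \<rho> h (\<rho> k x)"
    and act_id: "x \<in> carrier A \<Longrightarrow> \<rho> \<one>\<^bsub>H\<^esub> x = x"
begin

definition invariant :: "'a set \<Rightarrow> bool" where
  "invariant W \<longleftrightarrow> subgroup W A \<and> (\<forall>h\<in>carrier H. \<forall>w\<in>W. \<rho> h w \<in> W)"

definition irreducible_sub :: "'a set \<Rightarrow> bool" where
  "irreducible_sub S \<longleftrightarrow> invariant S \<and> S \<noteq> {\<one>} \<and>
    (\<forall>W. invariant W \<longrightarrow> W \<subseteq> S \<longrightarrow> W = {\<one>} \<or> W = S)"

lemma act_one: "h \<in> carrier H \<Longrightarrow> \<rho> h \<one> = \<one>"
  using act_mult[of h \<one> \<one>] act_closed[of h \<one>] by simp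

lemma act_inv:
  assumes "h \<in> carrier H" "x \<in> carrier A"
  shows "\<rho> h (inv x) = inv (\<rho> h x)"
  using assms act_mult[of h "inv x" x] act_closed act_one by (metis inv_closed inv_equality l_inv)

lemma act_pow:
  assumes "h \<in> carrier H" "x \<in> carrier A"
  shows "\<rho> h (x [^] (k::nat)) = \<rho> h x [^] k"
  by (induction k) (use assms in \<open>auto simp: act_one act_mult act_closed\<close>)

lemma act_cancel:
  assumes "h \<in> carrier H" "x \<in> carrier A"
  shows "\<rho> h (\<rho> (inv\<^bsub>H\<^esub> h) x) = x" "\<rho> (inv\<^bsub>H\<^esub> h) (\<rho> h x) = x"
  using assms act_comp[of h "inv\<^bsub>H\<^esub> h" x] act_comp[of "inv\<^bsub>H\<^esub> h" h x] act_id by auto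

lemma invariant_sub: "invariant W \<Longrightarrow> subgroup W A"
  and invariant_act: "invariant W \<Longrightarrow> h \<in> carrier H \<Longrightarrow> w \<in> W \<Longrightarrow> \<rho> h w \<in> W"
  and invariant_mem: "invariant W \<Longrightarrow> w \<in> W \<Longrightarrow> w \<in> carrier A"
  and invariant_one: "invariant W \<Longrightarrow> \<one> \<in> W"
  by (auto simp: invariant_def subgroup.mem_carrier subgroup.one_closed)

lemma irr_invariant: "irreducible_sub S \<Longrightarrow> invariant S"
  and irr_ne: "irreducible_sub S \<Longrightarrow> S \<noteq> {\<one>}"
  and irr_cases: "irreducible_sub S \<Longrightarrow> invariant W \<Longrightarrow> W \<subseteq> S \<Longrightarrow> W = {\<one>} \<or> W = S"
  by (auto simp: irreducible_sub_def)

lemma invariant_triv: "invariant {\<one>}"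
  using triv_subgroup by (simp add: invariant_def act_one)

lemma invariant_carrier: "invariant (carrier A)"
  using subgroup_self by (simp add: invariant_def act_closed)

lemma invariant_Int: "invariant X \<Longrightarrow> invariant Y \<Longrightarrow> invariant (X \<inter> Y)"
  using subgroups_Inter_pair by (auto simp: invariant_def)

lemma invariant_set_mult:
  assumes "invariant X" "invariant Y"
  shows "invariant (X <#> Y)"
  unfolding invariant_def
proof (intro conjI ballI)
  show "subgroup (X <#> Y) A" using assms mult_subgroups invariant_sub by blast
  fix h w assume h: "h \<in> carrier H" and "w \<in> X <#> Y"
  then obtain x y where xy: "x \<in> X" "y \<in> Y" "w = x \<otimes> y" by (auto simp: set_mult_mem)
  then have "\<rho> h w = \<rho> h x \<otimes> \<rho> h y" using assms h invariant_mem act_mult by metis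
  then show "\<rho> h w \<in> X <#> Y" using assms xy h invariant_act set_multI by metis
qed

lemma exists_irr:
  assumes "invariant W" "W \<noteq> {\<one>}"
  shows "\<exists>S. irreducible_sub S \<and> S \<subseteq> W"
proof -
  define Q where "Q = (\<lambda>S. invariant S \<and> S \<noteq> {\<one>} \<and> S \<subseteq> W)"
  have "Q W" using assms by (simp add: Q_def)
  then obtain S where S: "Q S" "\<And>S'. Q S' \<Longrightarrow> card S \<le> card S'"
    using ex_has_least_nat[of Q W card] by blast
  have "X = S" if "invariant X" "X \<subseteq> S" "X \<noteq> {\<one>}" for X
  proof -
    have "card S \<le> card X" using S(2)[of X] S(1) that by (auto simp: Q_def)
    then show ?thesis using that(2) finite_sub[OF invariant_sub] S(1) by (metis Q_def card_seteq)
  qed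
  then have "irreducible_sub S" using S(1) by (auto simp: irreducible_sub_def Q_def)
  then show ?thesis using S(1) by (auto simp: Q_def)
qed

lemma act_finprod:
  assumes "h \<in> carrier H" "f \<in> I \<rightarrow> carrier A"
  shows "\<rho> h (finprod A f I) = finprod A (\<lambda>i. \<rho> h (f i)) I"
  using assms(2)
proof (induction I rule: infinite_finite_induct)
  case (insert i I)
  then have "f \<in> I \<rightarrow> carrier A" "f i \<in> carrier A" by auto
  moreover have "(\<lambda>i. \<rho> h (f i)) \<in> I \<rightarrow> carrier A" using calculation assms(1) act_closed by auto
  ultimately show ?case using insert assms(1) by (simp add: finprod_insert act_mult act_closed)
qed (use assms(1) act_one in auto)

text \<open>Averaging over \<open>H\<close> the projection \<open>\<pi>\<close> onto \<open>B\<close> along an arbitrary complement gives an equivariant \<open>\<psi>\<close>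
from \<open>A\<close> to \<open>B\<close>. The average is not divided by \<open>|H|\<close>, so \<open>\<psi>\<close> is the power map with exponent \<open>|H|\<close> on
\<open>B\<close>, which is bijective as \<open>|H|\<close> is prime to \<open>p\<close>; the kernel of \<open>\<psi>\<close> is the complement.\<close>

theorem maschke:
  assumes "invariant B"
  shows "\<exists>C. invariant C \<and> B \<inter> C = {\<one>} \<and> B <#> C = carrier A"
proof -
  note sB = invariant_sub[OF assms]
  obtain C0 where C0: "subgroup C0 A" "B \<inter> C0 = {\<one>}" "B <#> C0 = carrier A"
    using complement_exists[OF sB] by blast
  define \<pi> where "\<pi> = (\<lambda>x. THE b. b \<in> B \<and> (\<exists>c\<in>C0. x = b \<otimes> c))"
  have \<pi>_eq: "\<pi> x = b" if "b \<in> B" "c \<in> C0" "x = b \<otimes> c" for x b c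
    unfolding \<pi>_def
  proof (rule the_equality)
    fix b' assume "b' \<in> B \<and> (\<exists>c\<in>C0. x = b' \<otimes> c)"
    then show "b' = b" using disjoint_unique(1)[OF sB C0(1,2)] that by metis
  qed (use that in auto)
  have split: "\<exists>b\<in>B. \<exists>c\<in>C0. x = b \<otimes> c" if "x \<in> carrier A" for x
    using that C0(3) by (auto simp: set_mult_mem)
  have mem: "b \<in> carrier A" if "b \<in> B" for b using that assms invariant_mem by blast
  have memC: "c \<in> carrier A" if "c \<in> C0" for c using that C0(1) subgroup.mem_carrier by metis
  have \<pi>_B: "\<pi> x \<in> B" if "x \<in> carrier A" for x using split[OF that] \<pi>_eq by metis
  have \<pi>_id: "\<pi> b = b" if "b \<in> B" for b
    using \<pi>_eq[of b \<one> b] that subgroup.one_closed[OF C0(1)] mem by simp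
  have \<pi>_mult: "\<pi> (x \<otimes> y) = \<pi> x \<otimes> \<pi> y" if xy: "x \<in> carrier A" "y \<in> carrier A" for x y
  proof -
    obtain b c where x: "b \<in> B" "c \<in> C0" "x = b \<otimes> c" using split[OF xy(1)] by blast
    obtain b' c' where y: "b' \<in> B" "c' \<in> C0" "y = b' \<otimes> c'" using split[OF xy(2)] by blast
    have "x \<otimes> y = (b \<otimes> b') \<otimes> (c \<otimes> c')" using x y mem memC by (simp add: m_ac)
    then have "\<pi> (x \<otimes> y) = b \<otimes> b'"
      using x y sB C0(1) by (intro \<pi>_eq) (auto simp: subgroup.m_closed)
    then show ?thesis using \<pi>_eq x y by metis
  qed
  define f where "f = (\<lambda>x h. \<rho> h (\<pi> (\<rho> (inv\<^bsub>H\<^esub> h) x)))"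
  define \<psi> where "\<psi> = (\<lambda>x. finprod A (f x) (carrier H))"
  have fB: "f x h \<in> B" if "x \<in> carrier A" "h \<in> carrier H" for x h
    using that assms \<pi>_B act_closed by (simp add: f_def invariant_act)
  then have fC: "f x \<in> carrier H \<rightarrow> carrier A" if "x \<in> carrier A" for x using that mem by auto
  have \<psi>_B: "\<psi> x \<in> B" if "x \<in> carrier A" for x
  proof -
    have "finprod A (f x) I \<in> B" if "I \<subseteq> carrier H" for I
      using finite_subset[OF that finite_H] that
    proof (induction I rule: finite_induct)
      case (insert i I)
      have "finprod A (f x) (insert i I) = f x i \<otimes> finprod A (f x) I"
        using insert fC[OF \<open>x \<in> carrier A\<close>] by (intro finprod_insert) auto
      then show ?case using insert fB[OF \<open>x \<in> carrier A\<close>] sB by (simp add: subgroup.m_closed)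
    qed (use sB subgroup.one_closed in auto)
    then show ?thesis by (simp add: \<psi>_def)
  qed
  have \<psi>_mult: "\<psi> (x \<otimes> y) = \<psi> x \<otimes> \<psi> y" if "x \<in> carrier A" "y \<in> carrier A" for x y
  proof -
    have "f (x \<otimes> y) h = f x h \<otimes> f y h" if h: "h \<in> carrier H" for h
      using \<open>x \<in> carrier A\<close> \<open>y \<in> carrier A\<close> h \<pi>_B mem
      by (simp add: f_def act_mult act_closed \<pi>_mult)
    then have "\<psi> (x \<otimes> y) = finprod A (\<lambda>h. f x h \<otimes> f y h) (carrier H)"
      unfolding \<psi>_def using that fC by (intro finprod_cong) (auto simp: Pi_iff)
    then show ?thesis using that fC by (simp add: \<psi>_def finprod_multf)
  qed
  have \<psi>_act: "\<psi> (\<rho> k x) = \<rho> k (\<psi> x)" if x: "x \<in> carrier A" and k: "k \<in> carrier H" for x k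
  proof -
    have "f (\<rho> k x) (k \<otimes>\<^bsub>H\<^esub> h) = \<rho> k (f x h)" if h: "h \<in> carrier H" for h
    proof -
      have "\<rho> (inv\<^bsub>H\<^esub> (k \<otimes>\<^bsub>H\<^esub> h)) (\<rho> k x) = \<rho> (inv\<^bsub>H\<^esub> h) x"
        using x k h act_closed act_cancel(2)[OF k x] by (simp add: H.inv_mult_group act_comp)
      then show ?thesis using x k h \<pi>_B mem act_closed by (simp add: f_def act_comp)
    qed
    note step = this
    have bij: "bij_betw (\<lambda>h. k \<otimes>\<^bsub>H\<^esub> h) (carrier H) (carrier H)"
      by (rule bij_betw_byWitness[where f' = "\<lambda>h. inv\<^bsub>H\<^esub> k \<otimes>\<^bsub>H\<^esub> h"])
        (use k in \<open>auto simp: H.m_assoc[symmetric]\<close>)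
    have "\<psi> (\<rho> k x) = finprod A (f (\<rho> k x)) ((\<lambda>h. k \<otimes>\<^bsub>H\<^esub> h) ` carrier H)"
      using bij by (simp add: \<psi>_def bij_betw_def)
    also have "\<dots> = finprod A (\<lambda>h. f (\<rho> k x) (k \<otimes>\<^bsub>H\<^esub> h)) (carrier H)"
      using bij fC[of "\<rho> k x"] x k act_closed
      by (intro finprod_reindex) (auto simp: bij_betw_def)
    also have "\<dots> = finprod A (\<lambda>h. \<rho> k (f x h)) (carrier H)"
      using step fC[OF x] k act_closed by (intro finprod_cong) (auto simp: Pi_iff simp_implies_def)
    also have "\<dots> = \<rho> k (\<psi> x)" using act_finprod[OF k fC[OF x]] by (simp add: \<psi>_def)
    finally show ?thesis .
  qed
  have \<psi>_pow: "\<psi> b = b [^] Coset.order H" if "b \<in> B" for b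
  proof -
    have "f b h = b" if "h \<in> carrier H" for h
      using that \<open>b \<in> B\<close> assms mem by (simp add: f_def \<pi>_id invariant_act act_cancel)
    then have "\<psi> b = finprod A (\<lambda>h. b) (carrier H)"
      unfolding \<psi>_def using mem[OF that] by (intro finprod_cong) auto
    then show ?thesis using finprod_const[OF mem[OF that]] by (simp add: Coset.order_def)
  qed
  define C where "C = {x \<in> carrier A. \<psi> x = \<one>}"
  have \<psi>_one: "\<psi> \<one> = \<one>"
    using \<psi>_pow[of \<one>] subgroup.one_closed[OF sB] by simp
  have \<psi>_inv: "\<psi> (inv x) = inv (\<psi> x)" if "x \<in> carrier A" for x
    using \<psi>_mult[of "inv x" x] that \<psi>_one \<psi>_B mem by (metis inv_closed inv_equality l_inv)
  have "invariant C"
    unfolding invariant_def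
  proof (intro conjI ballI)
    show "subgroup C A"
      by (rule subgroupI) (auto simp: C_def \<psi>_mult \<psi>_inv intro!: exI[of _ \<one>] \<psi>_one)
    show "\<rho> h w \<in> C" if "h \<in> carrier H" "w \<in> C" for h w
      using that by (simp add: C_def \<psi>_act act_closed act_one)
  qed
  obtain u where "[Coset.order H * u = 1] (mod p)"
    using cong_solve_coprime_nat[of "Coset.order H" p] coprime_H by auto
  then have u: "(u * Coset.order H) mod p = 1"
    using p_gt1 by (simp add: cong_def mult.commute)
  have pow_u: "(x [^] u) [^] Coset.order H = x" if "x \<in> carrier A" for x
    using that pow_mod_p[OF that, of "u * Coset.order H"] u by (simp add: nat_pow_pow)
  moreover have "B \<inter> C = {\<one>}"
  proof -
    have "b = \<one>" if "b \<in> B" "b \<in> C" for b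
    proof -
      have bC: "b \<in> carrier A" using that mem by blast
      have "b [^] Coset.order H = \<one>" using that \<psi>_pow by (simp add: C_def)
      moreover have "(b [^] u) [^] Coset.order H = (b [^] Coset.order H) [^] u"
        using bC by (simp add: nat_pow_pow mult.commute)
      ultimately show ?thesis using pow_u[OF bC] by simp
    qed
    then show ?thesis using sB \<open>invariant C\<close> invariant_one subgroup.one_closed by blast
  qed
  moreover have "B <#> C = carrier A"
  proof
    show "B <#> C \<subseteq> carrier A" using sB \<open>invariant C\<close>
      by (intro set_mult_closed) (auto dest: invariant_mem subgroup.mem_carrier)
    show "carrier A \<subseteq> B <#> C"
    proof
      fix x assume x: "x \<in> carrier A"
      define b where "b = \<psi> x [^] u"
      have bB: "b \<in> B" unfolding b_def
        by (induction u) (use \<psi>_B[OF x] sB in \<open>auto simp: subgroup.one_closed subgroup.m_closed\<close>)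
      have "\<psi> b = \<psi> x" using \<psi>_pow[OF bB] pow_u \<psi>_B[OF x] mem by (simp add: b_def)
      then have "inv b \<otimes> x \<in> C"
        using x mem[OF bB] \<psi>_B[OF x] mem by (simp add: C_def \<psi>_mult \<psi>_inv)
      moreover have "x = b \<otimes> (inv b \<otimes> x)" using x mem[OF bB] by (simp add: m_assoc[symmetric])
      ultimately show "x \<in> B <#> C" using bB set_multI by metis
    qed
  qed
  ultimately show ?thesis using \<open>invariant C\<close> by blast
qed

lemma irr_outside:
  assumes "invariant D" "D \<noteq> carrier A"
  shows "\<exists>T. irreducible_sub T \<and> D \<inter> T = {\<one>}"
proof -
  obtain C where C: "invariant C" "D \<inter> C = {\<one>}" "D <#> C = carrier A"
    using maschke[OF assms(1)] by blast
  have "C \<noteq> {\<one>}"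
  proof
    assume "C = {\<one>}"
    then have "D <#> C = D" using invariant_mem[OF assms(1)] by (auto simp: set_mult_def)
    then show False using C assms by simp
  qed
  then obtain T where T: "irreducible_sub T" "T \<subseteq> C" using exists_irr C by blast
  then have "D \<inter> T = {\<one>}"
    using C(2) invariant_one[OF assms(1)] invariant_one[OF irr_invariant[OF T(1)]] by blast
  then show ?thesis using T by blast
qed

end

section \<open>Irreducible submodules and Schur's lemma\<close>

context coprime_action
begin

definition equiv_hom :: "'a set \<Rightarrow> 'a set \<Rightarrow> ('a \<Rightarrow> 'a) set" where
  "equiv_hom S T = {f. f \<in> S \<rightarrow> T \<and> (\<forall>x\<in>S. \<forall>y\<in>S. f (x \<otimes> y) = f x \<otimes> f y) \<and>
    (\<forall>h\<in>carrier H. \<forall>x\<in>S. f (\<rho> h x) = \<rho> h (f x))}"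

definition equivariant_iso :: "'a set \<Rightarrow> 'a set \<Rightarrow> bool" where
  "equivariant_iso S T \<longleftrightarrow> (\<exists>f\<in>equiv_hom S T. bij_betw f S T)"

lemma equiv_homD:
  assumes "f \<in> equiv_hom S T"
  shows "x \<in> S \<Longrightarrow> f x \<in> T" "x \<in> S \<Longrightarrow> y \<in> S \<Longrightarrow> f (x \<otimes> y) = f x \<otimes> f y"
    "h \<in> carrier H \<Longrightarrow> x \<in> S \<Longrightarrow> f (\<rho> h x) = \<rho> h (f x)"
  using assms by (auto simp: equiv_hom_def)

lemma equiv_hom_one:
  assumes "f \<in> equiv_hom S T" "invariant S" "invariant T"
  shows "f \<one> = \<one>"
proof -
  have "f \<one> \<otimes> f \<one> = f \<one>"
    using equiv_homD(2)[OF assms(1), of \<one> \<one>] invariant_one[OF assms(2)] by simp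
  moreover have "f \<one> \<in> carrier A"
    using assms equiv_homD(1) invariant_one invariant_mem by metis
  ultimately show ?thesis by simp
qed

lemma equiv_hom_inv:
  assumes "f \<in> equiv_hom S T" "invariant S" "invariant T" "x \<in> S"
  shows "f (inv x) = inv (f x)"
proof -
  have x: "x \<in> carrier A" "inv x \<in> S"
    using assms(2,4) invariant_mem invariant_sub subgroup.m_inv_closed by metis+
  then have "f (inv x) \<otimes> f x = \<one>"
    using equiv_homD(2)[OF assms(1), of "inv x" x] equiv_hom_one[OF assms(1-3)] assms(4) by simp
  moreover have "f x \<in> carrier A" "f (inv x) \<in> carrier A"
    using x assms equiv_homD(1) invariant_mem by metis+
  ultimately show ?thesis by (metis inv_equality)
qed

lemma equiv_hom_comp:
  assumes "f \<in> equiv_hom S T" "g \<in> equiv_hom T U"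
  shows "(\<lambda>x. g (f x)) \<in> equiv_hom S U"
  using equiv_homD[OF assms(1)] equiv_homD[OF assms(2)] unfolding equiv_hom_def by simp

lemma equiv_hom_inverse:
  assumes "f \<in> equiv_hom S T" "bij_betw f S T" "invariant S"
  shows "inv_into S f \<in> equiv_hom T S"
proof -
  let ?g = "inv_into S f"
  have g: "?g y \<in> S" "f (?g y) = y" if "y \<in> T" for y
    using that assms(2) by (auto simp: bij_betw_def inv_into_into f_inv_into_f)
  have gf: "?g (f x) = x" if "x \<in> S" for x
    using that assms(2) by (auto simp: bij_betw_def)
  have "?g (x \<otimes> y) = ?g x \<otimes> ?g y" if "x \<in> T" "y \<in> T" for x y
  proof -
    have "?g x \<otimes> ?g y \<in> S" using g that assms(3) by (simp add: invariant_sub subgroup.m_closed)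
    moreover have "f (?g x \<otimes> ?g y) = x \<otimes> y" using g that equiv_homD(2)[OF assms(1)] by simp
    ultimately show ?thesis using gf by metis
  qed
  moreover have "?g (\<rho> h x) = \<rho> h (?g x)" if "h \<in> carrier H" "x \<in> T" for h x
  proof -
    have "\<rho> h (?g x) \<in> S" using g that assms(3) invariant_act by simp
    moreover have "f (\<rho> h (?g x)) = \<rho> h x" using g that equiv_homD(3)[OF assms(1)] by simp
    ultimately show ?thesis using gf by metis
  qed
  ultimately show ?thesis using g by (auto simp: equiv_hom_def)
qed

lemma iso_refl: "equivariant_iso S S"
  unfolding equivariant_iso_def by (rule bexI[of _ "\<lambda>x. x"]) (auto simp: equiv_hom_def bij_betw_def)

lemma iso_sym: "equivariant_iso S T \<Longrightarrow> invariant S \<Longrightarrow> equivariant_iso T S"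
  unfolding equivariant_iso_def using equiv_hom_inverse bij_betw_inv_into by blast

lemma iso_trans: "equivariant_iso S T \<Longrightarrow> equivariant_iso T U \<Longrightarrow> equivariant_iso S U"
  unfolding equivariant_iso_def using equiv_hom_comp bij_betw_trans
  by (metis (no_types, lifting) comp_apply bij_betw_cong)

lemma iso_card: "equivariant_iso S T \<Longrightarrow> card S = card T"
  unfolding equivariant_iso_def using bij_betw_same_card by blast

lemma schur:
  assumes f: "f \<in> equiv_hom S T" and S: "irreducible_sub S" and T: "irreducible_sub T"
  shows "(\<forall>x\<in>S. f x = \<one>) \<or> bij_betw f S T"
proof -
  note iS = irr_invariant[OF S] and iT = irr_invariant[OF T]
  note hom = equiv_homD[OF f] and one = equiv_hom_one[OF f iS iT] and inv = equiv_hom_inv[OF f iS iT]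
  note sS = invariant_sub[OF iS] and sT = invariant_sub[OF iT]
  define K where "K = {x \<in> S. f x = \<one>}"
  have "subgroup K A"
  proof (rule subgroupI)
    show "K \<noteq> {}" using one invariant_one[OF iS] by (auto simp: K_def)
  qed (use iS sS hom inv in \<open>auto simp: K_def invariant_mem subgroup.m_inv_closed subgroup.m_closed\<close>)
  then have "invariant K"
    using hom(3) iS by (auto simp: invariant_def K_def act_one)
  then consider "K = {\<one>}" | "K = S" using irr_cases[OF S, of K] by (auto simp: K_def)
  then show ?thesis
  proof cases
    case 1
    have "inj_on f S"
    proof (rule inj_onI)
      fix x y assume xy: "x \<in> S" "y \<in> S" "f x = f y"
      have c: "x \<in> carrier A" "y \<in> carrier A" "f y \<in> carrier A"
        using xy hom(1) iS iT invariant_mem by metis+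
      have m: "inv y \<in> S" using xy sS subgroup.m_inv_closed by metis
      have "f (x \<otimes> inv y) = \<one>" using xy c m hom(2) inv by simp
      then have "x \<otimes> inv y \<in> K" using xy m sS by (simp add: K_def subgroup.m_closed)
      then have "x \<otimes> inv y = \<one>" using 1 by simp
      then show "x = y" using c by (simp add: inv_solve_right')
    qed
    moreover have "invariant (f ` S)"
    proof -
      have "subgroup (f ` S) A"
      proof (rule subgroupI)
        show "f ` S \<subseteq> carrier A" using hom(1) iT invariant_mem by blast
        show "f ` S \<noteq> {}" using invariant_one[OF iS] by blast
        show "inv a \<in> f ` S" if a: "a \<in> f ` S" for a
        proof -
          obtain x where "x \<in> S" "a = f x" using a by blast
          then have "inv a = f (inv x)" "inv x \<in> S"
            using inv subgroup.m_inv_closed[OF sS] by auto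
          then show ?thesis by blast
        qed
        show "a \<otimes> b \<in> f ` S" if ab: "a \<in> f ` S" "b \<in> f ` S" for a b
        proof -
          obtain x y where "x \<in> S" "y \<in> S" "a = f x" "b = f y" using ab by blast
          then have "a \<otimes> b = f (x \<otimes> y)" "x \<otimes> y \<in> S"
            using hom(2) subgroup.m_closed[OF sS] by auto
          then show ?thesis by blast
        qed
      qed
      moreover have "\<forall>h\<in>carrier H. \<forall>w\<in>f ` S. \<rho> h w \<in> f ` S"
      proof (intro ballI)
        fix h w assume h: "h \<in> carrier H" and "w \<in> f ` S"
        then obtain x where "x \<in> S" "w = f x" by blast
        then show "\<rho> h w \<in> f ` S" using hom(3)[OF h] invariant_act[OF iS h] by (metis imageI)
      qed
      ultimately show ?thesis by (simp add: invariant_def)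
    qed
    moreover have "f ` S \<subseteq> T" using hom(1) by blast
    moreover have "f ` S \<noteq> {\<one>}"
    proof -
      obtain x where x: "x \<in> S" "x \<noteq> \<one>" using irr_ne[OF S] invariant_one[OF iS] by blast
      then have "f x \<noteq> \<one>" using 1 by (auto simp: K_def)
      then show ?thesis using x by blast
    qed
    ultimately show ?thesis using irr_cases[OF T] by (metis bij_betw_def)
  qed (auto simp: K_def)
qed

lemma irr_disjoint:
  assumes "irreducible_sub S" "irreducible_sub T" "S \<noteq> T"
  shows "S \<inter> T = {\<one>}"
  using assms irr_cases[of S "S \<inter> T"] irr_cases[of T "S \<inter> T"]
  by (metis inf_le1 inf_le2 invariant_Int irr_invariant)

lemma irr_elem:
  assumes "irreducible_sub S"
  shows "\<exists>s\<in>S. s \<noteq> \<one>"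
  using irr_ne[OF assms] invariant_one[OF irr_invariant[OF assms]] by blast

lemma card_irr:
  assumes "irreducible_sub S"
  shows "\<exists>e. card S = p ^ e \<and> e > 0"
proof -
  obtain e where e: "card S = p ^ e"
    using card_subgroup_power[OF invariant_sub[OF irr_invariant[OF assms]]] by blast
  have "e \<noteq> 0"
  proof
    assume "e = 0"
    then obtain x where "S = {x}" using e card_1_singletonE by (metis power_0)
    then show False using irr_ne[OF assms] invariant_one[OF irr_invariant[OF assms]] by blast
  qed
  then show ?thesis using e by blast
qed

lemma card_irr_gt1: "irreducible_sub S \<Longrightarrow> card S > 1"
  using card_irr[of S] one_less_power[OF p_gt1] by auto

text \<open>The socle is everything: a largest invariant subgroup inside \<open>X\<close> cannot be proper, because some
irreducible submodule lies outside it.\<close>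

lemma irr_generate:
  assumes X: "subgroup X A" and "\<And>S. irreducible_sub S \<Longrightarrow> S \<subseteq> X"
  shows "X = carrier A"
proof -
  define Q where "Q = (\<lambda>D. invariant D \<and> D \<subseteq> X)"
  have "Q {\<one>}" using invariant_triv subgroup.one_closed[OF X] by (simp add: Q_def)
  moreover have "\<forall>D. Q D \<longrightarrow> card D < Suc (card X)"
    using finite_sub[OF X] by (auto simp: Q_def less_Suc_eq_le intro: card_mono)
  ultimately obtain D where D: "Q D" "\<And>D'. Q D' \<Longrightarrow> card D' \<le> card D"
    using ex_has_greatest_nat[of Q "{\<one>}" card] by metis
  have "D = carrier A"
  proof (rule ccontr)
    assume "D \<noteq> carrier A"
    then obtain T where T: "irreducible_sub T" "D \<inter> T = {\<one>}" using irr_outside[of D] D(1) \<open>D \<noteq> carrier A\<close> unfolding Q_def by blast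
    have "Q (D <#> T)"
      using D(1) T(1) X assms(2) set_mult_least invariant_set_mult irr_invariant by (auto simp: Q_def)
    then have "card D * card T \<le> card D"
      using D T card_set_mult_disjoint invariant_sub irr_invariant by (metis Q_def)
    moreover have "card D > 0" using D(1) card_sub_pos invariant_sub by (auto simp: Q_def)
    moreover have "card T > 1" using card_irr_gt1[OF T(1)] .
    ultimately show False by simp
  qed
  then show ?thesis using D(1) subgroup.subset[OF X] by (auto simp: Q_def)
qed

text \<open>Goursat's lemma for two simple modules. If \<open>W\<close> does not contain \<open>T\<close>, it meets \<open>T\<close> trivially, and
unless \<open>W\<close> is trivial its projection to \<open>S\<close> is all of \<open>S\<close>; then \<open>W\<close> is a graph.\<close>

lemma invariant_in_product:
  assumes S: "irreducible_sub S" and T: "irreducible_sub T" and ST: "S \<inter> T = {\<one>}"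
    and W: "invariant W" "W \<subseteq> S <#> T"
  shows "W = {\<one>} \<or> W = T \<or> W = S <#> T \<or> (\<exists>g\<in>equiv_hom S T. W = (\<lambda>x. x \<otimes> g x) ` S)"
proof -
  note iS = irr_invariant[OF S] and iT = irr_invariant[OF T]
  note sS = invariant_sub[OF iS] and sT = invariant_sub[OF iT] and sW = invariant_sub[OF W(1)]
  have mS: "x \<in> carrier A" if "x \<in> S" for x using that iS invariant_mem by blast
  have mT: "x \<in> carrier A" if "x \<in> T" for x using that iT invariant_mem by blast
  have mW: "x \<in> carrier A" if "x \<in> W" for x using that W invariant_mem by blast
  consider "W \<inter> T = {\<one>}" | "T \<subseteq> W"
    using irr_cases[OF T, of "W \<inter> T"] invariant_Int[OF W(1) iT] by blast
  then show ?thesis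
  proof cases
    case 2
    have TS: "T <#> S = S <#> T" using mS mT m_comm by (auto simp: set_mult_def) metis+
    have "T <#> (S \<inter> W) = (T <#> S) \<inter> W" by (rule subgroup_dedekind[OF sT sS sW 2])
    then have eq: "T <#> (S \<inter> W) = W" using W(2) TS by auto
    have "S \<inter> W = {\<one>} \<or> S \<inter> W = S"
      using irr_cases[OF S, of "S \<inter> W"] invariant_Int[OF iS W(1)] by blast
    then show ?thesis
    proof
      assume "S \<inter> W = {\<one>}"
      then have "T <#> {\<one>} = W" using eq by simp
      moreover have "T <#> {\<one>} = T" using mT by (auto simp: set_mult_def)
      ultimately show ?thesis by simp
    next
      assume "S \<inter> W = S"
      then show ?thesis using eq TS by simp
    qed
  next
    case 1
    have "invariant ((W <#> T) \<inter> S)" by (intro invariant_Int invariant_set_mult W iS iT)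
    then consider "(W <#> T) \<inter> S = {\<one>}" | "S \<subseteq> W <#> T"
      using irr_cases[OF S, of "(W <#> T) \<inter> S"] by blast
    then show ?thesis
    proof cases
      assume triv: "(W <#> T) \<inter> S = {\<one>}"
      have "w = \<one>" if w: "w \<in> W" for w
      proof -
        obtain s t where st: "s \<in> S" "t \<in> T" "w = s \<otimes> t" using subsetD[OF W(2) w] by (auto simp: set_mult_mem)
        have "s = w \<otimes> inv t" using st mS mT by (simp add: m_assoc)
        then have "s \<in> W <#> T" using w st sT by (metis set_multI subgroup.m_inv_closed)
        then have "s = \<one>" using triv st by blast
        then have "w = t" using st mT by simp
        then show ?thesis using 1 w st by blast
      qed
      then have "W = {\<one>}" using invariant_one[OF W(1)] by blast
      then show ?thesis by simp
    next
      assume sub: "S \<subseteq> W <#> T"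
      define g where "g = (\<lambda>x. THE y. y \<in> T \<and> x \<otimes> y \<in> W)"
      have g_eq: "g x = y" if "x \<in> S" "y \<in> T" "x \<otimes> y \<in> W" for x y
        unfolding g_def
      proof (rule the_equality)
        fix y' assume y': "y' \<in> T \<and> x \<otimes> y' \<in> W"
        have c: "x \<in> carrier A" "y \<in> carrier A" "y' \<in> carrier A" using that y' mS mT by auto
        have "x \<otimes> y \<otimes> inv y = x \<otimes> y' \<otimes> inv y'" using c by (simp add: m_assoc)
        then show "y' = y"
          using disjoint_unique(2)[OF sW sT 1 _ _ _ _] that y' sT subgroup.m_inv_closed
          by (metis c(2,3) inv_inv)
      qed (use that in auto)
      have g_ex: "\<exists>y\<in>T. x \<otimes> y \<in> W" if x: "x \<in> S" for x
      proof -
        obtain w t where "w \<in> W" "t \<in> T" "x = w \<otimes> t" using subsetD[OF sub x] by (auto simp: set_mult_mem)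
        then have "x \<otimes> inv t = w" using mW mT by (simp add: m_assoc)
        then show ?thesis using \<open>w \<in> W\<close> \<open>t \<in> T\<close> sT subgroup.m_inv_closed by metis
      qed
      have g: "g x \<in> T" "x \<otimes> g x \<in> W" if "x \<in> S" for x
        using g_ex[OF that] g_eq[OF that] by auto
      have "g \<in> equiv_hom S T"
        unfolding equiv_hom_def
      proof (intro CollectI conjI ballI)
        show "g \<in> S \<rightarrow> T" using g by auto
        fix x assume x: "x \<in> S"
        show "g (x \<otimes> y) = g x \<otimes> g y" if y: "y \<in> S" for y
        proof (rule g_eq)
          have "x \<otimes> y \<otimes> (g x \<otimes> g y) = (x \<otimes> g x) \<otimes> (y \<otimes> g y)"
            using x y g mS mT by (simp add: m_ac)
          then show "x \<otimes> y \<otimes> (g x \<otimes> g y) \<in> W" using g x y sW by (simp add: subgroup.m_closed)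
        qed (use x y g sS sT in \<open>auto simp: subgroup.m_closed\<close>)
        show "g (\<rho> h x) = \<rho> h (g x)" if h: "h \<in> carrier H" for h
        proof (rule g_eq)
          have "\<rho> h x \<otimes> \<rho> h (g x) = \<rho> h (x \<otimes> g x)" using x h g mS mT by (simp add: act_mult)
          then show "\<rho> h x \<otimes> \<rho> h (g x) \<in> W" using g(2)[OF x] h W by (simp add: invariant_act)
        qed (use x h g iS iT in \<open>auto simp: invariant_act\<close>)
      qed
      moreover have "W = (\<lambda>x. x \<otimes> g x) ` S"
      proof
        show "(\<lambda>x. x \<otimes> g x) ` S \<subseteq> W" using g by auto
        show "W \<subseteq> (\<lambda>x. x \<otimes> g x) ` S"
        proof
          fix w assume w: "w \<in> W"
          then obtain s t where st: "s \<in> S" "t \<in> T" "w = s \<otimes> t"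
            using subsetD[OF W(2) w] by (auto simp: set_mult_mem)
          then have "g s = t" using g_eq w by blast
          then show "w \<in> (\<lambda>x. x \<otimes> g x) ` S" using st by blast
        qed
      qed
      ultimately show ?thesis by blast
    qed
  qed
qed

text \<open>Families are extensional, so that uniqueness of the components is literal equality. The product formula is
what turns the decomposition into statements about dimensions.\<close>

definition direct_decomposition :: "'a set \<Rightarrow> nat \<Rightarrow> (nat \<Rightarrow> 'a set) \<Rightarrow> bool" where
  "direct_decomposition D k W \<longleftrightarrow> (\<forall>i<k. irreducible_sub (W i) \<and> W i \<subseteq> D) \<and>
    (\<forall>v\<in>D. \<exists>!w. w \<in> (\<Pi>\<^sub>E i\<in>{..<k}. W i) \<and> v = finprod A w {..<k}) \<and>
    card D = (\<Prod>i<k. card (W i))"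

text \<open>Complete reducibility: an irreducible submodule is split off by Maschke's theorem and the
rest is decomposed by induction on the order; the new factor gets the last index.\<close>

lemma decomposition:
  assumes "invariant D"
  shows "\<exists>k W. direct_decomposition D k W"
  using assms
proof (induction "card D" arbitrary: D rule: less_induct)
  case less
  show ?case
  proof (cases "D = {\<one>}")
    case True
    then show ?thesis unfolding direct_decomposition_def
      by (intro exI[of _ 0] exI[of _ "\<lambda>_. {\<one>}"]) auto
  next
    case False
    obtain S where S: "irreducible_sub S" "S \<subseteq> D" using exists_irr[OF less.prems False] by blast
    note iS = irr_invariant[OF S(1)] note sS = invariant_sub[OF iS]
    obtain C where C: "invariant C" "S \<inter> C = {\<one>}" "S <#> C = carrier A"
      using maschke[OF iS] by blast
    let ?D = "D \<inter> C"
    note sD = invariant_sub[OF less.prems]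
    have iD: "invariant ?D" using less.prems C(1) by (rule invariant_Int)
    note sD' = invariant_sub[OF iD]
    have "S <#> (C \<inter> D) = (S <#> C) \<inter> D"
      by (rule subgroup_dedekind[OF sS invariant_sub[OF C(1)] sD S(2)])
    then have SD: "S <#> ?D = D" using C(3) subgroup.subset[OF sD] by (auto simp: Int_commute)
    have disj: "S \<inter> ?D = {\<one>}" using C(2) S(2) by blast
    have cD: "card D = card S * card ?D" using card_set_mult_disjoint[OF sS sD' disj] SD by simp
    have "card S > 1" using card_irr_gt1[OF S(1)] .
    then have "card ?D < card D" using cD card_sub_pos[OF sD'] by simp
    from less.hyps[OF this iD] obtain k W where "direct_decomposition ?D k W" by blast
    then have kW: "\<And>i. i < k \<Longrightarrow> irreducible_sub (W i) \<and> W i \<subseteq> ?D"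
      "\<And>v. v \<in> ?D \<Longrightarrow> \<exists>!w. w \<in> (\<Pi>\<^sub>E i\<in>{..<k::nat}. W i) \<and> v = finprod A w {..<k}"
      "card ?D = (\<Prod>i<k. card (W i))" by (simp_all add: direct_decomposition_def)
    define W' where "W' = (\<lambda>i. if i = k then S else W i)"
    have fp: "finprod A w {..<Suc k} = w k \<otimes> finprod A w {..<k}" "finprod A w {..<k} \<in> ?D" "w k \<in> S"
      if "w \<in> (\<Pi>\<^sub>E i\<in>{..<Suc k}. W' i)" for w
    proof -
      have wi: "w i \<in> W i" if "i < k" for i
        using PiE_mem[OF \<open>w \<in> _\<close>, of i] that by (simp add: W'_def)
      show "w k \<in> S" using PiE_mem[OF \<open>w \<in> _\<close>, of k] by (simp add: W'_def)
      have wD: "w i \<in> ?D" if "i < k" for i using kW(1) wi that by blast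
      then have wc: "w i \<in> carrier A" if "i < k" for i using that iD invariant_mem by metis
      have "finprod A w J \<in> ?D" if "J \<subseteq> {..<k}" for J
        using finite_subset[OF that finite_lessThan] that
      proof (induction J rule: finite_induct)
        case (insert i J)
        then have "finprod A w (insert i J) = w i \<otimes> finprod A w J"
          using wc by (intro finprod_insert) auto
        then show ?case
          using insert wD[of i] subgroup.m_closed[OF sD', of "w i" "finprod A w J"] by auto
      qed (use invariant_one[OF iD] in auto)
      then show "finprod A w {..<k} \<in> ?D" by simp
      show "finprod A w {..<Suc k} = w k \<otimes> finprod A w {..<k}"
        unfolding lessThan_Suc using wc \<open>w k \<in> S\<close> iS invariant_mem
        by (intro finprod_insert) auto
    qed
    have restr: "restrict w {..<k} \<in> (\<Pi>\<^sub>E i\<in>{..<k}. W i)"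
      "finprod A (restrict w {..<k}) {..<k} = finprod A w {..<k}"
      if "w \<in> (\<Pi>\<^sub>E i\<in>{..<Suc k}. W' i)" for w
    proof -
      have m: "w i \<in> W i" if "i < k" for i
        using PiE_mem[OF \<open>w \<in> _\<close>, of i] that by (simp add: W'_def)
      then show "restrict w {..<k} \<in> (\<Pi>\<^sub>E i\<in>{..<k}. W i)" by auto
      have "w i \<in> carrier A" if "i < k" for i using m[OF that] kW(1)[OF that] iD invariant_mem by blast
      then show "finprod A (restrict w {..<k}) {..<k} = finprod A w {..<k}"
        by (intro finprod_cong) auto
    qed
    show ?thesis unfolding direct_decomposition_def
    proof (intro exI[of _ "Suc k"] exI[of _ W'] conjI allI impI ballI)
      fix i assume "i < Suc k"
      then show "irreducible_sub (W' i)" "W' i \<subseteq> D" using kW(1)[of i] S by (auto simp: W'_def)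
    next
      show "card D = (\<Prod>i<Suc k. card (W' i))" using cD kW(3) by (simp add: W'_def)
    next
      fix v assume "v \<in> D"
      then have "v \<in> S <#> ?D" using SD by simp
      then obtain s d where sd: "s \<in> S" "d \<in> ?D" "v = s \<otimes> d" by (auto simp: set_mult_mem)
      obtain w where w: "w \<in> (\<Pi>\<^sub>E i\<in>{..<k}. W i)" "d = finprod A w {..<k}" using kW(2)[OF sd(2)] by blast
      define w' where "w' = w(k := s)"
      have w': "w' \<in> (\<Pi>\<^sub>E i\<in>{..<Suc k}. W' i)"
        using w sd(1) by (auto simp: w'_def W'_def PiE_iff extensional_def less_Suc_eq)
      have "restrict w' {..<k} = w"
        using w(1) by (auto simp: w'_def PiE_iff extensional_def restrict_def)
      then have "v = finprod A w' {..<Suc k}"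
        using fp(1)[OF w'] restr(2)[OF w'] w(2) sd(3) by (simp add: w'_def)
      moreover have "u = w'" if u: "u \<in> (\<Pi>\<^sub>E i\<in>{..<Suc k}. W' i)" "v = finprod A u {..<Suc k}" for u
      proof -
        have "u k \<otimes> finprod A u {..<k} = s \<otimes> d" using u fp(1) sd by simp
        then have "u k = s" "finprod A u {..<k} = d"
          using disjoint_unique[OF sS sD' disj fp(3)[OF u(1)] sd(1) fp(2)[OF u(1)] sd(2)] by auto
        then have "restrict u {..<k} = w"
          using kW(2)[OF sd(2)] restr[OF u(1)] w by metis
        show ?thesis
        proof
          fix i
          consider "i < k" | "i = k" | "i > k" by linarith
          then show "u i = w' i"
          proof cases
            case 1
            then show ?thesis using \<open>restrict u {..<k} = w\<close> by (auto simp: w'_def)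
          next
            case 2
            then show ?thesis using \<open>u k = s\<close> by (simp add: w'_def)
          next
            case 3
            then have "i \<notin> {..<Suc k}" by simp
            then show ?thesis using u(1) w' by (metis PiE_arb)
          qed
        qed
      qed
      ultimately show "\<exists>!w. w \<in> (\<Pi>\<^sub>E i\<in>{..<Suc k}. W' i) \<and> v = finprod A w {..<Suc k}"
        using w' by blast
    qed
  qed
qed

lemma card_power_of_irr:
  assumes "invariant D" "\<And>S. irreducible_sub S \<Longrightarrow> card S = c"
  shows "\<exists>k. card D = c ^ k"
proof -
  obtain k W where "direct_decomposition D k W" using decomposition[OF assms(1)] by blast
  then have kW: "\<forall>i<k. irreducible_sub (W i)" "card D = (\<Prod>i<k. card (W i))"
    by (simp_all add: direct_decomposition_def)
  have "(\<Prod>i<k. card (W i)) = (\<Prod>i<k. c)"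
    by (intro prod.cong refl assms(2)) (use kW(1) in auto)
  then show ?thesis using kW(2) by auto
qed

end

section \<open>Modules in which the subspaces of one dimension have invariant complements\<close>

context coprime_action
begin

lemma card_product:
  assumes "invariant X" "invariant Y" "X \<inter> Y = {\<one>}"
  shows "card (X <#> Y) = card X * card Y"
  using assms card_set_mult_disjoint invariant_sub by blast

end

locale complemented_action = coprime_action +
  fixes N m :: nat
  assumes card_A: "card (carrier A) = p ^ N"
    and m_pos: "0 < m" and m_less: "m < N"
    and complements: "subgroup U A \<Longrightarrow> card U = p ^ m \<Longrightarrow>
      \<exists>W. invariant W \<and> U \<inter> W = {\<one>} \<and> U <#> W = carrier A"
begin

lemma proper_of_card:
  assumes "card X \<le> p ^ m"
  shows "X \<noteq> carrier A"
proof
  assume "X = carrier A"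
  then have "p ^ N \<le> p ^ m" using assms card_A by simp
  then show False using m_less p_gt1 by simp
qed

definition largest_irr :: "'a set \<Rightarrow> bool" where
  "largest_irr S \<longleftrightarrow> irreducible_sub S \<and> (\<forall>T. irreducible_sub T \<longrightarrow> card T \<le> card S)"

lemma largest_irr_exists: "\<exists>S. largest_irr S"
proof -
  have "carrier A \<noteq> {\<one>}"
    using proper_of_card[of "{\<one>}"] p_gt1 by (simp add: m_pos)
  then obtain S0 where "irreducible_sub S0" using exists_irr[OF invariant_carrier] by blast
  moreover have "\<forall>S. irreducible_sub S \<longrightarrow> card S < Suc (card (carrier A))"
    using finite_carrier invariant_sub irr_invariant subgroup.subset
    by (metis card_mono less_Suc_eq_le)
  ultimately obtain S where "irreducible_sub S" "\<forall>T. irreducible_sub T \<longrightarrow> card T \<le> card S"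
    using ex_has_greatest_nat[of irreducible_sub S0 card] by metis
  then show ?thesis by (auto simp: largest_irr_def)
qed

text \<open>Choose \<open>R\<close> invariant, disjoint from \<open>S T\<close>, of order less than \<open>p^m\<close> and as large as possible. Passing to the quotient
by \<open>R\<close> lowers the dimension \<open>m\<close> to \<open>l = m - dim R\<close>, and the modular law restricts the
property to \<open>S T\<close>. If \<open>l\<close> were still at least \<open>dim (S T)\<close>,
some irreducible \<open>T'\<close> avoids \<open>R S T\<close>, and \<open>R T'\<close> would be a better choice since
\<open>dim T' \<le> dim S < dim (S T)\<close>; this is why \<open>S\<close> has to be of largest dimension.\<close>

lemma complements_in_product:
  assumes S: "largest_irr S" and T: "irreducible_sub T" and ST: "S \<inter> T = {\<one>}"
  shows "\<exists>l. 0 < l \<and> p ^ l < card S * card T \<and>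
    (\<forall>U. subgroup U A \<longrightarrow> U \<subseteq> S <#> T \<longrightarrow> card U = p ^ l \<longrightarrow>
      (\<exists>W. invariant W \<and> W \<subseteq> S <#> T \<and> U \<inter> W = {\<one>} \<and> U <#> W = S <#> T))"
proof -
  let ?D = "S <#> T"
  have irS: "irreducible_sub S" using S by (simp add: largest_irr_def)
  note iS = irr_invariant[OF irS] and iT = irr_invariant[OF T]
  have iD: "invariant ?D" using iS iT by (rule invariant_set_mult)
  note sD = invariant_sub[OF iD]
  have cD: "card ?D = card S * card T" using card_product iS iT ST by simp
  define Q where "Q = (\<lambda>R. invariant R \<and> R \<inter> ?D = {\<one>} \<and> card R < p ^ m)"
  have "Q {\<one>}"
    using invariant_triv invariant_one[OF iD] one_less_power[OF p_gt1 m_pos] by (auto simp: Q_def)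
  then obtain R where R: "Q R" "\<And>R'. Q R' \<Longrightarrow> card R' \<le> card R"
    using ex_has_greatest_nat[of Q "{\<one>}" card "p ^ m"] by (metis Q_def)
  have iR: "invariant R" and RD: "R \<inter> ?D = {\<one>}" and cR: "card R < p ^ m"
    using R(1) by (auto simp: Q_def)
  note sR = invariant_sub[OF iR]
  obtain r where r: "card R = p ^ r" using card_subgroup_power[OF sR] by blast
  then have rm: "r < m" using cR p_gt1 by simp
  have pm: "p ^ m = p ^ r * p ^ (m - r)" using rm by (simp add: power_add[symmetric])
  have mem: "x \<in> carrier A" if "x \<in> R \<or> x \<in> ?D" for x
    using that iR iD invariant_mem by blast
  have "p ^ (m - r) < card S * card T"
  proof (rule ccontr)
    assume "\<not> p ^ (m - r) < card S * card T"
    then have le: "card R * (card S * card T) \<le> p ^ m" using pm r by simp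
    have iRD: "invariant (R <#> ?D)" using iR iD by (rule invariant_set_mult)
    have "card (R <#> ?D) \<le> p ^ m" using le cD card_product[OF iR iD RD] by simp
    then obtain T' where T': "irreducible_sub T'" "(R <#> ?D) \<inter> T' = {\<one>}"
      using irr_outside[OF iRD] proper_of_card by blast
    note iT' = irr_invariant[OF T'(1)]
    have RT': "R \<inter> T' = {\<one>}"
      using T'(2) subset_set_mult(1)[OF sR sD] invariant_one[OF iR] invariant_one[OF iT'] by blast
    have cRT': "card (R <#> T') = card R * card T'" using card_product[OF iR iT' RT'] .
    have Rpos: "card R > 0" using card_sub_pos[OF sR] .
    have "card T' \<le> card S" using S T'(1) by (simp add: largest_irr_def)
    also have "card S < card S * card T"
      using card_irr_gt1[OF T] card_irr_gt1[OF irS] by simp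
    finally have "card R * card T' < card R * (card S * card T)" using Rpos by simp
    then have "card (R <#> T') < p ^ m" using le unfolding cRT' by (rule less_le_trans)
    moreover have "(R <#> T') \<inter> ?D = {\<one>}"
    proof -
      have "x = \<one>" if x: "x \<in> R <#> T'" "x \<in> ?D" for x
      proof -
        obtain a t where at: "a \<in> R" "t \<in> T'" "x = a \<otimes> t" using x by (auto simp: set_mult_mem)
        have c: "a \<in> carrier A" "t \<in> carrier A" "x \<in> carrier A"
          using at x mem iT' invariant_mem by blast+
        have "t = inv a \<otimes> x" using at(3) c by (simp add: m_assoc[symmetric])
        then have "t \<in> R <#> ?D" using at(1) x(2) sR set_multI subgroup.m_inv_closed by metis
        then have "t = \<one>" using T'(2) at(2) by blast
        then have "x = a" using at(3) c by simp
        then show ?thesis using RD at(1) x(2) by blast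
      qed
      then show ?thesis
        using invariant_one[OF iD] invariant_one[OF invariant_set_mult[OF iR iT']] by blast
    qed
    ultimately have "Q (R <#> T')" using invariant_set_mult[OF iR iT'] by (simp add: Q_def)
    then have "card R * card T' \<le> card R" using R(2) cRT' by metis
    then show False using Rpos card_irr_gt1[OF T'(1)] by simp
  qed
  moreover have "\<exists>W. invariant W \<and> W \<subseteq> ?D \<and> U \<inter> W = {\<one>} \<and> U <#> W = ?D"
    if U: "subgroup U A" "U \<subseteq> ?D" "card U = p ^ (m - r)" for U
  proof -
    have UR: "U \<inter> R = {\<one>}"
      using U(2) RD subgroup.one_closed[OF U(1)] invariant_one[OF iR] by blast
    have sUR: "subgroup (U <#> R) A" using U(1) sR by (rule mult_subgroups)
    have "card (U <#> R) = p ^ m" using card_set_mult_disjoint[OF U(1) sR UR] U(3) r pm by simp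
    then obtain W where W: "invariant W" "(U <#> R) \<inter> W = {\<one>}" "(U <#> R) <#> W = carrier A"
      using complements[OF sUR] by blast
    note sW = invariant_sub[OF W(1)]
    have sRW: "subgroup (R <#> W) A" using sR sW by (rule mult_subgroups)
    have "U <#> ((R <#> W) \<inter> ?D) = (U <#> (R <#> W)) \<inter> ?D"
      by (rule subgroup_dedekind[OF U(1) sRW sD U(2)])
    also have "U <#> (R <#> W) = carrier A"
      using W(3) set_mult_assoc[of U R W] U(1) sR sW subgroup.subset by metis
    finally have "U <#> ((R <#> W) \<inter> ?D) = ?D" using subgroup.subset[OF sD] by auto
    moreover have "U \<inter> ((R <#> W) \<inter> ?D) = {\<one>}"
    proof -
      have "x = \<one>" if x: "x \<in> U" "x \<in> R <#> W" for x
      proof -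
        obtain a w where aw: "a \<in> R" "w \<in> W" "x = a \<otimes> w" using x by (auto simp: set_mult_mem)
        have c: "a \<in> carrier A" "w \<in> carrier A" "x \<in> carrier A"
          using aw x mem U W invariant_mem by blast+
        have "w = x \<otimes> inv a" using aw(3) c by (metis inv_closed inv_solve_right m_comm m_closed)
        then have "w \<in> U <#> R" using aw(1) x(1) sR set_multI subgroup.m_inv_closed by metis
        then have "w = \<one>" using W(2) aw(2) by blast
        then have "x = a" using aw(3) c by simp
        then show ?thesis using UR aw(1) x(1) by blast
      qed
      then show ?thesis
        using subgroup.one_closed[OF U(1)] subgroup.one_closed[OF sRW] subgroup.one_closed[OF sD]
        by blast
    qed
    moreover have "invariant ((R <#> W) \<inter> ?D)"
      using invariant_Int[OF invariant_set_mult[OF iR W(1)] iD] .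
    ultimately show ?thesis by blast
  qed
  ultimately show ?thesis using rm by (intro exI[of _ "m - r"]) auto
qed

lemma complement_nontrivial:
  assumes "U \<inter> W = {\<one>}" "U <#> W = D" "subgroup U A" "card U < card D" "1 < card U"
  shows "W \<noteq> {\<one>}" "W \<noteq> D"
proof -
  show "W \<noteq> {\<one>}"
  proof
    assume "W = {\<one>}"
    then have "U <#> W = U" using subgroup.mem_carrier[OF assms(3)] by (auto simp: set_mult_def)
    then show False using assms by simp
  qed
  show "W \<noteq> D"
  proof
    assume "W = D"
    have "U = {\<one>}"
    proof -
      have "x \<in> W" if "x \<in> U" for x
      proof -
        have "\<one> \<in> W" using assms(1) by blast
        then have "x \<otimes> \<one> \<in> U <#> W" using that set_multI by blast
        then show ?thesis using assms(2,3) \<open>W = D\<close> that subgroup.mem_carrier by fastforce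
      qed
      then show ?thesis using assms(1) by blast
    qed
    then show False using assms(5) by simp
  qed
qed

text \<open>There are no graphs of isomorphisms, so \<open>S\<close> and \<open>T\<close> are the only nontrivial proper submodules of
\<open>S T\<close>. If \<open>l > 1\<close>, a subspace through a vector of \<open>S\<close> and a vector of \<open>T\<close> meets both. If \<open>l = 1\<close>, a line
in \<open>S\<close> can only have the complement \<open>T\<close>, which forces \<open>S\<close> to be a line.\<close>

lemma nonisomorphic_imp_card:
  assumes S: "largest_irr S" and T: "irreducible_sub T" and niso: "\<not> equivariant_iso S T"
  shows "card S = p"
proof -
  have irS: "irreducible_sub S" using S by (simp add: largest_irr_def)
  note iS = irr_invariant[OF irS] and iT = irr_invariant[OF T]
  note sS = invariant_sub[OF iS] and sT = invariant_sub[OF iT]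
  have "S \<noteq> T" using niso iso_refl by blast
  then have ST: "S \<inter> T = {\<one>}" using irr_disjoint irS T by blast
  let ?D = "S <#> T"
  have cD: "card ?D = card S * card T" using card_product iS iT ST by simp
  have sD: "subgroup ?D A" using mult_subgroups[OF sS sT] .
  obtain l where l: "0 < l" "p ^ l < card S * card T"
    "\<And>U. subgroup U A \<Longrightarrow> U \<subseteq> ?D \<Longrightarrow> card U = p ^ l \<Longrightarrow>
      \<exists>W. invariant W \<and> W \<subseteq> ?D \<and> U \<inter> W = {\<one>} \<and> U <#> W = ?D"
    using complements_in_product[OF S T ST] by blast
  have cases: "W = {\<one>} \<or> W = S \<or> W = T \<or> W = ?D" if W: "invariant W" "W \<subseteq> ?D" for W
  proof -
    have "W = S" if g: "g \<in> equiv_hom S T" "W = (\<lambda>x. x \<otimes> g x) ` S" for g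
    proof -
      have "\<forall>x\<in>S. g x = \<one>" using schur[OF g(1) irS T] niso g(1) by (auto simp: equivariant_iso_def)
      then have "W = (\<lambda>x. x) ` S" using g(2) iS invariant_mem by (auto simp: image_iff)
      then show ?thesis by simp
    qed
    then show ?thesis using invariant_in_product[OF irS T ST W] by blast
  qed
  obtain s where s: "s \<in> S" "s \<noteq> \<one>" using irr_elem[OF irS] by blast
  obtain t where t: "t \<in> T" "t \<noteq> \<one>" using irr_elem[OF T] by blast
  have sc: "s \<in> carrier A" and tc: "t \<in> carrier A" using s t iS iT invariant_mem by blast+
  let ?s = "generate A {s}" and ?t = "generate A {t}"
  have ss: "subgroup ?s A" "subgroup ?t A" using sc tc by (auto intro!: generate_is_subgroup)
  have sub: "?s \<subseteq> S" "?t \<subseteq> T"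
    using generate_singleton_sub[OF sS s(1)] generate_singleton_sub[OF sT t(1)] by auto
  have cs: "card ?s = p" "card ?t = p" using card_generate_singleton sc tc s t by auto
  have sD1: "S \<subseteq> ?D" "T \<subseteq> ?D" using subset_set_mult[OF sS sT] by auto
  have s_in: "s \<in> ?s" "t \<in> ?t" using generate.incl by (metis insertI1)+
  show ?thesis
  proof (cases "l = 1")
    case True
    obtain W where W: "invariant W" "W \<subseteq> ?D" "?s \<inter> W = {\<one>}" "?s <#> W = ?D"
      using l(3)[OF ss(1)] sub sD1 cs True by auto
    have "W \<noteq> {\<one>}" "W \<noteq> ?D"
      using complement_nontrivial[OF W(3,4) ss(1)] cs l(2) True cD p_gt1 by auto
    moreover have "W \<noteq> S" using W(3) s s_in by blast
    ultimately have "W = T" using cases W by blast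
    then have "card S * card T = p * card T"
      using W cD card_set_mult_disjoint[OF ss(1) sT] cs by simp
    then show ?thesis using card_irr_gt1[OF T] by simp
  next
    case False
    have disj: "?s \<inter> ?t = {\<one>}"
      using sub ST subgroup.one_closed[OF ss(1)] subgroup.one_closed[OF ss(2)] by blast
    have sst: "subgroup (?s <#> ?t) A" using mult_subgroups[OF ss] .
    have sstD: "?s <#> ?t \<subseteq> ?D" using sub by (rule mono_set_mult)
    have "card (?s <#> ?t) = p ^ 2"
      using card_set_mult_disjoint[OF ss disj] cs by (simp add: power2_eq_square)
    moreover have "p ^ 2 \<le> p ^ l" using False l(1) p_gt1 by (intro power_increasing) auto
    ultimately obtain U where U: "subgroup U A" "?s <#> ?t \<subseteq> U" "U \<subseteq> ?D" "card U = p ^ l"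
      using subgroup_between[OF sst sD sstD, of l] l(2) cD by auto
    obtain W where W: "invariant W" "W \<subseteq> ?D" "U \<inter> W = {\<one>}" "U <#> W = ?D"
      using l(3)[OF U(1,3,4)] by blast
    have "W \<noteq> {\<one>}" "W \<noteq> ?D"
      using complement_nontrivial[OF W(3,4) U(1)] U(4) l cD one_less_power[OF p_gt1 l(1)] by auto
    moreover have "s \<in> U" "t \<in> U" using subset_set_mult[OF ss] s_in U(2) by blast+
    then have "W \<noteq> S" "W \<noteq> T" using W(3) s t by blast+
    ultimately show ?thesis using cases W by blast
  qed
qed

lemma dichotomy:
  "(\<forall>S. irreducible_sub S \<longrightarrow> card S = p) \<or>
   (\<exists>e>1. (\<forall>S. irreducible_sub S \<longrightarrow> card S = p ^ e) \<and> (\<forall>S T. irreducible_sub S \<longrightarrow> irreducible_sub T \<longrightarrow> equivariant_iso S T))"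
proof -
  obtain S where S: "largest_irr S" using largest_irr_exists by blast
  then have irS: "irreducible_sub S" by (simp add: largest_irr_def)
  show ?thesis
  proof (cases "card S = p")
    case True
    have "card T = p" if T: "irreducible_sub T" for T
    proof -
      obtain e where e: "card T = p ^ e" "e > 0" using card_irr[OF T] by blast
      have "p ^ 1 \<le> p ^ e" using e p_gt1 by (intro power_increasing) auto
      moreover have "card T \<le> p" using S T True by (metis largest_irr_def)
      ultimately show ?thesis using e by simp
    qed
    then show ?thesis by blast
  next
    case False
    then have equivariant_iso: "equivariant_iso S T" if "irreducible_sub T" for T using nonisomorphic_imp_card[OF S that] by blast
    obtain e where e: "card S = p ^ e" "e > 0" using card_irr[OF irS] by blast
    have "e > 1" using e False by (cases "e = 1") auto
    moreover have "card T = p ^ e" if "irreducible_sub T" for T using iso_card[OF equivariant_iso[OF that]] e by simp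
    moreover have "equivariant_iso T T'" if "irreducible_sub T" "irreducible_sub T'" for T T'
      using iso_trans[OF iso_sym[OF equivariant_iso[OF that(1)] irr_invariant[OF irS]] equivariant_iso[OF that(2)]] .
    ultimately show ?thesis by blast
  qed
qed

text \<open>Every invariant subgroup is a direct sum of irreducible ones. This applies to the whole module and to an invariant
complement of a subspace of dimension \<open>m\<close>.\<close>

lemma dimension_dvd:
  assumes "\<And>S. irreducible_sub S \<Longrightarrow> card S = p ^ e"
  shows "e dvd N" "e dvd m"
proof -
  have dvd: "e dvd k" if D: "invariant D" "card D = p ^ k" for D k
  proof -
    obtain j where "card D = (p ^ e) ^ j" using card_power_of_irr[OF D(1) assms] by blast
    then have "p ^ k = p ^ (e * j)" using D by (simp add: power_mult)
    then have "k = e * j" using p_gt1 by simp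
    then show ?thesis by simp
  qed
  show eN: "e dvd N" using dvd[OF invariant_carrier card_A] .
  obtain U where U: "subgroup U A" "card U = p ^ m"
    using subgroup_between[OF triv_subgroup subgroup_self, of m] subgroup.one_closed[OF subgroup_self]
      p_gt1 card_A m_less by (auto simp: Suc_leI)
  obtain W where W: "invariant W" "U \<inter> W = {\<one>}" "U <#> W = carrier A"
    using complements[OF U] by blast
  obtain k where k: "card W = p ^ k" using card_subgroup_power[OF invariant_sub[OF W(1)]] by blast
  have "p ^ N = p ^ (m + k)"
    using card_set_mult_disjoint[OF U(1) invariant_sub[OF W(1)] W(2)] W(3) U(2) k card_A
    by (simp add: power_add)
  then have "N = m + k" using p_gt1 by simp
  then show "e dvd m" using eN dvd[OF W(1) k] by (simp add: dvd_add_left_iff)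
qed

end

section \<open>The field of endomorphisms of an irreducible module\<close>

lemma (in group) inv_mult_one_imp_eq:
  assumes "x \<in> carrier G" "y \<in> carrier G" "inv x \<otimes> y = \<one>"
  shows "y = x"
proof -
  have "y = x \<otimes> (inv x \<otimes> y)" using assms(1,2) by (simp add: m_assoc[symmetric])
  then show ?thesis using assms by simp
qed

text \<open>The image of \<open>K\<close>, of order \<open>k\<close>, lies in the set of solutions of \<open>x^k = 1\<close>, and in a cyclic group these
are the at most \<open>k\<close> powers of one element \<open>b\<close>.\<close>

lemma (in group) cyclic_if_in_cyclic:
  assumes fin: "finite (carrier G)" and a: "a \<in> carrier G" "carrier G = {a [^] i |i::nat. i \<in> UNIV}"
    and K: "group K" "F \<in> hom K G" "inj_on F (carrier K)"
  shows "cyclic_group K"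
proof -
  interpret K: group K by fact
  interpret F: group_hom K G F by unfold_locales (rule K(2))
  define n where "n = ord a"
  have "generate G {a} = carrier G"
    using generate_pow_nat[OF a(1)] a(2) ord_ge_1[OF fin a(1)]  by auto
  then have n: "card (carrier G) = n" using generate_pow_card[OF a(1)] by (simp add: n_def)
  let ?I = "F ` carrier K"
  have sI: "subgroup ?I G" using F.img_is_subgroup .
  have finI: "finite ?I" using fin sI subgroup.subset finite_subset by blast
  define k where "k = card ?I"
  have kpos: "k > 0" using subgroup.finite_imp_card_positive[OF sI fin] by (simp add: k_def)
  have "k dvd n" using lagrange[OF sI] n by (metis dvd_triv_right k_def Coset.order_def)
  then obtain l where l: "n = k * l" by (elim dvdE)
  define b where "b = a [^] l"
  have b: "b \<in> carrier G" unfolding b_def using a(1) by (rule nat_pow_closed)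
  have bk: "b [^] k = \<one>"
    using a(1) l by (simp add: b_def nat_pow_pow n_def pow_ord_eq_1 mult.commute flip: l)
  have bmod: "b [^] (j mod k) = b [^] j" for j :: nat
  proof -
    have "b [^] (k * (j div k) + j mod k) = (b [^] k) [^] (j div k) \<otimes> b [^] (j mod k)"
      using b by (simp add: nat_pow_mult nat_pow_pow)
    then show ?thesis using b bk by simp
  qed
  define B where "B = (\<lambda>j. b [^] (j::nat)) ` {..<k}"
  have "?I \<subseteq> B"
  proof
    fix x assume x: "x \<in> ?I"
    then have xG: "x \<in> carrier G" using sI subgroup.mem_carrier by metis
    interpret I: group "G\<lparr>carrier := ?I\<rparr>" by (rule subgroup.subgroup_is_group[OF sI is_group])
    have "x [^]\<^bsub>G\<lparr>carrier := ?I\<rparr>\<^esub> Coset.order (G\<lparr>carrier := ?I\<rparr>) = \<one>"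
      using I.pow_order_eq_1[of x] x by simp
    then have xk: "x [^] k = \<one>" by (simp add: Coset.order_def k_def nat_pow_consistent[symmetric])
    obtain i :: nat where i: "x = a [^] i" using xG a(2) by auto
    then have "a [^] (i * k) = \<one>" using xk a(1) by (simp add: nat_pow_pow)
    then have "n dvd i * k" using pow_eq_id[OF a(1)] by (simp add: n_def)
    then have "l dvd i" using l kpos by (simp add: mult.commute)
    then obtain j where j: "i = l * j" by (elim dvdE)
    then have "x = b [^] (j mod k)" using i a(1) bmod by (simp add: b_def nat_pow_pow)
    then show "x \<in> B" using kpos by (auto simp: B_def)
  qed
  moreover have "card B \<le> k" unfolding B_def using card_image_le[of "{..<k}"] by simp
  ultimately have IB: "?I = B"
    by (intro card_seteq) (auto simp: k_def B_def)
  have "b = b [^] (1 mod k)" using bmod[of 1] b by simp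
  then have "b \<in> ?I" unfolding IB B_def using kpos by (metis image_eqI lessThan_iff mod_less_divisor)
  then obtain c where c: "c \<in> carrier K" "b = F c" by blast
  have "x \<in> range (\<lambda>n::int. c [^]\<^bsub>K\<^esub> n)" if x: "x \<in> carrier K" for x
  proof -
    obtain j :: nat where "F x = b [^] j" using x IB by (auto simp: B_def)
    then have "F x = F (c [^]\<^bsub>K\<^esub> j)" using c by (simp add: F.hom_nat_pow)
    then have "x = c [^]\<^bsub>K\<^esub> int j" using K(3) x c by (auto simp: inj_on_def int_pow_int)
    then show ?thesis by blast
  qed
  moreover have "range (\<lambda>n::int. c [^]\<^bsub>K\<^esub> n) \<subseteq> carrier K" using c by auto
  ultimately show ?thesis using K.cyclic_group c(1) by blast
qed

context coprime_action
begin

lemma equiv_hom_mult: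
  assumes "f \<in> equiv_hom S T" "g \<in> equiv_hom S T" "invariant T"
  shows "(\<lambda>x. f x \<otimes> g x) \<in> equiv_hom S T"
  unfolding equiv_hom_def
proof (intro CollectI conjI ballI)
  note f = equiv_homD[OF assms(1)] and g = equiv_homD[OF assms(2)]
  have c: "f x \<in> carrier A" "g x \<in> carrier A" if "x \<in> S" for x
    using that f(1) g(1) assms(3) invariant_mem by metis+
  show "(\<lambda>x. f x \<otimes> g x) \<in> S \<rightarrow> T"
    using f(1) g(1) subgroup.m_closed[OF invariant_sub[OF assms(3)]] by auto
  show "f (x \<otimes> y) \<otimes> g (x \<otimes> y) = f x \<otimes> g x \<otimes> (f y \<otimes> g y)" if "x \<in> S" "y \<in> S" for x y
    using f(2) g(2) that c by (simp add: m_ac)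
  show "f (\<rho> h x) \<otimes> g (\<rho> h x) = \<rho> h (f x \<otimes> g x)" if "h \<in> carrier H" "x \<in> S" for h x
    using f(3) g(3) that c by (simp add: act_mult)
qed

lemma equiv_hom_minus:
  assumes "f \<in> equiv_hom S T" "invariant T"
  shows "(\<lambda>x. inv (f x)) \<in> equiv_hom S T"
  unfolding equiv_hom_def
proof (intro CollectI conjI ballI)
  note f = equiv_homD[OF assms(1)]
  have c: "f x \<in> carrier A" if "x \<in> S" for x
    using that f(1) assms(2) invariant_mem by metis
  show "(\<lambda>x. inv (f x)) \<in> S \<rightarrow> T"
    using f(1) subgroup.m_inv_closed[OF invariant_sub[OF assms(2)]] by auto
  show "inv (f (x \<otimes> y)) = inv (f x) \<otimes> inv (f y)" if "x \<in> S" "y \<in> S" for x y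
    using f(2) that c by (simp add: inv_mult)
  show "inv (f (\<rho> h x)) = \<rho> h (inv (f x))" if "h \<in> carrier H" "x \<in> S" for h x
    using f(3) that c by (simp add: act_inv)
qed

lemma equiv_hom_const_one: "invariant T \<Longrightarrow> (\<lambda>x. \<one>) \<in> equiv_hom S T"
  by (auto simp: equiv_hom_def invariant_one act_one)

lemma equiv_hom_id: "(\<lambda>x. x) \<in> equiv_hom S S"
  by (simp add: equiv_hom_def)

lemma equiv_hom_cong:
  assumes "f \<in> equiv_hom S T" "invariant S" "\<And>x. x \<in> S \<Longrightarrow> g x = f x"
  shows "g \<in> equiv_hom S T"
proof -
  note sS = invariant_sub[OF assms(2)]
  show ?thesis
    using equiv_homD[OF assms(1)] assms(3) subgroup.m_closed[OF sS] invariant_act[OF assms(2)]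
    by (simp add: equiv_hom_def Pi_iff)
qed

text \<open>Endomorphisms are extensional functions on \<open>S\<close>, so that equality in the ring is equality on \<open>S\<close>.\<close>

definition endo_ring :: "'a set \<Rightarrow> ('a \<Rightarrow> 'a) ring" where
  "endo_ring S = \<lparr>carrier = equiv_hom S S \<inter> extensional S,
     monoid.mult = (\<lambda>f g. \<lambda>x\<in>S. f (g x)), one = (\<lambda>x\<in>S. x),
     zero = (\<lambda>x\<in>S. \<one>), add = (\<lambda>f g. \<lambda>x\<in>S. f x \<otimes> g x)\<rparr>"

lemma restrict_endo:
  assumes "f \<in> equiv_hom S S" "invariant S"
  shows "restrict f S \<in> carrier (endo_ring S)"
  using equiv_hom_cong[OF assms, of "restrict f S"] by (simp add: endo_ring_def)

lemma ring_endo_ring: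
  assumes S: "invariant S"
  shows "ring (endo_ring S)"
proof -
  let ?E = "endo_ring S"
  have E: "f \<in> carrier ?E \<longleftrightarrow> f \<in> equiv_hom S S \<and> f \<in> extensional S" for f
    by (simp add: endo_ring_def)
  have mem: "f x \<in> S" if "f \<in> carrier ?E" "x \<in> S" for f x
    using that equiv_homD(1) by (auto simp: endo_ring_def)
  have c: "f x \<in> carrier A" if "f \<in> carrier ?E" "x \<in> S" for f x
    using mem[OF that] S invariant_mem by blast
  have cS: "x \<in> carrier A" if "x \<in> S" for x using that S invariant_mem by blast
  have eq: "f = g" if "f \<in> carrier ?E" "g \<in> carrier ?E" "\<And>x. x \<in> S \<Longrightarrow> f x = g x" for f g
    using that by (auto simp: endo_ring_def intro: extensionalityI)
  have add: "(f \<oplus>\<^bsub>?E\<^esub> g) x = f x \<otimes> g x" if "x \<in> S" for f g x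
    using that by (simp add: endo_ring_def)
  have mult: "(f \<otimes>\<^bsub>?E\<^esub> g) x = f (g x)" if "x \<in> S" for f g x
    using that by (simp add: endo_ring_def)
  have zero: "\<zero>\<^bsub>?E\<^esub> x = \<one>" if "x \<in> S" for x using that by (simp add: endo_ring_def)
  have one: "\<one>\<^bsub>?E\<^esub> x = x" if "x \<in> S" for x using that by (simp add: endo_ring_def)
  have add_c: "f \<oplus>\<^bsub>?E\<^esub> g \<in> carrier ?E" if "f \<in> carrier ?E" "g \<in> carrier ?E" for f g
    using restrict_endo[OF equiv_hom_mult[of f S S g] S] that S by (simp add: endo_ring_def)
  have mult_c: "f \<otimes>\<^bsub>?E\<^esub> g \<in> carrier ?E" if "f \<in> carrier ?E" "g \<in> carrier ?E" for f g
    using restrict_endo[OF equiv_hom_comp[of g S S f] S] that by (simp add: endo_ring_def)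
  have zero_c: "\<zero>\<^bsub>?E\<^esub> \<in> carrier ?E"
    using restrict_endo[OF equiv_hom_const_one[OF S] S] by (simp add: endo_ring_def)
  have one_c: "\<one>\<^bsub>?E\<^esub> \<in> carrier ?E"
    using restrict_endo[OF equiv_hom_id S] by (simp add: endo_ring_def)
  show ?thesis
  proof (rule ringI)
    show "abelian_group ?E"
    proof (rule abelian_groupI)
      fix f g k assume f: "f \<in> carrier ?E" and g: "g \<in> carrier ?E" and k: "k \<in> carrier ?E"
      show "f \<oplus>\<^bsub>?E\<^esub> g \<oplus>\<^bsub>?E\<^esub> k = f \<oplus>\<^bsub>?E\<^esub> (g \<oplus>\<^bsub>?E\<^esub> k)"
        by (rule eq) (use f g k add_c c in \<open>auto simp: add m_assoc\<close>)
    next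
      fix f g assume f: "f \<in> carrier ?E" and g: "g \<in> carrier ?E"
      show "f \<oplus>\<^bsub>?E\<^esub> g = g \<oplus>\<^bsub>?E\<^esub> f"
        by (rule eq) (use f g add_c c in \<open>auto simp: add m_comm\<close>)
    next
      fix f assume f: "f \<in> carrier ?E"
      show "\<zero>\<^bsub>?E\<^esub> \<oplus>\<^bsub>?E\<^esub> f = f"
        by (rule eq) (use f zero_c add_c c in \<open>auto simp: add zero\<close>)
      let ?g = "\<lambda>x\<in>S. inv (f x)"
      have g: "?g \<in> carrier ?E"
        using f by (intro restrict_endo equiv_hom_minus S) (simp add: E)
      have "?g \<oplus>\<^bsub>?E\<^esub> f = \<zero>\<^bsub>?E\<^esub>"
        by (rule eq) (use f g zero_c add_c c in \<open>auto simp: add zero\<close>)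
      then show "\<exists>g\<in>carrier ?E. g \<oplus>\<^bsub>?E\<^esub> f = \<zero>\<^bsub>?E\<^esub>" using g by blast
    qed (use add_c zero_c in auto)
    show "monoid ?E"
    proof (rule monoidI)
      fix f g k assume f: "f \<in> carrier ?E" and g: "g \<in> carrier ?E" and k: "k \<in> carrier ?E"
      show "f \<otimes>\<^bsub>?E\<^esub> g \<otimes>\<^bsub>?E\<^esub> k = f \<otimes>\<^bsub>?E\<^esub> (g \<otimes>\<^bsub>?E\<^esub> k)"
        by (rule eq) (use f g k mult_c mem in \<open>auto simp: mult\<close>)
    next
      fix f assume f: "f \<in> carrier ?E"
      show "\<one>\<^bsub>?E\<^esub> \<otimes>\<^bsub>?E\<^esub> f = f" "f \<otimes>\<^bsub>?E\<^esub> \<one>\<^bsub>?E\<^esub> = f"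
        by (rule eq; use f mult_c one_c mem in \<open>auto simp: mult one\<close>)+
    qed (use mult_c one_c in auto)
    fix f g k assume f: "f \<in> carrier ?E" and g: "g \<in> carrier ?E" and k: "k \<in> carrier ?E"
    show "(f \<oplus>\<^bsub>?E\<^esub> g) \<otimes>\<^bsub>?E\<^esub> k = f \<otimes>\<^bsub>?E\<^esub> k \<oplus>\<^bsub>?E\<^esub> g \<otimes>\<^bsub>?E\<^esub> k"
      by (rule eq) (use f g k mult_c add_c mem in \<open>auto simp: mult add\<close>)
    show "k \<otimes>\<^bsub>?E\<^esub> (f \<oplus>\<^bsub>?E\<^esub> g) = k \<otimes>\<^bsub>?E\<^esub> f \<oplus>\<^bsub>?E\<^esub> k \<otimes>\<^bsub>?E\<^esub> g"
    proof (rule eq)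
      fix x assume x: "x \<in> S"
      have "k (f x \<otimes> g x) = k (f x) \<otimes> k (g x)"
        using k f g x mem by (intro equiv_homD(2)[of k S S]) (simp_all add: E)
      then show "(k \<otimes>\<^bsub>?E\<^esub> (f \<oplus>\<^bsub>?E\<^esub> g)) x = (k \<otimes>\<^bsub>?E\<^esub> f \<oplus>\<^bsub>?E\<^esub> k \<otimes>\<^bsub>?E\<^esub> g) x"
        using x f g mem by (simp add: mult add)
    qed (use f g k mult_c add_c in auto)
  qed
qed

text \<open>Schur's lemma makes the ring a division ring, and Wedderburn's theorem makes that a field.\<close>

lemma field_endo_ring:
  assumes S: "irreducible_sub S"
  shows "field (endo_ring S)" "finite (carrier (endo_ring S))"
proof -
  let ?E = "endo_ring S"
  note iS = irr_invariant[OF S]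
  interpret E: ring ?E using ring_endo_ring[OF iS] .
  have "carrier ?E \<subseteq> (\<Pi>\<^sub>E x\<in>S. S)"
  proof
    fix f assume "f \<in> carrier ?E"
    then show "f \<in> (\<Pi>\<^sub>E x\<in>S. S)" using equiv_homD(1)[of f S S] by (auto simp: endo_ring_def extensional_def)
  qed
  then show fin: "finite (carrier ?E)"
    using finite_PiE[of S "\<lambda>_. S"] finite_sub[OF invariant_sub[OF iS]] finite_subset by blast
  obtain s where s: "s \<in> S" "s \<noteq> \<one>" using irr_elem[OF S] by blast
  have "\<one>\<^bsub>?E\<^esub> s \<noteq> \<zero>\<^bsub>?E\<^esub> s" using s by (simp add: endo_ring_def)
  then have ne: "\<one>\<^bsub>?E\<^esub> \<noteq> \<zero>\<^bsub>?E\<^esub>" by metis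
  have units: "carrier ?E - {\<zero>\<^bsub>?E\<^esub>} \<subseteq> Units ?E"
  proof
    fix f assume f: "f \<in> carrier ?E - {\<zero>\<^bsub>?E\<^esub>}"
    then have fE: "f \<in> equiv_hom S S" "f \<in> extensional S" by (auto simp: endo_ring_def)
    have "\<not> (\<forall>x\<in>S. f x = \<one>)"
    proof
      assume "\<forall>x\<in>S. f x = \<one>"
      then have "f = \<zero>\<^bsub>?E\<^esub>" using fE(2) by (auto simp: endo_ring_def intro: extensionalityI)
      then show False using f by simp
    qed
    then have bij: "bij_betw f S S" using schur[OF fE(1) S S] by blast
    let ?g = "restrict (inv_into S f) S"
    have g: "?g \<in> carrier ?E" using equiv_hom_inverse[OF fE(1) bij iS] iS by (rule restrict_endo)
    have "f x \<in> S" "inv_into S f x \<in> S" "f (inv_into S f x) = x" "inv_into S f (f x) = x"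
      if "x \<in> S" for x
      using that bij by (auto simp: bij_betw_def inv_into_into f_inv_into_f)
    then have "?g \<otimes>\<^bsub>?E\<^esub> f = \<one>\<^bsub>?E\<^esub>" "f \<otimes>\<^bsub>?E\<^esub> ?g = \<one>\<^bsub>?E\<^esub>"
      by (auto simp: endo_ring_def fun_eq_iff)
    then show "f \<in> Units ?E" using f g by (auto simp: Units_def)
  qed
  have "cring ?E"
    by unfold_locales (rule E.wedderburn_little[OF fin ne units])
  then interpret E: cring ?E .
  have "Units ?E = carrier ?E - {\<zero>\<^bsub>?E\<^esub>}"
    using units ne by (auto simp: Units_def)
  then show "field ?E" by (rule E.cring_fieldI)
qed

lemma endo_commute:
  assumes "irreducible_sub S" "f \<in> equiv_hom S S" "g \<in> equiv_hom S S" "x \<in> S"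
  shows "f (g x) = g (f x)"
proof -
  interpret E: field "endo_ring S" using field_endo_ring(1)[OF assms(1)] .
  note iS = irr_invariant[OF assms(1)]
  have "restrict f S \<otimes>\<^bsub>endo_ring S\<^esub> restrict g S = restrict g S \<otimes>\<^bsub>endo_ring S\<^esub> restrict f S"
    using restrict_endo[OF assms(2) iS] restrict_endo[OF assms(3) iS] by (rule E.m_comm)
  then have "(restrict f S \<otimes>\<^bsub>endo_ring S\<^esub> restrict g S) x =
      (restrict g S \<otimes>\<^bsub>endo_ring S\<^esub> restrict f S) x" by simp
  then show ?thesis using assms equiv_homD(1) by (simp add: endo_ring_def)
qed

lemma fixed_by_all:
  assumes h: "h \<in> carrier H" "k \<in> carrier H"
    and "\<And>S x. irreducible_sub S \<Longrightarrow> x \<in> S \<Longrightarrow> \<rho> h x = \<rho> k x" and x: "x \<in> carrier A"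
  shows "\<rho> h x = \<rho> k x"
proof -
  define X where "X = {x \<in> carrier A. \<rho> h x = \<rho> k x}"
  have "subgroup X A"
  proof (rule subgroupI)
    show "X \<noteq> {}" using h act_one by (auto simp: X_def)
  qed (use h in \<open>auto simp: X_def act_mult act_inv\<close>)
  moreover have "S \<subseteq> X" if "irreducible_sub S" for S
    using assms(3)[OF that] irr_invariant[OF that] invariant_mem by (auto simp: X_def)
  ultimately have "X = carrier A" by (rule irr_generate)
  then show ?thesis using x by (auto simp: X_def)
qed

end

section \<open>The acting group\<close>

context complemented_action
begin

text \<open>Suppose that an orbit \<open>E s\<close> of least order under the endomorphisms \<open>E\<close> of \<open>S\<close> is proper. The orbit of a
vector outside it is disjoint from it and at least as large, so \<open>|E s|^2 \<le> |S|\<close>. The product of \<open>E s\<close>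
with its copy in an isomorphic \<open>T\<close> therefore fits into a subspace \<open>U\<close> of \<open>S T\<close> with \<open>|U| = |S|\<close>. But \<open>U\<close>
has no invariant complement \<open>W\<close>: it meets \<open>T\<close>, and the graph of an isomorphism from \<open>S\<close> to \<open>T\<close>, or of
the trivial map, contains an element of \<open>E s\<close> times an element of the copy.\<close>

lemma endo_orbit:
  assumes cards: "\<And>S. irreducible_sub S \<Longrightarrow> card S = p ^ e"
    and isos: "\<And>S T. irreducible_sub S \<Longrightarrow> irreducible_sub T \<Longrightarrow> equivariant_iso S T"
    and S: "irreducible_sub S"
  shows "\<exists>s\<in>S. s \<noteq> \<one> \<and> (\<forall>x\<in>S. \<exists>f\<in>equiv_hom S S. x = f s)"
proof -
  note iS = irr_invariant[OF S]
  note sS = invariant_sub[OF iS]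
  have largest: "largest_irr S" using S cards by (simp add: largest_irr_def)
  have "e dvd m" using dimension_dvd(2)[OF cards] by blast
  then have "card S \<le> p ^ m" using cards[OF S] m_pos p_gt1 by (auto intro!: power_increasing dvd_imp_le)
  then obtain T where T: "irreducible_sub T" "S \<inter> T = {\<one>}" using irr_outside[OF iS] proper_of_card by blast
  note iT = irr_invariant[OF T(1)] note sT = invariant_sub[OF iT]
  obtain \<tau> where \<tau>: "\<tau> \<in> equiv_hom S T" "bij_betw \<tau> S T" using isos[OF S T(1)] by (auto simp: equivariant_iso_def)
  let ?D = "S <#> T"
  have cD: "card ?D = p ^ (2 * e)"
    using card_product[OF iS iT T(2)] cards S T(1) by (simp add: mult_2 power_add)
  have iD: "invariant ?D" using invariant_set_mult[OF iS iT] .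
  note sD = invariant_sub[OF iD]
  have mS: "x \<in> carrier A" if "x \<in> S" for x using that iS invariant_mem by blast
  have mT: "x \<in> carrier A" if "x \<in> T" for x using that iT invariant_mem by blast
  obtain l where l: "0 < l" "p ^ l < card S * card T"
    "\<And>U. subgroup U A \<Longrightarrow> U \<subseteq> ?D \<Longrightarrow> card U = p ^ l \<Longrightarrow>
      \<exists>W. invariant W \<and> W \<subseteq> ?D \<and> U \<inter> W = {\<one>} \<and> U <#> W = ?D"
    using complements_in_product[OF largest T] by blast
  have "p ^ l < p ^ (2 * e)" using l(2) card_product[OF iS iT T(2)] cD by simp
  then have l2e: "l < 2 * e" using power_less_imp_less_exp[OF p_gt1] by blast
  define orb where "orb = (\<lambda>s. {f s |f. f \<in> equiv_hom S S})"
  have orb_self: "s \<in> orb s" for s using equiv_hom_id by (force simp: orb_def)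
  have orb_S: "orb s \<subseteq> S" if "s \<in> S" for s
    using that equiv_homD(1) by (auto simp: orb_def)
  have orb_sub: "subgroup (orb s) A" if s: "s \<in> S" for s
  proof (rule subgroupI)
    show "orb s \<subseteq> carrier A" using orb_S[OF s] mS by auto
    show "orb s \<noteq> {}" using orb_self by auto
    show "inv a \<in> orb s" if a: "a \<in> orb s" for a
    proof -
      obtain f where "f \<in> equiv_hom S S" "a = f s" using a by (auto simp: orb_def)
      then show ?thesis using equiv_hom_minus[OF _ iS, of f S] by (force simp: orb_def)
    qed
    show "a \<otimes> b \<in> orb s" if ab: "a \<in> orb s" "b \<in> orb s" for a b
    proof -
      obtain f g where "f \<in> equiv_hom S S" "a = f s" "g \<in> equiv_hom S S" "b = g s"
        using ab by (auto simp: orb_def)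
      then show ?thesis using equiv_hom_mult[OF _ _ iS, of f S g] by (force simp: orb_def)
    qed
  qed
  have orb_disj: "orb s \<inter> orb t = {\<one>}" if st: "s \<in> S" "t \<in> S" "t \<notin> orb s" for s t
  proof -
    have "x = \<one>" if x: "x \<in> orb s" "x \<in> orb t" for x
    proof (rule ccontr)
      assume x1: "x \<noteq> \<one>"
      obtain f g where fg: "f \<in> equiv_hom S S" "x = f s" "g \<in> equiv_hom S S" "x = g t"
        using x by (auto simp: orb_def)
      then have "bij_betw g S S" using schur[OF fg(3) S S] x1 st by auto
      then have "inv_into S g \<in> equiv_hom S S" "t = inv_into S g (g t)"
        using equiv_hom_inverse[OF fg(3)] iS st by (auto simp: bij_betw_def)
      then have "t = inv_into S g (f s)" "(\<lambda>x. inv_into S g (f x)) \<in> equiv_hom S S"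
        using fg equiv_hom_comp by auto
      then have "t \<in> orb s" by (auto simp: orb_def)
      then show False using st by simp
    qed
    then show ?thesis
      using subgroup.one_closed[OF orb_sub] st by blast
  qed
  define Q where "Q = (\<lambda>s. s \<in> S \<and> s \<noteq> \<one>)"
  obtain s0 where "Q s0" using irr_elem[OF S] by (auto simp: Q_def)
  then obtain s where "Q s" and least: "\<And>t. Q t \<Longrightarrow> card (orb s) \<le> card (orb t)"
    using ex_has_least_nat[of Q s0 "\<lambda>s. card (orb s)"] by blast
  then have s: "s \<in> S" "s \<noteq> \<one>" by (auto simp: Q_def)
  have "orb s = S"
  proof (rule ccontr)
    assume "orb s \<noteq> S"
    then obtain t where t: "t \<in> S" "t \<notin> orb s" using orb_S[OF s(1)] by blast
    have "t \<noteq> \<one>" using t subgroup.one_closed[OF orb_sub[OF s(1)]] by auto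
    then have "card (orb s) \<le> card (orb t)" using least t(1) by (simp add: Q_def)
    then have "card (orb s) * card (orb s) \<le> card (orb s) * card (orb t)" by simp
    also have "\<dots> = card (orb s <#> orb t)"
      using card_set_mult_disjoint[OF orb_sub[OF s(1)] orb_sub[OF t(1)] orb_disj[OF s(1) t]] by simp
    also have "\<dots> \<le> card S"
      using set_mult_least[OF sS orb_S[OF s(1)] orb_S[OF t(1)]] finite_sub[OF sS]
      by (intro card_mono)
    finally have small: "card (orb s) * card (orb s) \<le> p ^ e" using cards[OF S] by simp
    let ?O = "\<tau> ` orb s"
    have O_T: "?O \<subseteq> T" using orb_S[OF s(1)] equiv_homD(1)[OF \<tau>(1)] by blast
    have O_sub: "subgroup ?O A"
    proof (rule subgroupI)
      show "?O \<subseteq> carrier A" using O_T mT by auto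
      show "?O \<noteq> {}" using orb_self by auto
      show "inv a \<in> ?O" if a: "a \<in> ?O" for a
      proof -
        obtain x where x: "x \<in> orb s" "a = \<tau> x" using a by blast
        then have "inv a = \<tau> (inv x)" using equiv_hom_inv[OF \<tau>(1) iS iT] orb_S[OF s(1)] by auto
        then show ?thesis using x subgroup.m_inv_closed[OF orb_sub[OF s(1)]] by blast
      qed
      show "a \<otimes> b \<in> ?O" if ab: "a \<in> ?O" "b \<in> ?O" for a b
      proof -
        obtain x y where x: "x \<in> orb s" "a = \<tau> x" "y \<in> orb s" "b = \<tau> y" using ab by blast
        then have "x \<in> S" "y \<in> S" using orb_S[OF s(1)] by blast+
        then have "a \<otimes> b = \<tau> (x \<otimes> y)"
          using equiv_homD(2)[OF \<tau>(1), of x y] x by simp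
        then show ?thesis using x subgroup.m_closed[OF orb_sub[OF s(1)]] by blast
      qed
    qed
    have O_card: "card ?O \<le> card (orb s)"
      using finite_sub[OF orb_sub[OF s(1)]] by (rule card_image_le)
    have disj: "orb s \<inter> ?O = {\<one>}"
      using orb_S[OF s(1)] O_T T(2) subgroup.one_closed[OF orb_sub[OF s(1)]]
        subgroup.one_closed[OF O_sub] by blast
    let ?U0 = "orb s <#> ?O"
    have U0: "subgroup ?U0 A" using orb_sub[OF s(1)] O_sub by (rule mult_subgroups)
    have U0D: "?U0 \<subseteq> ?D" using orb_S[OF s(1)] O_T by (rule mono_set_mult)
    have "card ?U0 \<le> card (orb s) * card (orb s)"
      using card_set_mult_disjoint[OF orb_sub[OF s(1)] O_sub disj] O_card by simp
    then have U0c: "card ?U0 \<le> p ^ e" using small by simp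
    \<comment> \<open>The order of a submodule is a power of \<open>p^e\<close>, so \<open>l\<close>, being strictly between \<open>0\<close>
      and \<open>2 e\<close>, can only be \<open>e\<close>.\<close>
    have le: "l = e"
    proof -
      have "card {\<one>} \<le> p ^ l" "p ^ l \<le> card ?D" using cD l2e p_gt1 by (auto simp: Suc_leI)
      then obtain U where U: "subgroup U A" "U \<subseteq> ?D" "card U = p ^ l"
        using subgroup_between[OF triv_subgroup sD, of l] subgroup.one_closed[OF sD] by auto
      obtain W where W: "invariant W" "U \<inter> W = {\<one>}" "U <#> W = ?D" using l(3)[OF U] by blast
      obtain k where k: "card W = (p ^ e) ^ k" using card_power_of_irr[OF W(1) cards] by blast
      have "p ^ (2 * e) = p ^ (l + e * k)"
        using card_set_mult_disjoint[OF U(1) invariant_sub[OF W(1)] W(2)] W(3) U(3) k cD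
        by (simp add: power_add power_mult)
      then have eq: "2 * e = l + e * k" using p_gt1 by simp
      have "k = 1"
      proof (rule ccontr)
        assume "k \<noteq> 1"
        then consider "k = 0" | "k \<ge> 2" by linarith
        then show False
        proof cases
          case 2
          then have "e * k \<ge> e * 2" by simp
          then show False using eq l(1) by linarith
        qed (use eq l2e in simp)
      qed
      then show ?thesis using eq by simp
    qed
    have "p ^ e \<le> card ?D" using cD p_gt1 by simp
    then obtain U where U: "subgroup U A" "?U0 \<subseteq> U" "U \<subseteq> ?D" "card U = p ^ e"
      using subgroup_between[OF U0 sD U0D U0c] by blast
    obtain W where W: "invariant W" "W \<subseteq> ?D" "U \<inter> W = {\<one>}" "U <#> W = ?D"
      using l(3)[OF U(1,3)] U(4) le by blast
    have "card U < card ?D" "1 < card U"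
      using U(4) cards[OF S] card_irr_gt1[OF S] power_strict_increasing[OF l2e p_gt1] le cD by auto
    then have nontriv: "W \<noteq> {\<one>}" "W \<noteq> ?D"
      using complement_nontrivial[OF W(3,4) U(1)] by auto
    have orbU: "orb s \<subseteq> U" "?O \<subseteq> U"
      using subset_set_mult[OF orb_sub[OF s(1)] O_sub] U(2) by blast+
    have \<tau>s: "\<tau> s \<in> ?O" using orb_self by blast
    have "W \<noteq> T"
    proof
      assume "W = T"
      then have "\<tau> s = \<one>" using \<tau>s O_T orbU(2) W(3) by blast
      moreover have "\<tau> \<one> = \<one>" using equiv_hom_one[OF \<tau>(1) iS iT] .
      ultimately have "s = \<one>"
        using \<tau>(2) s(1) invariant_one[OF iS] by (auto simp: bij_betw_def inj_on_def)
      then show False using s by simp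
    qed
    then obtain g where g: "g \<in> equiv_hom S T" "W = (\<lambda>x. x \<otimes> g x) ` S"
      using invariant_in_product[OF S T W(1,2)] nontriv by blast
    define f where "f = (\<lambda>x. inv_into S \<tau> (g x))"
    have f: "f \<in> equiv_hom S S"
      unfolding f_def by (rule equiv_hom_comp[OF g(1) equiv_hom_inverse[OF \<tau> iS]])
    have gT: "g s \<in> T" using equiv_homD(1)[OF g(1) s(1)] .
    then have "g s = \<tau> (f s)" using \<tau>(2) by (simp add: f_def bij_betw_def f_inv_into_f)
    moreover have "f s \<in> orb s" using f by (auto simp: orb_def)
    ultimately have "g s \<in> ?O" by blast
    then have "s \<otimes> g s \<in> U"
      using orb_self orbU subgroup.m_closed[OF U(1)] by blast
    moreover have "s \<otimes> g s \<in> W" using g(2) s(1) by blast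
    ultimately have "s \<otimes> g s = \<one>" using W(3) by blast
    then have "s = inv (g s)" using mS[OF s(1)] mT[OF gT] by (metis inv_equality inv_inv)
    then have "s \<in> T" using subgroup.m_inv_closed[OF sT gT] by simp
    then show False using s T(2) by blast
  qed
  then have "\<forall>x\<in>S. \<exists>f\<in>equiv_hom S S. x = f s" by (auto simp: orb_def)
  then show ?thesis using s by blast
qed

text \<open>On the orbit \<open>E s = S\<close> an element \<open>h\<close> agrees with the endomorphism \<open>a\<close> determined by \<open>h s = a s\<close>, because
\<open>h (f s) = f (h s) = f (a s) = a (f s)\<close>; the last step is commutativity of \<open>E\<close>.\<close>

lemma cyclic_acting_group:
  assumes cards: "\<And>S. irreducible_sub S \<Longrightarrow> card S = p ^ e"
    and isos: "\<And>S T. irreducible_sub S \<Longrightarrow> irreducible_sub T \<Longrightarrow> equivariant_iso S T"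
    and faithful: "\<And>h. h \<in> carrier H \<Longrightarrow> (\<And>x. x \<in> carrier A \<Longrightarrow> \<rho> h x = x) \<Longrightarrow> h = \<one>\<^bsub>H\<^esub>"
  shows "cyclic_group H"
proof -
  obtain S where "largest_irr S" using largest_irr_exists by blast
  then have S: "irreducible_sub S" by (simp add: largest_irr_def)
  note iS = irr_invariant[OF S]
  let ?E = "endo_ring S"
  obtain s where s: "s \<in> S" "s \<noteq> \<one>" "\<And>x. x \<in> S \<Longrightarrow> \<exists>f\<in>equiv_hom S S. x = f s"
    using endo_orbit[OF cards isos S] by blast
  have scal: "\<rho> h \<in> equiv_hom S S" if h: "h \<in> carrier H" for h
  proof -
    obtain a where a: "a \<in> equiv_hom S S" "\<rho> h s = a s"
      using s(3)[OF invariant_act[OF iS h s(1)]] by blast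
    have "\<rho> h x = a x" if "x \<in> S" for x
    proof -
      obtain f where f: "f \<in> equiv_hom S S" "x = f s" using s(3) \<open>x \<in> S\<close> by blast
      then have "\<rho> h x = f (a s)" using equiv_homD(3)[OF f(1) h s(1)] a(2) by simp
      then show ?thesis using endo_commute[OF S f(1) a(1) s(1)] f(2) by simp
    qed
    then show ?thesis using equiv_hom_cong[OF a(1) iS] by blast
  qed
  interpret E: field ?E using field_endo_ring(1)[OF S] .
  have finE: "finite (carrier ?E)" using field_endo_ring(2)[OF S] .
  define F where "F = (\<lambda>h. restrict (\<rho> h) S)"
  have Fc: "F h \<in> carrier (mult_of ?E)" if h: "h \<in> carrier H" for h
  proof -
    have "\<rho> h s \<noteq> \<one>"
      using act_cancel(2)[OF h, of s] act_one[of "inv\<^bsub>H\<^esub> h"] h s iS invariant_mem by auto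
    then have "F h s \<noteq> \<zero>\<^bsub>?E\<^esub> s" using s(1) by (simp add: F_def endo_ring_def)
    then have "F h \<noteq> \<zero>\<^bsub>?E\<^esub>" by metis
    then show ?thesis using restrict_endo[OF scal[OF h] iS] by (simp add: F_def)
  qed
  have "F \<in> hom H (mult_of ?E)"
  proof (rule homI)
    show "F (h \<otimes>\<^bsub>H\<^esub> k) = F h \<otimes>\<^bsub>mult_of ?E\<^esub> F k" if "h \<in> carrier H" "k \<in> carrier H" for h k
      using that iS invariant_act invariant_mem
      by (auto simp: F_def endo_ring_def act_comp)
  qed (rule Fc)
  moreover have "inj_on F (carrier H)"
  proof (rule inj_onI)
    fix h k assume h: "h \<in> carrier H" and k: "k \<in> carrier H" and eq: "F h = F k"
    have eqS: "\<rho> h x = \<rho> k x" if "x \<in> S" for x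
      using fun_cong[OF eq, of x] that by (simp add: F_def)
    have "\<rho> h x = \<rho> k x" if T: "irreducible_sub T" "x \<in> T" for T x
    proof -
      obtain \<tau> where \<tau>: "\<tau> \<in> equiv_hom S T" "bij_betw \<tau> S T"
        using isos[OF S T(1)] by (auto simp: equivariant_iso_def)
      then obtain y where "y \<in> S" "x = \<tau> y" using T(2) by (auto simp: bij_betw_def)
      then show ?thesis using equiv_homD(3)[OF \<tau>(1)] h k eqS by metis
    qed
    then have all: "\<rho> h x = \<rho> k x" if "x \<in> carrier A" for x
      using fixed_by_all[OF h k _ that] by blast
    have "inv\<^bsub>H\<^esub> k \<otimes>\<^bsub>H\<^esub> h = \<one>\<^bsub>H\<^esub>"
      using h k all act_cancel(2)[OF k] by (intro faithful) (auto simp: act_comp)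
    then show "h = k" using h k H.inv_mult_one_imp_eq by blast
  qed
  ultimately show ?thesis
    using E.finite_field_mult_group_has_gen[OF finE] E.field_mult_group H.is_group
      group.cyclic_if_in_cyclic[OF E.field_mult_group E.finite_mult_of[OF finE], of _ H F]
    by (auto simp: nat_pow_mult_of)
qed

text \<open>An irreducible submodule of order \<open>p\<close> is cyclic, and automorphisms of cyclic groups are power maps, which commute.\<close>

lemma abelian_acting_group:
  assumes cards: "\<And>S. irreducible_sub S \<Longrightarrow> card S = p"
    and faithful: "\<And>h. h \<in> carrier H \<Longrightarrow> (\<And>x. x \<in> carrier A \<Longrightarrow> \<rho> h x = x) \<Longrightarrow> h = \<one>\<^bsub>H\<^esub>"
    and h: "h \<in> carrier H" and k: "k \<in> carrier H"
  shows "h \<otimes>\<^bsub>H\<^esub> k = k \<otimes>\<^bsub>H\<^esub> h"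
proof -
  have irreducible_sub: "\<rho> (h \<otimes>\<^bsub>H\<^esub> k) x = \<rho> (k \<otimes>\<^bsub>H\<^esub> h) x" if S: "irreducible_sub S" "x \<in> S" for S x
  proof -
    note iS = irr_invariant[OF S(1)]
    obtain s where s: "s \<in> S" "s \<noteq> \<one>" using irr_elem[OF S(1)] by blast
    have sc: "s \<in> carrier A" using s iS invariant_mem by blast
    have "generate A {s} = S"
      using generate_singleton_sub[OF invariant_sub[OF iS] s(1)] card_generate_singleton[OF sc s(2)]
        cards[OF S(1)] finite_sub[OF invariant_sub[OF iS]] by (intro card_subset_eq) auto
    then have pow: "\<exists>i::nat. y = s [^] i" if "y \<in> S" for y
      using that generate_pow_nat[OF sc] ord_ge_1[OF finite_carrier sc] by auto
    obtain a :: nat where a: "\<rho> h s = s [^] a" using pow invariant_act[OF iS h s(1)] by blast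
    obtain b :: nat where b: "\<rho> k s = s [^] b" using pow invariant_act[OF iS k s(1)] by blast
    obtain i :: nat where i: "x = s [^] i" using pow S(2) by blast
    show ?thesis using h k sc a b i
      by (simp add: act_comp act_pow nat_pow_pow ac_simps)
  qed
  have all: "\<rho> (h \<otimes>\<^bsub>H\<^esub> k) x = \<rho> (k \<otimes>\<^bsub>H\<^esub> h) x" if "x \<in> carrier A" for x
    by (rule fixed_by_all[OF H.m_closed[OF h k] H.m_closed[OF k h] irreducible_sub that])
  have "inv\<^bsub>H\<^esub> (k \<otimes>\<^bsub>H\<^esub> h) \<otimes>\<^bsub>H\<^esub> (h \<otimes>\<^bsub>H\<^esub> k) = \<one>\<^bsub>H\<^esub>"
  proof (rule faithful)
    fix x assume x: "x \<in> carrier A"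
    have kh: "k \<otimes>\<^bsub>H\<^esub> h \<in> carrier H" and hk: "h \<otimes>\<^bsub>H\<^esub> k \<in> carrier H" using h k by auto
    show "\<rho> (inv\<^bsub>H\<^esub> (k \<otimes>\<^bsub>H\<^esub> h) \<otimes>\<^bsub>H\<^esub> (h \<otimes>\<^bsub>H\<^esub> k)) x = x"
      using act_comp[OF H.inv_closed[OF kh] hk x] all[OF x] act_cancel(2)[OF kh x] by simp
  qed (use h k in auto)
  then show ?thesis by (rule H.inv_mult_one_imp_eq[OF H.m_closed[OF k h] H.m_closed[OF h k]])
qed

end

section \<open>Maximal subgroups of p-groups\<close>

lemma (in group) group_action_restrict:
  assumes closed: "\<And>g x. g \<in> carrier G \<Longrightarrow> x \<in> E \<Longrightarrow> act g x \<in> E"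
    and comp: "\<And>g h x. g \<in> carrier G \<Longrightarrow> h \<in> carrier G \<Longrightarrow> x \<in> E \<Longrightarrow>
      act (g \<otimes> h) x = act g (act h x)"
    and id: "\<And>x. x \<in> E \<Longrightarrow> act \<one> x = x"
  shows "group_action G E (\<lambda>g. restrict (act g) E)"
proof -
  have inv: "act (inv g) (act g x) = x" "act g (act (inv g) x) = x" if "g \<in> carrier G" "x \<in> E" for g x
    using comp[of "inv g" g x] comp[of g "inv g" x] that id by auto
  have bij: "bij_betw (act g) E E" if "g \<in> carrier G" for g
    by (rule bij_betw_byWitness[where f' = "act (inv g)"]) (use that closed inv in auto)
  have Bij: "restrict (act g) E \<in> Bij E" if "g \<in> carrier G" for g
    using bij[OF that] by (simp add: Bij_def)
  have "(\<lambda>g. restrict (act g) E) \<in> hom G (BijGroup E)"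
  proof (rule homI)
    show "restrict (act (g \<otimes> h)) E = restrict (act g) E \<otimes>\<^bsub>BijGroup E\<^esub> restrict (act h) E"
      if "g \<in> carrier G" "h \<in> carrier G" for g h
      using that Bij closed comp by (auto simp: BijGroup_def compose_def fun_eq_iff)
  qed (simp add: BijGroup_def Bij)
  then show ?thesis
    by (simp add: group_action_def group_hom_def group_hom_axioms_def group_BijGroup is_group)
qed

text \<open>The orbits other than fixed points have sizes that divide a power of \<open>q\<close> and are not 1.\<close>

lemma (in group) prime_dvd_card_not_fixed:
  assumes q: "prime q" "Coset.order G = q ^ k" and finE: "finite E"
    and closed: "\<And>g x. g \<in> carrier G \<Longrightarrow> x \<in> E \<Longrightarrow> act g x \<in> E"
    and comp: "\<And>g h x. g \<in> carrier G \<Longrightarrow> h \<in> carrier G \<Longrightarrow> x \<in> E \<Longrightarrow>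
      act (g \<otimes> h) x = act g (act h x)"
    and id: "\<And>x. x \<in> E \<Longrightarrow> act \<one> x = x"
  shows "q dvd card (E - {x \<in> E. \<forall>g\<in>carrier G. act g x = x})"
proof -
  define \<phi> where "\<phi> = (\<lambda>g. restrict (act g) E)"
  interpret group_action G E \<phi>
    unfolding \<phi>_def by (rule group_action_restrict[of E act]) (use closed comp id in auto)
  let ?F = "{x \<in> E. \<forall>g\<in>carrier G. act g x = x}"
  have orb: "orbit G \<phi> x = (\<lambda>g. act g x) ` carrier G" if "x \<in> E" for x
    using that by (auto simp: orbit_def \<phi>_def)
  have self: "x \<in> orbit G \<phi> x" if "x \<in> E" for x
    using orbit_refl that by blast
  define \<C> where "\<C> = {orbit G \<phi> x |x. x \<in> E - ?F}"
  have "q dvd card c" if c: "c \<in> \<C>" for c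
  proof -
    obtain x where x: "x \<in> E" "x \<notin> ?F" "c = orbit G \<phi> x" using c by (auto simp: \<C>_def)
    then obtain g where g: "g \<in> carrier G" "act g x \<noteq> x" by auto
    have sub: "{x, act g x} \<subseteq> c" using orb[OF x(1)] x(3) self[OF x(1)] g by auto
    have "c \<subseteq> E" using orb[OF x(1)] x closed by auto
    then have "card {x, act g x} \<le> card c" using sub finE finite_subset by (intro card_mono) auto
    then have c2: "card c \<noteq> 1" using g by auto
    have "card c dvd q ^ k"
      using orbit_stabilizer_theorem[OF x(1)] x(3) q(2) by (metis dvd_triv_left)
    then obtain j where "card c = q ^ j" using divides_primepow_nat[OF q(1)] by blast
    then show ?thesis using c2 by (cases j) auto
  qed
  moreover have "c1 \<inter> c2 = {}" if "c1 \<in> \<C>" "c2 \<in> \<C>" "c1 \<noteq> c2" for c1 c2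
  proof -
    have "c1 \<in> orbits G E \<phi>" "c2 \<in> orbits G E \<phi>" using that by (auto simp: \<C>_def orbits_def)
    then show ?thesis using orbit_partition that(3) unfolding partition_def by blast
  qed
  moreover have "\<Union> \<C> = E - ?F"
  proof
    show "E - ?F \<subseteq> \<Union> \<C>" using self by (auto simp: \<C>_def)
    show "\<Union> \<C> \<subseteq> E - ?F"
    proof
      fix y assume "y \<in> \<Union> \<C>"
      then obtain x where x0: "x \<in> E" "x \<notin> ?F" "y \<in> orbit G \<phi> x"
        unfolding \<C>_def by blast
      then obtain g where "g \<in> carrier G" "y = act g x" using orb[OF x0(1)] by auto
      note x = x0(1,2) this
      have "y \<notin> ?F"
      proof
        assume y: "y \<in> ?F"
        have "x = act (inv g) y" using x comp[of "inv g" g x] id by simp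
        then have "x = y" using y x by simp
        then show False using x y by simp
      qed
      then show "y \<in> E - ?F" using x closed by simp
    qed
  qed
  ultimately show ?thesis using dvd_partition[of \<C> q] finE by auto
qed

lemma (in normal) rcoset_eq_iff:
  assumes "x \<in> carrier G" "y \<in> carrier G"
  shows "H #> x = H #> y \<longleftrightarrow> x \<otimes> inv y \<in> H"
proof
  assume "H #> x = H #> y"
  then have "x \<in> H #> y" using rcos_self[OF assms(1) is_subgroup] by simp
  then obtain h where "h \<in> H" "x = h \<otimes> y" by (auto simp: r_coset_def)
  then show "x \<otimes> inv y \<in> H" using assms by (simp add: m_assoc)
next
  assume h: "x \<otimes> inv y \<in> H"
  have "x = (x \<otimes> inv y) \<otimes> y" using assms by (simp add: m_assoc)
  then have "x \<in> H #> y" using h by (auto simp: r_coset_def)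
  then show "H #> x = H #> y" using repr_independence[OF _ assms(2) is_subgroup] by simp
qed

lemma (in group) exists_maximal_subgroup:
  assumes fin: "finite (carrier G)" and K: "subgroup K G" "K \<noteq> carrier G"
  shows "\<exists>M. maximal_subgroup M G \<and> K \<subseteq> M"
proof -
  define Q where "Q = (\<lambda>M. subgroup M G \<and> M \<noteq> carrier G \<and> K \<subseteq> M)"
  have "Q K" using K by (simp add: Q_def)
  moreover have "\<forall>M. Q M \<longrightarrow> card M < Suc (card (carrier G))"
    using card_mono[OF fin] subgroup.subset unfolding Q_def less_Suc_eq_le by blast
  ultimately obtain M where M: "Q M" "\<And>M'. Q M' \<Longrightarrow> card M' \<le> card M"
    using ex_has_greatest_nat[of Q K card] by metis
  have "L = M" if L: "subgroup L G" "M \<subseteq> L" "L \<noteq> carrier G" for L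
  proof -
    have "card L \<le> card M" using M L by (auto simp: Q_def)
    moreover have "finite L" using fin L(1) subgroup.subset finite_subset by blast
    ultimately show ?thesis using L(2) card_seteq by blast
  qed
  then show ?thesis using M(1) unfolding maximal_subgroup_def Q_def by blast
qed

text \<open>Normalisers grow in \<open>p\<close>-groups: \<open>M\<close> acts on its own cosets, whose number is divisible by \<open>p\<close>, and fixes
the coset \<open>M\<close>, hence at least one more. Its representative normalises \<open>M\<close>, and by maximality
the normaliser is the whole group.\<close>

lemma (in group) maximal_subgroup_normal:
  assumes p: "prime p" "Coset.order G = p ^ n" and M: "maximal_subgroup M G"
  shows "M \<lhd> G"
proof -
  have sM: "subgroup M G" and Mne: "M \<noteq> carrier G"
    and maxi: "\<And>K. subgroup K G \<Longrightarrow> M \<subseteq> K \<Longrightarrow> K = M \<or> K = carrier G"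
    using M by (auto simp: maximal_subgroup_def)
  have "Coset.order G > 0" using p prime_gt_0_nat by simp
  then have fin: "finite (carrier G)" by (simp add: Coset.order_def card_gt_0_iff)
  note mM = subgroup.mem_carrier[OF sM]
  have finM: "finite M" using fin sM subgroup.subset finite_subset by blast
  interpret M: group "G\<lparr>carrier := M\<rparr>" by (rule subgroup.subgroup_is_group[OF sM is_group])
  have lag: "card (rcosets M) * card M = p ^ n" using lagrange[OF sM] p(2) by simp
  obtain a where a: "card M = p ^ a"
    using lag divides_primepow_nat[OF p(1)] by (metis dvd_triv_right)
  obtain b where b: "card (rcosets M) = p ^ b"
    using lag divides_primepow_nat[OF p(1)] by (metis dvd_triv_left)
  have "card M < card (carrier G)"
    using fin sM Mne subgroup.subset by (intro psubset_card_mono) auto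
  then have "b \<noteq> 0" using lag b p(2) by (cases b) (auto simp: Coset.order_def)
  then have pE: "p dvd card (rcosets M)" using b by simp
  have "card (rcosets M) > 0" using b prime_gt_0_nat[OF p(1)] by simp
  then have finE: "finite (rcosets M)" by (rule card_ge_0_finite)
  define act where "act = (\<lambda>g C. C #> inv g)"
  have rc: "(M #> x) #> inv g = M #> (x \<otimes> inv g)" if "x \<in> carrier G" "g \<in> M" for x g
    using that mM sM subgroup.subset by (intro coset_mult_assoc) auto
  define Fix where "Fix = {C \<in> rcosets M. \<forall>g\<in>M. act g C = C}"
  have "p dvd card (rcosets M - {C \<in> rcosets M. \<forall>g\<in>carrier (G\<lparr>carrier := M\<rparr>). act g C = C})"
  proof (rule M.prime_dvd_card_not_fixed[OF p(1) _ finE])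
    show "Coset.order (G\<lparr>carrier := M\<rparr>) = p ^ a" using a by (simp add: Coset.order_def)
    show "act g C \<in> rcosets M" if "g \<in> carrier (G\<lparr>carrier := M\<rparr>)" "C \<in> rcosets M" for g C
      using that rc mM by (auto simp: act_def RCOSETS_def)
    show "act \<one>\<^bsub>G\<lparr>carrier := M\<rparr>\<^esub> C = C" if "C \<in> rcosets M" for C
      using that subgroup.rcosets_carrier[OF sM is_group] by (simp add: act_def)
    show "act (g \<otimes>\<^bsub>G\<lparr>carrier := M\<rparr>\<^esub> h) C = act g (act h C)"
      if "g \<in> carrier (G\<lparr>carrier := M\<rparr>)" "h \<in> carrier (G\<lparr>carrier := M\<rparr>)" "C \<in> rcosets M" for g h C
    proof -
      have "g \<in> carrier G" "h \<in> carrier G" "C \<subseteq> carrier G"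
        using that mM subgroup.rcosets_carrier[OF sM is_group] by auto
      then show ?thesis by (simp add: act_def inv_mult_group coset_mult_assoc)
    qed
  qed
  then have "p dvd card (rcosets M - Fix)" by (simp add: Fix_def)
  moreover have "card (rcosets M) = card (rcosets M - Fix) + card Fix"
    using finE by (subst card_Un_disjoint[symmetric]) (auto simp: Fix_def intro: arg_cong[where f = card])
  ultimately have pF: "p dvd card Fix" using pE by (metis dvd_add_right_iff)
  have "M #> inv g = M" if "g \<in> M" for g
    using that mM subgroup.m_inv_closed[OF sM] by (intro coset_join2 sM) auto
  then have MF: "M \<in> Fix"
    using subgroup.subgroup_in_rcosets[OF sM is_group] by (simp add: Fix_def act_def)
  have "card Fix \<noteq> 0" using MF finE by (auto simp: Fix_def)
  then have "card Fix \<ge> p" using pF by (auto dest: dvd_imp_le)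
  then have "card Fix > 1" using prime_gt_1_nat[OF p(1)] by simp
  then have "Fix \<noteq> {M}" by auto
  then obtain C where C: "C \<in> Fix" "C \<noteq> M" using MF by blast
  then obtain x where x: "x \<in> carrier G" "C = M #> x" by (auto simp: Fix_def RCOSETS_def)
  have xM: "x \<notin> M" using C(2) x coset_join2[OF x(1) sM] by auto
  have conj: "x \<otimes> g \<otimes> inv x \<in> M" if g: "g \<in> M" for g
  proof -
    have "M #> (x \<otimes> inv (inv g)) = M #> x"
      using C(1) x rc[OF x(1), of "inv g"] subgroup.m_inv_closed[OF sM g] by (auto simp: Fix_def act_def)
    then have "x \<otimes> g \<in> M #> x"
      using g mM x(1) rcos_self[of "x \<otimes> g" M] sM by simp
    then obtain k where "k \<in> M" "x \<otimes> g = k \<otimes> x" by (auto simp: r_coset_def)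
    then show ?thesis using x(1) mM by (simp add: m_assoc)
  qed
  define K where "K = {y \<in> carrier G. (\<lambda>g. y \<otimes> g \<otimes> inv y) ` M = M}"
  have inj: "inj_on (\<lambda>g. y \<otimes> g \<otimes> inv y) M" if "y \<in> carrier G" for y
    using that mM by (auto intro!: inj_onI)
  have K_I: "y \<in> K" if "y \<in> carrier G" "\<And>g. g \<in> M \<Longrightarrow> y \<otimes> g \<otimes> inv y \<in> M" for y
    using that endo_inj_surj[OF finM _ inj[OF that(1)]] by (auto simp: K_def)
  have K_D: "y \<otimes> g \<otimes> inv y \<in> M" if "y \<in> K" "g \<in> M" for y g
    using that by (auto simp: K_def)
  have "subgroup K G"
  proof (rule subgroupI)
    show "K \<noteq> {}" using K_I[of \<one>] mM by auto
    show "inv y \<in> K" if y: "y \<in> K" for y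
    proof (rule K_I)
      have yG: "y \<in> carrier G" using y by (simp add: K_def)
      show "inv y \<in> carrier G" using yG by simp
      fix g assume "g \<in> M"
      then obtain k where k: "k \<in> M" "g = y \<otimes> k \<otimes> inv y" using y by (auto simp: K_def)
      then have "inv y \<otimes> g \<otimes> inv (inv y) = k" using yG mM[OF k(1)]
        by (simp add: m_assoc) (simp add: m_assoc[symmetric])
      then show "inv y \<otimes> g \<otimes> inv (inv y) \<in> M" using k by simp
    qed
    show "y \<otimes> z \<in> K" if yz: "y \<in> K" "z \<in> K" for y z
    proof (rule K_I)
      have c: "y \<in> carrier G" "z \<in> carrier G" using yz by (auto simp: K_def)
      then show "y \<otimes> z \<in> carrier G" by simp
      fix g assume g: "g \<in> M"
      have "y \<otimes> z \<otimes> g \<otimes> inv (y \<otimes> z) = y \<otimes> (z \<otimes> g \<otimes> inv z) \<otimes> inv y"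
        using c mM[OF g] by (simp add: inv_mult_group m_assoc)
      then show "y \<otimes> z \<otimes> g \<otimes> inv (y \<otimes> z) \<in> M" using K_D[OF yz(1) K_D[OF yz(2) g]] by simp
    qed
  qed (auto simp: K_def)
  moreover have "M \<subseteq> K"
    
  proof
    fix y assume y: "y \<in> M"
    show "y \<in> K"
      using y by (intro K_I mM) (auto intro: subgroup.m_closed[OF sM] subgroup.m_inv_closed[OF sM])
  qed
  moreover have "x \<in> K" using K_I x(1) conj by blast
  ultimately have "K = carrier G" using maxi xM by blast
  then show ?thesis using K_D by (metis normal_invI[OF sM])
qed

text \<open>By maximality the quotient by \<open>M\<close> is generated by each of its nontrivial elements. It is thus cyclic, hence
abelian. If \<open>x^p\<close> were outside \<open>M\<close>, then modulo \<open>M\<close> the element \<open>x\<close> would be a power of \<open>x^p\<close>, which is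
impossible for a nontrivial element of \<open>p\<close>-power order.\<close>

lemma (in group) maximal_subgroup_p_group:
  assumes p: "prime p" "Coset.order G = p ^ n" and M: "maximal_subgroup M G"
  shows "x \<in> carrier G \<Longrightarrow> x [^] p \<in> M"
    and "x \<in> carrier G \<Longrightarrow> y \<in> carrier G \<Longrightarrow> x \<otimes> y \<otimes> inv x \<otimes> inv y \<in> M"
proof -
  have sM: "subgroup M G" and Mne: "M \<noteq> carrier G"
    and maxi: "\<And>K. subgroup K G \<Longrightarrow> M \<subseteq> K \<Longrightarrow> K = M \<or> K = carrier G"
    using M by (auto simp: maximal_subgroup_def)
  interpret M: normal M G using maximal_subgroup_normal[OF assms] .
  have "Coset.order G > 0" using p prime_gt_0_nat by simp
  then have fin: "finite (carrier G)" by (simp add: Coset.order_def card_gt_0_iff)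
  interpret Q: group "G Mod M" by (rule M.factorgroup_is_group)
  interpret \<pi>: group_hom G "G Mod M" "\<lambda>x. M #> x"
    by unfold_locales (rule M.r_coset_hom_Mod)
  have ker: "M #> x = \<one>\<^bsub>G Mod M\<^esub> \<longleftrightarrow> x \<in> M" if "x \<in> carrier G" for x
    using M.rcoset_eq_iff[OF that one_closed] that sM coset_join2[OF one_closed sM] subgroup.one_closed[OF sM]
    by simp
  have gen: "\<exists>i::nat. M #> x = (M #> z) [^]\<^bsub>G Mod M\<^esub> i"
    if z: "z \<in> carrier G" "z \<notin> M" and x: "x \<in> carrier G" for x z
  proof -
    have gz: "subgroup (generate G {z}) G" using z by (intro generate_is_subgroup) auto
    have "subgroup (M <#> generate G {z}) G" using mult_norm_subgroup[OF M.normal_axioms gz] .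
    moreover have "M \<subseteq> M <#> generate G {z}"
    proof
      fix a assume a: "a \<in> M"
      have "a \<otimes> \<one> \<in> M <#> generate G {z}"
        using a subgroup.one_closed[OF gz] unfolding set_mult_def by blast
      then show "a \<in> M <#> generate G {z}" using a M.mem_carrier by simp
    qed
    moreover have "\<one> \<otimes> z \<in> M <#> generate G {z}"
      using M.one_closed generate.incl[of z "{z}" G] unfolding set_mult_def by blast
    then have "z \<in> M <#> generate G {z}" using z(1) by simp
    ultimately have "M <#> generate G {z} = carrier G" using maxi z(2) by blast
    then have "x \<in> M <#> generate G {z}" using x by simp
    then obtain a y where ay: "a \<in> M" "y \<in> generate G {z}" "x = a \<otimes> y"
      by (auto simp: set_mult_def)
    then obtain i :: nat where i: "y = z [^] i"
      using generate_pow_nat[OF z(1)] ord_ge_1[OF fin z(1)] by auto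
    have "M #> x = (M #> a) \<otimes>\<^bsub>G Mod M\<^esub> (M #> y)"
      using ay i z(1) M.mem_carrier by (simp del: mult_FactGroup)
    also have "M #> a = \<one>\<^bsub>G Mod M\<^esub>" using ker ay(1) M.mem_carrier by blast
    also have "M #> y = (M #> z) [^]\<^bsub>G Mod M\<^esub> i" using i z(1) by (simp add: \<pi>.hom_nat_pow)
    finally show ?thesis using z(1) by (metis Q.l_one Q.nat_pow_closed \<pi>.hom_closed)
  qed
  obtain z where z: "z \<in> carrier G" "z \<notin> M" using Mne subgroup.subset[OF sM] by blast
  show "x \<otimes> y \<otimes> inv x \<otimes> inv y \<in> M" if xy: "x \<in> carrier G" "y \<in> carrier G"
  proof -
    obtain i j :: nat where ij: "M #> x = (M #> z) [^]\<^bsub>G Mod M\<^esub> i" "M #> y = (M #> z) [^]\<^bsub>G Mod M\<^esub> j"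
      using gen[OF z] xy by metis
    have zc: "M #> z \<in> carrier (G Mod M)" using z \<pi>.hom_closed by blast
    have "(M #> x) \<otimes>\<^bsub>G Mod M\<^esub> (M #> y) = (M #> y) \<otimes>\<^bsub>G Mod M\<^esub> (M #> x)"
      unfolding ij using zc by (simp add: Q.nat_pow_mult add.commute del: mult_FactGroup)
    then have "M #> (x \<otimes> y) = M #> (y \<otimes> x)" using xy by (simp del: mult_FactGroup)
    then have "(x \<otimes> y) \<otimes> inv (y \<otimes> x) \<in> M" using M.rcoset_eq_iff[of "x \<otimes> y" "y \<otimes> x"] xy by simp
    then show ?thesis using xy by (simp add: inv_mult_group m_assoc)
  qed
  show "x [^] p \<in> M" if x: "x \<in> carrier G"
  proof (rule ccontr)
    assume xp: "x [^] p \<notin> M"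
    define X where "X = M #> x"
    have Xc: "X \<in> carrier (G Mod M)" using x \<pi>.hom_closed by (simp add: X_def)
    obtain i :: nat where "M #> x = (M #> (x [^] p)) [^]\<^bsub>G Mod M\<^esub> i"
      using gen[OF _ xp x] x by auto
    then have i: "X = X [^]\<^bsub>G Mod M\<^esub> (p * i)"
      using x Xc by (simp add: X_def \<pi>.hom_nat_pow Q.nat_pow_pow)
    have "X [^]\<^bsub>G Mod M\<^esub> (p ^ n) = M #> (x [^] (p ^ n))" using x by (simp add: X_def \<pi>.hom_nat_pow)
    also have "x [^] (p ^ n) = \<one>" using pow_order_eq_1[OF x] p(2) by simp
    finally have "X [^]\<^bsub>G Mod M\<^esub> (p ^ n) = \<one>\<^bsub>G Mod M\<^esub>" using \<pi>.hom_one by simp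
    then have "Q.ord X dvd p ^ n" using Q.pow_eq_id[OF Xc] by blast
    then obtain j where j: "Q.ord X = p ^ j" using divides_primepow_nat[OF p(1)] by blast
    have "x \<notin> M"
    proof
      assume "x \<in> M"
      then have "x [^] k \<in> M" for k :: nat by (induction k) auto
      then show False using xp by blast
    qed
    then have X1: "X \<noteq> \<one>\<^bsub>G Mod M\<^esub>" using ker[OF x] by (simp add: X_def)
    then have "j \<noteq> 0" using j Q.ord_eq_1[OF Xc] by (cases j) auto
    have "i \<noteq> 0" using i X1 by (cases i) auto
    then have pi: "Suc (p * i - 1) = p * i" using prime_gt_0_nat[OF p(1)] by simp
    have "X [^]\<^bsub>G Mod M\<^esub> (p * i - 1) \<otimes>\<^bsub>G Mod M\<^esub> X = X [^]\<^bsub>G Mod M\<^esub> (p * i)"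
      by (subst Q.nat_pow_Suc[symmetric]) (simp only: pi)
    also have "\<dots> = \<one>\<^bsub>G Mod M\<^esub> \<otimes>\<^bsub>G Mod M\<^esub> X" using i Q.l_one[OF Xc] by metis
    finally have "X [^]\<^bsub>G Mod M\<^esub> (p * i - 1) = \<one>\<^bsub>G Mod M\<^esub>"
      using Q.right_cancel[OF Xc Q.nat_pow_closed[OF Xc] Q.one_closed] by blast
    then have "p ^ j dvd p * i - 1" using Q.pow_eq_id[OF Xc] j by simp
    then have "p dvd p * i - 1" using \<open>j \<noteq> 0\<close> by (metis dvd_power dvd_trans gr0I)
    moreover have "p dvd p * i" by simp
    ultimately have "p dvd Suc 0"
      using pi by (metis One_nat_def Suc_eq_plus1 dvd_add_right_iff)
    then show False using prime_gt_1_nat[OF p(1)] by simp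
  qed
qed

section \<open>Frattini subgroups\<close>

context group
begin

lemma conj_inv:
  assumes "g \<in> carrier G" "x \<in> carrier G"
  shows "inv g \<otimes> (g \<otimes> x \<otimes> inv g) \<otimes> inv (inv g) = x" "g \<otimes> (inv g \<otimes> x \<otimes> g) \<otimes> inv g = x"
  using assms by (simp add: m_assoc, simp add: m_assoc[symmetric])+

lemma frattini_sub: "x \<in> frattini G \<Longrightarrow> x \<in> carrier G"
  and frattini_max: "x \<in> frattini G \<Longrightarrow> maximal_subgroup M G \<Longrightarrow> x \<in> M"
  and frattiniI: "x \<in> carrier G \<Longrightarrow> (\<And>M. maximal_subgroup M G \<Longrightarrow> x \<in> M) \<Longrightarrow> x \<in> frattini G"
  by (auto simp: frattini_def)

lemma frattini_subgroup: "subgroup (frattini G) G"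
proof (rule subgroupI)
  have s: "subgroup M G" if "maximal_subgroup M G" for M using that by (simp add: maximal_subgroup_def)
  show "frattini G \<noteq> {}" using frattiniI[OF one_closed] s subgroup.one_closed by blast
  show "inv x \<in> frattini G" if "x \<in> frattini G" for x
    using that frattini_sub frattini_max s by (intro frattiniI) (auto intro: subgroup.m_inv_closed)
  show "x \<otimes> y \<in> frattini G" if "x \<in> frattini G" "y \<in> frattini G" for x y
    using that frattini_sub frattini_max s by (intro frattiniI) (auto intro: subgroup.m_closed)
qed (auto simp: frattini_def)

text \<open>A bijective endomorphism permutes the maximal subgroups.\<close>

lemma frattini_automorphism:
  assumes f: "f \<in> hom G G" and g: "g \<in> hom G G"
    and fg: "\<And>x. x \<in> carrier G \<Longrightarrow> f (g x) = x" "\<And>x. x \<in> carrier G \<Longrightarrow> g (f x) = x"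
    and x: "x \<in> frattini G"
  shows "f x \<in> frattini G"
proof (rule frattiniI)
  interpret f: group_hom G G f by unfold_locales (rule f)
  interpret g: group_hom G G g by unfold_locales (rule g)
  have xG: "x \<in> carrier G" using x frattini_sub by blast
  then show "f x \<in> carrier G" by simp
  fix M assume M: "maximal_subgroup M G"
  then have sM: "subgroup M G" by (simp add: maximal_subgroup_def)
  note mM = subgroup.mem_carrier[OF sM]
  have "maximal_subgroup (g ` M) G"
    unfolding maximal_subgroup_def
  proof (intro conjI allI impI)
    show "subgroup (g ` M) G" using g.subgroup_img_is_subgroup[OF sM] .
    show "g ` M \<noteq> carrier G"
    proof
      assume eq: "g ` M = carrier G"
      have "y \<in> M" if y: "y \<in> carrier G" for y
      proof -
        have "g y \<in> g ` M" using eq y by simp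
        then obtain z where "z \<in> M" "g y = g z" by blast
        then show ?thesis using fg(1) y mM by metis
      qed
      then have "M = carrier G" using mM by blast
      then show False using M by (simp add: maximal_subgroup_def)
    qed
    fix K assume K: "subgroup K G" "g ` M \<subseteq> K"
    have fK: "subgroup (f ` K) G" using f.subgroup_img_is_subgroup[OF K(1)] .
    have "M \<subseteq> f ` K"
    proof
      fix y assume y: "y \<in> M"
      then have "y = f (g y)" using fg(1) mM by simp
      then show "y \<in> f ` K" using K(2) y by blast
    qed
    then have "f ` K = M \<or> f ` K = carrier G" using M fK by (simp add: maximal_subgroup_def)
    moreover have "g ` f ` K = K"
      using fg(2) subgroup.mem_carrier[OF K(1)] by (force simp: image_image)
    moreover have "g ` carrier G = carrier G"
    proof
      show "carrier G \<subseteq> g ` carrier G"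
      proof
        fix y assume "y \<in> carrier G"
        then show "y \<in> g ` carrier G" using fg(2)[of y] f.hom_closed by (metis imageI)
      qed
    qed auto
    ultimately show "K = g ` M \<or> K = carrier G" by metis
  qed
  then have "x \<in> g ` M" using x frattini_max by blast
  then show "f x \<in> M" using fg(1) mM by auto
qed

lemma conj_hom: "g \<in> carrier G \<Longrightarrow> (\<lambda>x. g \<otimes> x \<otimes> inv g) \<in> hom G G"
proof (rule homI)
  fix x y assume "g \<in> carrier G" "x \<in> carrier G" "y \<in> carrier G"
  then show "g \<otimes> (x \<otimes> y) \<otimes> inv g = (g \<otimes> x \<otimes> inv g) \<otimes> (g \<otimes> y \<otimes> inv g)"
    by (simp add: m_assoc) (simp add: m_assoc[symmetric])
qed auto

lemma frattini_normal: "frattini G \<lhd> G"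
proof (rule normal_invI[OF frattini_subgroup])
  fix g x assume g: "g \<in> carrier G" and x: "x \<in> frattini G"
  show "g \<otimes> x \<otimes> inv g \<in> frattini G"
  proof (rule frattini_automorphism[OF conj_hom[OF g] conj_hom[OF inv_closed[OF g]] _ _ x])
    fix y assume y: "y \<in> carrier G"
    show "g \<otimes> (inv g \<otimes> y \<otimes> inv (inv g)) \<otimes> inv g = y" using conj_inv(2)[OF g y] g by simp
    show "inv g \<otimes> (g \<otimes> y \<otimes> inv g) \<otimes> inv (inv g) = y" using conj_inv(1)[OF g y] .
  qed
qed

text \<open>The form in which the Frattini subgroup enters everywhere: a supplement of it is the whole group, since
a proper subgroup lies in a maximal one.\<close>

lemma frattini_nongenerator:
  assumes fin: "finite (carrier G)" and K: "subgroup K G" and F: "F \<subseteq> frattini G"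
    and gen: "\<And>g. g \<in> carrier G \<Longrightarrow> \<exists>x\<in>F. \<exists>k\<in>K. g = x \<otimes> k"
  shows "K = carrier G"
proof (rule ccontr)
  assume "K \<noteq> carrier G"
  then obtain M where M: "maximal_subgroup M G" "K \<subseteq> M" using exists_maximal_subgroup[OF fin K] by blast
  then have sM: "subgroup M G" by (simp add: maximal_subgroup_def)
  have "g \<in> M" if "g \<in> carrier G" for g
    using gen[OF that] M frattini_max F subgroup.m_closed[OF sM] by blast
  then have "M = carrier G" using subgroup.subset[OF sM] by blast
  then show False using M by (simp add: maximal_subgroup_def)
qed

lemma frattini_p_group:
  assumes p: "prime p" "Coset.order G = p ^ n"
  shows "x \<in> carrier G \<Longrightarrow> x [^] p \<in> frattini G"
    and "x \<in> carrier G \<Longrightarrow> y \<in> carrier G \<Longrightarrow> x \<otimes> y \<otimes> inv x \<otimes> inv y \<in> frattini G"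
  using maximal_subgroup_p_group[OF p] by (auto intro!: frattiniI)

text \<open>\<open>\<Phi>(P)\<close> is characteristic in \<open>P\<close>, hence normal in \<open>G\<close>. A maximal subgroup \<open>M\<close> of \<open>G\<close> that did not contain it would
supplement it, so by the modular law \<open>P \<inter> M\<close> would supplement \<open>\<Phi>(P)\<close> in \<open>P\<close>, and \<open>P \<le> M\<close>.\<close>

lemma frattini_normal_subset:
  assumes fin: "finite (carrier G)" and P: "P \<lhd> G"
  shows "frattini (G\<lparr>carrier := P\<rparr>) \<subseteq> frattini G"
    and "g \<in> carrier G \<Longrightarrow> x \<in> frattini (G\<lparr>carrier := P\<rparr>) \<Longrightarrow>
      g \<otimes> x \<otimes> inv g \<in> frattini (G\<lparr>carrier := P\<rparr>)"
proof -
  interpret P: normal P G by (rule P)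
  have sP: "subgroup P G" by (rule P.is_subgroup)
  let ?P = "G\<lparr>carrier := P\<rparr>"
  interpret PG: group ?P by (rule subgroup.subgroup_is_group[OF sP is_group])
  have finP: "finite P" using fin P.subset finite_subset by blast
  note Dsub = PG.frattini_sub[simplified]
  show conj: "g \<otimes> x \<otimes> inv g \<in> frattini ?P" if g: "g \<in> carrier G" and x: "x \<in> frattini ?P" for g x
  proof (rule PG.frattini_automorphism[OF _ _ _ _ x])
    have c: "(\<lambda>x. h \<otimes> x \<otimes> inv h) \<in> hom ?P ?P" if h: "h \<in> carrier G" for h
      using conj_hom[OF h] P.inv_op_closed2[OF h] P.mem_carrier by (auto simp: hom_def)
    show "(\<lambda>x. g \<otimes> x \<otimes> inv g) \<in> hom ?P ?P" using c[OF g] .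
    show "(\<lambda>x. inv g \<otimes> x \<otimes> inv (inv g)) \<in> hom ?P ?P" using c[of "inv g"] g by simp
    fix y assume "y \<in> carrier ?P"
    then have y: "y \<in> carrier G" using P.mem_carrier by simp
    show "g \<otimes> (inv g \<otimes> y \<otimes> inv (inv g)) \<otimes> inv g = y" using conj_inv(2)[OF g y] g by simp
    show "inv g \<otimes> (g \<otimes> y \<otimes> inv g) \<otimes> inv (inv g) = y" using conj_inv(1)[OF g y] .
  qed
  have Dn: "frattini ?P \<lhd> G"
  proof (rule normal_invI)
    show "subgroup (frattini ?P) G"
      using incl_subgroup[OF sP PG.frattini_subgroup] .
  qed (rule conj)
  show "frattini ?P \<subseteq> frattini G"
  proof
    fix x assume x: "x \<in> frattini ?P"
    show "x \<in> frattini G"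
    proof (rule frattiniI)
      show "x \<in> carrier G" using x Dsub P.mem_carrier by blast
      fix M assume M: "maximal_subgroup M G"
      then have sM: "subgroup M G" by (simp add: maximal_subgroup_def)
      show "x \<in> M"
      proof (rule ccontr)
        assume xM: "x \<notin> M"
        have sub: "subgroup (frattini ?P <#> M) G" using mult_norm_subgroup[OF Dn sM] .
        have "y \<in> frattini ?P <#> M" if "y \<in> M" for y
        proof -
          have "\<one> \<otimes> y \<in> frattini ?P <#> M"
            using that subgroup.one_closed[OF PG.frattini_subgroup] unfolding set_mult_def by auto
          then show ?thesis using that subgroup.mem_carrier[OF sM] by simp
        qed
        moreover have "x \<in> frattini ?P <#> M"
        proof -
          have "x \<otimes> \<one> \<in> frattini ?P <#> M"
            using x subgroup.one_closed[OF sM] unfolding set_mult_def by auto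
          then show ?thesis using x Dsub P.mem_carrier by simp
        qed
        ultimately have all: "frattini ?P <#> M = carrier G"
          using M sub xM by (metis maximal_subgroup_def subsetI)
        have PM: "subgroup (P \<inter> M) ?P"
          using subgroup_incl[OF subgroups_Inter_pair[OF sP sM] sP] by simp
        have "P \<inter> M = carrier ?P"
        proof (rule PG.frattini_nongenerator[OF _ PM order_refl])
          show "finite (carrier ?P)" using finP by simp
          fix g assume g: "g \<in> carrier ?P"
          then have "g \<in> frattini ?P <#> M" using all P.mem_carrier by simp
          then obtain d k where dk: "d \<in> frattini ?P" "k \<in> M" "g = d \<otimes> k" by (auto simp: set_mult_def)
          have c: "d \<in> carrier G" "k \<in> carrier G" "d \<in> P"
            using dk Dsub P.mem_carrier subgroup.mem_carrier[OF sM] by blast+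
          have "k = inv d \<otimes> g" using dk c by (simp add: m_assoc[symmetric])
          then have "k \<in> P" using c g by simp
          then show "\<exists>d\<in>frattini ?P. \<exists>k\<in>P \<inter> M. g = d \<otimes>\<^bsub>?P\<^esub> k" using dk by auto
        qed
        then show False using x Dsub xM by auto
      qed
    qed
  qed
qed

end

section \<open>Split extensions of p-groups\<close>

text \<open>Products in a quotient group are kept as such instead of being unfolded to products of cosets as sets, so that the group
laws of the quotient apply to them.\<close>

declare mult_FactGroup [simp del] one_FactGroup [simp del]

lemma (in group) conj_coprime_action:
  assumes N: "N \<lhd> G" "finite N" and comm: "\<And>x y. x \<in> N \<Longrightarrow> y \<in> N \<Longrightarrow> x \<otimes> y = y \<otimes> x"
    and exp: "\<And>x. x \<in> N \<Longrightarrow> x [^] p = \<one>" and p: "prime p"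
    and \<kappa>: "group_hom H G \<kappa>" and H: "finite (carrier H)" "coprime (Coset.order H) p"
  shows "coprime_action (G\<lparr>carrier := N\<rparr>) p H (conj_action G \<kappa>)"
proof -
  interpret N: normal N G by (rule N)
  interpret \<kappa>: group_hom H G \<kappa> by (rule \<kappa>)
  interpret NG: group "G\<lparr>carrier := N\<rparr>" by (rule subgroup.subgroup_is_group[OF N.is_subgroup is_group])
  note m = N.mem_carrier
  have "comm_group (G\<lparr>carrier := N\<rparr>)"
    by (rule NG.group_comm_groupI) (use comm in auto)
  moreover have "conj_action G \<kappa> h x \<in> N" if "h \<in> carrier H" "x \<in> N" for h x
    using that N.inv_op_closed2 by (simp add: conj_action_def)
  moreover have "conj_action G \<kappa> h (x \<otimes> y) = conj_action G \<kappa> h x \<otimes> conj_action G \<kappa> h y"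
    if "h \<in> carrier H" "x \<in> N" "y \<in> N" for h x y
    using that m by (simp add: conj_action_def m_assoc) (simp add: m_assoc[symmetric])
  moreover have "conj_action G \<kappa> (h \<otimes>\<^bsub>H\<^esub> k) x = conj_action G \<kappa> h (conj_action G \<kappa> k x)"
    if "h \<in> carrier H" "k \<in> carrier H" "x \<in> N" for h k x
    using that m by (simp add: conj_action_def m_assoc inv_mult_group)
  moreover have "conj_action G \<kappa> \<one>\<^bsub>H\<^esub> x = x" if "x \<in> N" for x
    using that m by (simp add: conj_action_def)
  moreover have "x [^]\<^bsub>G\<lparr>carrier := N\<rparr>\<^esub> p = \<one>" if "x \<in> N" for x
    using exp[OF that] by (simp add: nat_pow_consistent[symmetric])
  ultimately show ?thesis
    unfolding coprime_action_def coprime_action_axioms_def elementary_abelian_def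
      elementary_abelian_axioms_def
    using p N(2) H \<kappa>.G.is_group by simp
qed

text \<open>The semidirect product seen from inside: \<open>H\<close> is embedded by \<open>\<iota>\<close> and acts by conjugation.\<close>

locale split_extension = group G for G (structure) +
  fixes H :: "('h, 'n) monoid_scheme" and \<iota> :: "'h \<Rightarrow> 'a" and P :: "'a set" and p n :: nat
  assumes prime_p: "prime p"
    and finite_G: "finite (carrier G)"
    and normal_P: "P \<lhd> G"
    and card_P: "card P = p ^ n"
    and hom_\<iota>: "group_hom H G \<iota>"
    and finite_H: "finite (carrier H)"
    and coprime_H: "coprime (Coset.order H) p"
    and split: "g \<in> carrier G \<Longrightarrow> \<exists>x\<in>P. \<exists>h\<in>carrier H. g = x \<otimes> \<iota> h"
    and faithful: "h \<in> carrier H \<Longrightarrow> (\<And>x. x \<in> P \<Longrightarrow> \<iota> h \<otimes> x \<otimes> inv (\<iota> h) = x) \<Longrightarrow> h = \<one>\<^bsub>H\<^esub>"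
begin

sublocale P: normal P G by (rule normal_P)
sublocale \<iota>: group_hom H G \<iota> by (rule hom_\<iota>)
sublocale PG: group "G\<lparr>carrier := P\<rparr>"
  by (rule subgroup.subgroup_is_group[OF P.is_subgroup is_group])

lemma finite_P: "finite P"
  using finite_G P.subset finite_subset by blast

lemma order_P: "Coset.order (G\<lparr>carrier := P\<rparr>) = p ^ n"
  by (simp add: Coset.order_def card_P)

lemma P_mem: "x \<in> P \<Longrightarrow> x \<in> carrier G"
  by (rule P.mem_carrier)

lemma \<iota>_in_P:
  assumes "h \<in> carrier H" "\<iota> h \<in> P"
  shows "\<iota> h = \<one>"
proof -
  have "\<iota> h [^] (p ^ n) = \<one>"
    using PG.pow_order_eq_1[of "\<iota> h"] assms order_P by (simp add: nat_pow_consistent[symmetric])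
  then have a: "ord (\<iota> h) dvd p ^ n" using assms pow_eq_id by simp
  have "h [^]\<^bsub>H\<^esub> Coset.order H = \<one>\<^bsub>H\<^esub>" using \<iota>.G.pow_order_eq_1[OF assms(1)] .
  then have "\<iota> h [^] Coset.order H = \<one>" using assms(1) by (metis \<iota>.hom_nat_pow \<iota>.hom_one)
  then have b: "ord (\<iota> h) dvd Coset.order H" using assms pow_eq_id by simp
  have "coprime (Coset.order H) (p ^ n)" using coprime_H by simp
  then have "ord (\<iota> h) dvd 1" using a b by (meson coprime_common_divisor)
  then show ?thesis using assms(1) ord_eq_1 by simp
qed

text \<open>The conditions on \<open>F\<close> make \<open>P F / F\<close> an elementary abelian group. Both \<open>\<Phi>(P)\<close> and \<open>\<Phi>(G)\<close> satisfy them.\<close>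

definition elementary_quotient :: "'a set \<Rightarrow> bool" where
  "elementary_quotient F \<longleftrightarrow> F \<lhd> G \<and> (\<forall>x\<in>P. x [^] p \<in> F) \<and>
    (\<forall>x\<in>P. \<forall>y\<in>P. x \<otimes> y \<otimes> inv x \<otimes> inv y \<in> F)"

definition quotient_image :: "'a set \<Rightarrow> 'a set set" where
  "quotient_image F = (\<lambda>x. F #> x) ` P"

lemma proj_hom:
  assumes "F \<lhd> G"
  shows "group_hom G (G Mod F) (\<lambda>x. F #> x)"
proof -
  interpret F: normal F G by (rule assms)
  interpret Q: group "G Mod F" by (rule F.factorgroup_is_group)
  show ?thesis by unfold_locales (rule F.r_coset_hom_Mod)
qed

lemma image_normal:
  assumes F: "F \<lhd> G"
  shows "quotient_image F \<lhd> (G Mod F)"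
proof -
  interpret \<pi>: group_hom G "G Mod F" "\<lambda>x. F #> x" by (rule proj_hom[OF F])
  show ?thesis
  proof (rule \<pi>.H.normal_invI)
    show "subgroup (quotient_image F) (G Mod F)"
      unfolding quotient_image_def by (rule \<pi>.subgroup_img_is_subgroup[OF P.is_subgroup])
    fix X Y assume "X \<in> carrier (G Mod F)" "Y \<in> quotient_image F"
    then obtain g x where g: "g \<in> carrier G" "X = F #> g" and x: "x \<in> P" "Y = F #> x"
      by (auto simp: carrier_FactGroup quotient_image_def)
    then have eq: "X \<otimes>\<^bsub>G Mod F\<^esub> Y \<otimes>\<^bsub>G Mod F\<^esub> inv\<^bsub>G Mod F\<^esub> X = F #> (g \<otimes> x \<otimes> inv g)"
      using P_mem by simp
    show "X \<otimes>\<^bsub>G Mod F\<^esub> Y \<otimes>\<^bsub>G Mod F\<^esub> inv\<^bsub>G Mod F\<^esub> X \<in> quotient_image F"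
      unfolding eq quotient_image_def using P.inv_op_closed2[OF g(1) x(1)] by (rule imageI)
  qed
qed

lemma quotient_action:
  assumes "elementary_quotient F"
  shows "coprime_action ((G Mod F)\<lparr>carrier := quotient_image F\<rparr>) p H
    (conj_action (G Mod F) (\<lambda>h. F #> \<iota> h))"
proof -
  have F: "F \<lhd> G" and exp: "\<And>x. x \<in> P \<Longrightarrow> x [^] p \<in> F"
    and comm: "\<And>x y. x \<in> P \<Longrightarrow> y \<in> P \<Longrightarrow> x \<otimes> y \<otimes> inv x \<otimes> inv y \<in> F"
    using assms by (auto simp: elementary_quotient_def)
  interpret F: normal F G by (rule F)
  interpret \<pi>: group_hom G "G Mod F" "\<lambda>x. F #> x" by (rule proj_hom[OF F])
  have one: "F #> x = \<one>\<^bsub>G Mod F\<^esub>" if "x \<in> F" for x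
    using that coset_join2[OF F.mem_carrier F.is_subgroup] by (simp add: one_FactGroup)
  show ?thesis
  proof (rule \<pi>.H.conj_coprime_action[OF image_normal[OF F]])
    show "finite (quotient_image F)" using finite_P by (simp add: quotient_image_def)
    show "X \<otimes>\<^bsub>G Mod F\<^esub> Y = Y \<otimes>\<^bsub>G Mod F\<^esub> X" if XY: "X \<in> quotient_image F" "Y \<in> quotient_image F" for X Y
    proof -
      obtain x y where xy: "x \<in> P" "y \<in> P" "X = F #> x" "Y = F #> y" using XY by (auto simp: quotient_image_def)
      have c: "x \<in> carrier G" "y \<in> carrier G" using xy P_mem by auto
      have "(x \<otimes> y) \<otimes> inv (y \<otimes> x) = x \<otimes> y \<otimes> inv x \<otimes> inv y"
        using c by (simp add: inv_mult_group m_assoc)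
      then have "F #> (x \<otimes> y) = F #> (y \<otimes> x)"
        using F.rcoset_eq_iff[of "x \<otimes> y" "y \<otimes> x"] c comm[OF xy(1,2)] by simp
      then show ?thesis using xy c by simp
    qed
    show "X [^]\<^bsub>G Mod F\<^esub> p = \<one>\<^bsub>G Mod F\<^esub>" if X: "X \<in> quotient_image F" for X
    proof -
      obtain x where x: "x \<in> P" "X = F #> x" using X by (auto simp: quotient_image_def)
      then have "X [^]\<^bsub>G Mod F\<^esub> p = F #> (x [^] p)" using P_mem by (simp add: \<pi>.hom_nat_pow)
      then show ?thesis using one exp[OF x(1)] by simp
    qed
    show "group_hom H (G Mod F) (\<lambda>h. F #> \<iota> h)"
    proof (unfold_locales, rule homI)
      show "F #> \<iota> (h \<otimes>\<^bsub>H\<^esub> k) = (F #> \<iota> h) \<otimes>\<^bsub>G Mod F\<^esub> (F #> \<iota> k)"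
        if "h \<in> carrier H" "k \<in> carrier H" for h k using that by simp
    qed (rule \<pi>.hom_closed[OF \<iota>.hom_closed])
  qed (use prime_p finite_H coprime_H in auto)
qed

text \<open>As \<open>G = P H\<close> and the image of \<open>P\<close> is abelian, normality of a subgroup of this image is tested by \<open>H\<close> alone.\<close>

lemma invariant_imp_normal:
  assumes F: "elementary_quotient F"
    and W: "coprime_action.invariant ((G Mod F)\<lparr>carrier := quotient_image F\<rparr>) H
      (conj_action (G Mod F) (\<lambda>h. F #> \<iota> h)) W"
  shows "W \<lhd> (G Mod F)" "W \<subseteq> quotient_image F"
proof -
  have Fn: "F \<lhd> G" using F by (simp add: elementary_quotient_def)
  interpret \<pi>: group_hom G "G Mod F" "\<lambda>x. F #> x" by (rule proj_hom[OF Fn])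
  interpret A: coprime_action "(G Mod F)\<lparr>carrier := quotient_image F\<rparr>" p H "conj_action (G Mod F) (\<lambda>h. F #> \<iota> h)"
    by (rule quotient_action[OF F])
  interpret I: normal "quotient_image F" "G Mod F" by (rule image_normal[OF Fn])
  have sW: "subgroup W ((G Mod F)\<lparr>carrier := quotient_image F\<rparr>)" using W A.invariant_sub by blast
  show WI: "W \<subseteq> quotient_image F" using subgroup.subset[OF sW] by simp
  have Wc: "X \<in> carrier (G Mod F)" if "X \<in> W" for X using that WI I.mem_carrier by blast
  show "W \<lhd> (G Mod F)"
  proof (rule \<pi>.H.normal_invI)
    show sWQ: "subgroup W (G Mod F)" using \<pi>.H.incl_subgroup[OF I.is_subgroup sW] .
    fix X Y assume X: "X \<in> carrier (G Mod F)" and Y: "Y \<in> W"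
    obtain g where g: "g \<in> carrier G" "X = F #> g" using X by (auto simp: carrier_FactGroup)
    obtain x h where xh: "x \<in> P" "h \<in> carrier H" "g = x \<otimes> \<iota> h" using split[OF g(1)] by blast
    let ?x = "F #> x" and ?h = "F #> \<iota> h"
    have c: "?x \<in> carrier (G Mod F)" "?h \<in> carrier (G Mod F)" "Y \<in> carrier (G Mod F)"
      using xh P_mem \<iota>.hom_closed \<pi>.hom_closed Wc[OF Y] by blast+
    have Xe: "X = ?x \<otimes>\<^bsub>G Mod F\<^esub> ?h"
      using g xh P_mem by simp
    define Z where "Z = ?h \<otimes>\<^bsub>G Mod F\<^esub> Y \<otimes>\<^bsub>G Mod F\<^esub> inv\<^bsub>G Mod F\<^esub> ?h"
    have ZW: "Z \<in> W" using A.invariant_act[OF W xh(2) Y] by (simp add: Z_def conj_action_def)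
    then have Zc: "Z \<in> carrier (G Mod F)" using Wc by blast
    have "X \<otimes>\<^bsub>G Mod F\<^esub> Y \<otimes>\<^bsub>G Mod F\<^esub> inv\<^bsub>G Mod F\<^esub> X = ?x \<otimes>\<^bsub>G Mod F\<^esub> Z \<otimes>\<^bsub>G Mod F\<^esub> inv\<^bsub>G Mod F\<^esub> ?x"
      unfolding Xe Z_def using c by (simp add: \<pi>.H.inv_mult_group \<pi>.H.m_assoc)
    also have "?x \<otimes>\<^bsub>G Mod F\<^esub> Z = Z \<otimes>\<^bsub>G Mod F\<^esub> ?x"
      using A.m_comm[of ?x Z] ZW WI xh(1) by (simp add: quotient_image_def subset_iff)
    also have "Z \<otimes>\<^bsub>G Mod F\<^esub> ?x \<otimes>\<^bsub>G Mod F\<^esub> inv\<^bsub>G Mod F\<^esub> ?x = Z"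
      using c(1) Zc by (simp add: \<pi>.H.m_assoc)
    finally show "X \<otimes>\<^bsub>G Mod F\<^esub> Y \<otimes>\<^bsub>G Mod F\<^esub> inv\<^bsub>G Mod F\<^esub> X \<in> W" using ZW by simp
  qed
qed

lemma normal_imp_invariant:
  assumes F: "elementary_quotient F" and W: "W \<lhd> (G Mod F)" "W \<subseteq> quotient_image F"
  shows "coprime_action.invariant ((G Mod F)\<lparr>carrier := quotient_image F\<rparr>) H
      (conj_action (G Mod F) (\<lambda>h. F #> \<iota> h)) W"
proof -
  have Fn: "F \<lhd> G" using F by (simp add: elementary_quotient_def)
  interpret \<pi>: group_hom G "G Mod F" "\<lambda>x. F #> x" by (rule proj_hom[OF Fn])
  interpret A: coprime_action "(G Mod F)\<lparr>carrier := quotient_image F\<rparr>" p H "conj_action (G Mod F) (\<lambda>h. F #> \<iota> h)"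
    by (rule quotient_action[OF F])
  interpret I: normal "quotient_image F" "G Mod F" by (rule image_normal[OF Fn])
  interpret W: normal W "G Mod F" by (rule W(1))
  have "subgroup W ((G Mod F)\<lparr>carrier := quotient_image F\<rparr>)"
    using \<pi>.H.subgroup_incl[OF W.is_subgroup I.is_subgroup W(2)] .
  then show ?thesis
    using W.inv_op_closed2 by (auto simp: A.invariant_def conj_action_def)
qed

lemma frattini_P_elementary: "elementary_quotient (frattini (G\<lparr>carrier := P\<rparr>))"
proof -
  let ?D = "frattini (G\<lparr>carrier := P\<rparr>)"
  have "?D \<lhd> G"
  proof (rule normal_invI)
    show "subgroup ?D G" using incl_subgroup[OF P.is_subgroup PG.frattini_subgroup] .
  qed (rule frattini_normal_subset(2)[OF finite_G normal_P])
  moreover have "x [^] p \<in> ?D" if "x \<in> P" for x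
    using PG.frattini_p_group(1)[OF prime_p order_P, of x] that
    by (simp add: nat_pow_consistent[symmetric])
  moreover have "x \<otimes> y \<otimes> inv x \<otimes> inv y \<in> ?D" if "x \<in> P" "y \<in> P" for x y
    using PG.frattini_p_group(2)[OF prime_p order_P, of x y] that
    by (simp add: m_inv_consistent[OF P.is_subgroup])
  ultimately show ?thesis by (simp add: elementary_quotient_def)
qed

lemma frattini_elementary: "elementary_quotient (frattini G)"
  using frattini_P_elementary frattini_normal frattini_normal_subset(1)[OF finite_G normal_P]
  by (auto simp: elementary_quotient_def)

text \<open>By Maschke's theorem the image \<open>B\<close> of \<open>\<Phi>(G) \<inter> P\<close> in \<open>P/\<Phi>(P)\<close> has an invariant complement; let \<open>L\<close> be its
preimage in \<open>P\<close>. Then \<open>L H\<close> is a subgroup that supplements \<open>\<Phi>(G)\<close>, so \<open>L H = G\<close>, hence \<open>L = P\<close> and \<open>B\<close> is trivial.\<close>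

lemma frattini_Int_P: "frattini G \<inter> P \<subseteq> frattini (G\<lparr>carrier := P\<rparr>)"
proof -
  let ?D = "frattini (G\<lparr>carrier := P\<rparr>)"
  note el = frattini_P_elementary
  have Dn: "?D \<lhd> G" using el by (simp add: elementary_quotient_def)
  interpret D: normal ?D G by (rule Dn)
  interpret \<pi>: group_hom G "G Mod ?D" "\<lambda>x. ?D #> x" by (rule proj_hom[OF Dn])
  interpret A: coprime_action "(G Mod ?D)\<lparr>carrier := quotient_image ?D\<rparr>" p H "conj_action (G Mod ?D) (\<lambda>h. ?D #> \<iota> h)"
    by (rule quotient_action[OF el])
  interpret \<Phi>: normal "frattini G" G by (rule frattini_normal)
  let ?N = "frattini G \<inter> P"
  have DP: "?D \<subseteq> P" using PG.frattini_sub by auto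
  have DN: "?D \<subseteq> ?N" using DP frattini_normal_subset(1)[OF finite_G normal_P] by blast
  have sN: "subgroup ?N G" using subgroups_Inter_pair[OF \<Phi>.is_subgroup P.is_subgroup] .
  define B where "B = (\<lambda>x. ?D #> x) ` ?N"
  have "B \<lhd> (G Mod ?D)"
  proof (rule \<pi>.H.normal_invI)
    show "subgroup B (G Mod ?D)" unfolding B_def by (rule \<pi>.subgroup_img_is_subgroup[OF sN])
    fix X Y assume "X \<in> carrier (G Mod ?D)" "Y \<in> B"
    then obtain g x where g: "g \<in> carrier G" "X = ?D #> g" and x: "x \<in> ?N" "Y = ?D #> x"
      by (auto simp: carrier_FactGroup B_def)
    then have eq: "X \<otimes>\<^bsub>G Mod ?D\<^esub> Y \<otimes>\<^bsub>G Mod ?D\<^esub> inv\<^bsub>G Mod ?D\<^esub> X = ?D #> (g \<otimes> x \<otimes> inv g)"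
      using P_mem by simp
    have "g \<otimes> x \<otimes> inv g \<in> ?N"
      using P.inv_op_closed2[OF g(1)] \<Phi>.inv_op_closed2[OF g(1)] x(1) by blast
    then show "X \<otimes>\<^bsub>G Mod ?D\<^esub> Y \<otimes>\<^bsub>G Mod ?D\<^esub> inv\<^bsub>G Mod ?D\<^esub> X \<in> B"
      unfolding eq B_def by (rule imageI)
  qed
  then have iB: "A.invariant B" using normal_imp_invariant[OF el] by (auto simp: B_def quotient_image_def)
  obtain C where C: "A.invariant C" "B \<inter> C = {\<one>\<^bsub>G Mod ?D\<^esub>}"
    "B <#>\<^bsub>G Mod ?D\<^esub> C = quotient_image ?D"
    using A.maschke[OF iB] by (auto simp: set_mult_def)
  interpret C: normal C "G Mod ?D" using invariant_imp_normal(1)[OF el C(1)] .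
  define L where "L = {x \<in> P. ?D #> x \<in> C}"
  define K where "K = {x \<otimes> \<iota> h |x h. x \<in> L \<and> h \<in> carrier H}"
  have Lc: "x \<in> P" "x \<in> carrier G" "?D #> x \<in> C" if "x \<in> L" for x using that P_mem by (auto simp: L_def)
  have L_mult: "x \<otimes> y \<in> L" if "x \<in> L" "y \<in> L" for x y
    using Lc[OF that(1)] Lc[OF that(2)] C.m_closed by (simp add: L_def \<pi>.hom_mult)
  have L_inv: "inv x \<in> L" if "x \<in> L" for x
    using Lc[OF that] C.m_inv_closed by (simp add: L_def \<pi>.hom_inv)
  have L_conj: "g \<otimes> x \<otimes> inv g \<in> L" if "g \<in> carrier G" "x \<in> L" for g x
    using Lc[OF that(2)] that(1) P.inv_op_closed2 C.inv_op_closed2[of "?D #> g" "?D #> x"]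
    by (simp add: L_def \<pi>.hom_mult \<pi>.hom_inv)
  have one_L: "\<one> \<in> L" using \<pi>.hom_one C.one_closed by (simp add: L_def)
  have "subgroup K G"
  proof (rule subgroupI)
    show "K \<subseteq> carrier G" using Lc by (auto simp: K_def)
    show "K \<noteq> {}" using one_L \<iota>.G.one_closed by (auto simp: K_def)
    show "inv k \<in> K" if k: "k \<in> K" for k
    proof -
      obtain x h where x: "x \<in> L" "h \<in> carrier H" "k = x \<otimes> \<iota> h" using k by (auto simp: K_def)
      have c: "x \<in> carrier G" "\<iota> h \<in> carrier G" using x Lc by auto
      have "inv k = (inv (\<iota> h) \<otimes> inv x \<otimes> inv (inv (\<iota> h))) \<otimes> \<iota> (inv\<^bsub>H\<^esub> h)"
        using x c by (simp add: inv_mult_group m_assoc)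
      moreover have "inv (\<iota> h) \<otimes> inv x \<otimes> inv (inv (\<iota> h)) \<in> L"
        using c x by (intro L_conj L_inv) auto
      ultimately show ?thesis using x(2) unfolding K_def by blast
    qed
    show "k \<otimes> l \<in> K" if kl: "k \<in> K" "l \<in> K" for k l
    proof -
      obtain x h where x: "x \<in> L" "h \<in> carrier H" "k = x \<otimes> \<iota> h" using kl by (auto simp: K_def)
      obtain y j where y: "y \<in> L" "j \<in> carrier H" "l = y \<otimes> \<iota> j" using kl by (auto simp: K_def)
      have c: "x \<in> carrier G" "y \<in> carrier G" "\<iota> h \<in> carrier G" "\<iota> j \<in> carrier G" using x y Lc by auto
      have "k \<otimes> l = (x \<otimes> (\<iota> h \<otimes> y \<otimes> inv (\<iota> h))) \<otimes> \<iota> (h \<otimes>\<^bsub>H\<^esub> j)"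
        using x y c by (simp add: m_assoc) (simp add: m_assoc[symmetric])
      moreover have "x \<otimes> (\<iota> h \<otimes> y \<otimes> inv (\<iota> h)) \<in> L" using c x y by (intro L_mult L_conj) auto
      moreover have "h \<otimes>\<^bsub>H\<^esub> j \<in> carrier H" using x y by simp
      ultimately show ?thesis unfolding K_def by blast
    qed
  qed
  then have KG: "K = carrier G"
  proof (rule frattini_nongenerator[OF finite_G])
    show "?N \<subseteq> frattini G" by simp
    fix g assume "g \<in> carrier G"
    then obtain x h where xh: "x \<in> P" "h \<in> carrier H" "g = x \<otimes> \<iota> h" using split by blast
    have "?D #> x \<in> B <#>\<^bsub>G Mod ?D\<^esub> C" using C(3) xh(1) by (auto simp: quotient_image_def)
    then obtain b Y where bY: "b \<in> ?N" "Y \<in> C" "?D #> x = (?D #> b) \<otimes>\<^bsub>G Mod ?D\<^esub> Y"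
      by (auto simp: set_mult_def B_def)
    obtain c where c: "c \<in> P" "Y = ?D #> c"
      using bY(2) invariant_imp_normal(2)[OF el C(1)] by (auto simp: quotient_image_def)
    have cc: "b \<in> carrier G" "c \<in> carrier G" "x \<in> carrier G" "\<iota> h \<in> carrier G"
      using bY(1) c xh P_mem by auto
    have "?D #> x = ?D #> (b \<otimes> c)" using bY(3) c cc by simp
    then have d: "x \<otimes> inv (b \<otimes> c) \<in> ?D" using D.rcoset_eq_iff[of x "b \<otimes> c"] cc by simp
    have "g = (x \<otimes> inv (b \<otimes> c) \<otimes> b) \<otimes> (c \<otimes> \<iota> h)"
      using xh(3) cc by (simp add: m_assoc inv_mult_group) (simp add: m_assoc[symmetric])
    moreover have "x \<otimes> inv (b \<otimes> c) \<otimes> b \<in> ?N"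
      using subgroup.m_closed[OF sN subsetD[OF DN d] bY(1)] .
    moreover have "c \<otimes> \<iota> h \<in> K" using c bY(2) xh(2) by (auto simp: K_def L_def)
    ultimately show "\<exists>y\<in>?N. \<exists>k\<in>K. g = y \<otimes> k" by blast
  qed
  have PL: "x \<in> L" if x: "x \<in> P" for x
  proof -
    have "x \<in> K" using KG x P_mem by blast
    then obtain y h where y: "y \<in> L" "h \<in> carrier H" "x = y \<otimes> \<iota> h" by (auto simp: K_def)
    have "\<iota> h = inv y \<otimes> x" using y Lc[OF y(1)] by (simp add: m_assoc[symmetric])
    then have "\<iota> h \<in> P" using x Lc[OF y(1)] by simp
    then have "x = y" using \<iota>_in_P[OF y(2)] y Lc[OF y(1)] by simp
    then show ?thesis using y by simp
  qed
  show ?thesis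
  proof
    fix x assume x: "x \<in> ?N"
    then have "?D #> x \<in> B" "?D #> x \<in> C" using PL by (auto simp: B_def L_def)
    then have "?D #> x = ?D" using C(2) by (auto simp: one_FactGroup)
    then show "x \<in> ?D" using rcos_self[of x ?D] x P_mem D.is_subgroup by auto
  qed
qed

lemma P_nongenerator:
  assumes K: "subgroup K (G\<lparr>carrier := P\<rparr>)"
    and gen: "\<And>x. x \<in> P \<Longrightarrow> \<exists>y\<in>frattini G \<inter> P. \<exists>k\<in>K. x = y \<otimes> k"
  shows "K = P"
proof -
  have "K = carrier (G\<lparr>carrier := P\<rparr>)"
    by (rule PG.frattini_nongenerator[OF _ K frattini_Int_P]) (use finite_P gen in auto)
  then show ?thesis by simp
qed

end

section \<open>Supersolvability\<close>

text \<open>The series of \<open>supersolvable\<close>, but ending at \<open>L\<close>, so that it can be built step by step.\<close>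

definition cyclic_series :: "('a, 'm) monoid_scheme \<Rightarrow> 'a set \<Rightarrow> bool" where
  "cyclic_series G L \<longleftrightarrow> (\<exists>(k::nat) N. N 0 = {\<one>\<^bsub>G\<^esub>} \<and> N k = L \<and>
     (\<forall>i\<le>k. N i \<lhd> G) \<and>
     (\<forall>i<k. N i \<subseteq> N (Suc i) \<and> cyclic_group (G\<lparr>carrier := N (Suc i)\<rparr> Mod N i)))"

lemma supersolvable_iff: "supersolvable G \<longleftrightarrow> cyclic_series G (carrier G)"
  by (simp add: supersolvable_def cyclic_series_def)

context group
begin

lemma cyclic_series_triv: "cyclic_series G {\<one>}"
  unfolding cyclic_series_def using one_is_normal by (intro exI[of _ 0] exI[of _ "\<lambda>_. {\<one>}"]) auto

lemma cyclic_series_normal: "cyclic_series G L \<Longrightarrow> L \<lhd> G"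
  unfolding cyclic_series_def by auto

lemma cyclic_series_extend:
  assumes L: "cyclic_series G L" and x: "x \<in> carrier G" and L': "L <#> generate G {x} \<lhd> G"
  shows "cyclic_series G (L <#> generate G {x})"
proof -
  let ?L = "L <#> generate G {x}"
  interpret L: normal L G using L by (rule cyclic_series_normal)
  interpret L': normal ?L G by (rule L')
  have gx: "subgroup (generate G {x}) G" using x by (intro generate_is_subgroup) auto
  have sub: "L \<subseteq> ?L"
  proof
    fix a assume a: "a \<in> L"
    have "a \<otimes> \<one> \<in> ?L" using a subgroup.one_closed[OF gx] unfolding set_mult_def by blast
    then show "a \<in> ?L" using a by simp
  qed
  have "\<one> \<otimes> x \<in> ?L"
    using L.one_closed generate.incl[of x "{x}" G] unfolding set_mult_def by blast
  then have xL: "x \<in> ?L" using x by simp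
  let ?S = "G\<lparr>carrier := ?L\<rparr>"
  interpret S: group ?S by (rule subgroup.subgroup_is_group[OF L'.is_subgroup is_group])
  have nS: "L \<lhd> ?S"
    using L.inv_op_closed2 L'.mem_carrier subgroup_incl[OF L.is_subgroup L'.is_subgroup sub]
    by (intro S.normal_invI) (auto simp: m_inv_consistent[OF L'.is_subgroup])
  interpret N: normal L ?S by (rule nS)
  interpret Q: group "?S Mod L" by (rule N.factorgroup_is_group)
  interpret \<pi>: group_hom ?S "?S Mod L" "\<lambda>y. L #>\<^bsub>?S\<^esub> y"
    by unfold_locales (rule N.r_coset_hom_Mod)
  let ?X = "L #>\<^bsub>?S\<^esub> x"
  have X: "?X \<in> carrier (?S Mod L)" using xL \<pi>.hom_closed by simp
  have "Y \<in> range (\<lambda>i::int. ?X [^]\<^bsub>?S Mod L\<^esub> i)" if Y: "Y \<in> carrier (?S Mod L)" for Y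
  proof -
    obtain y where y: "y \<in> ?L" "Y = L #>\<^bsub>?S\<^esub> y" using Y by (auto simp: carrier_FactGroup)
    obtain a z where az: "a \<in> L" "z \<in> generate G {x}" "y = a \<otimes> z" using y(1) by (auto simp: set_mult_def)
    obtain i :: int where i: "z = x [^] i" using az(2) generate_pow[OF x] by auto
    have zS: "x [^]\<^bsub>?S\<^esub> i = x [^] i" using int_pow_consistent[OF L'.is_subgroup xL] by simp
    have zL: "z \<in> ?L" using S.int_pow_closed[of x i] xL zS i by simp
    have "Y = (L #>\<^bsub>?S\<^esub> a) \<otimes>\<^bsub>?S Mod L\<^esub> (L #>\<^bsub>?S\<^esub> z)"
      using y(2) az(1,3) zL sub \<pi>.hom_mult[of a z] by auto
    also have "L #>\<^bsub>?S\<^esub> a = \<one>\<^bsub>?S Mod L\<^esub>"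
      using az(1) sub S.coset_join2[of a L] N.is_subgroup by (auto simp: one_FactGroup)
    also have "L #>\<^bsub>?S\<^esub> z = ?X [^]\<^bsub>?S Mod L\<^esub> i"
      using \<pi>.hom_int_pow[of x i] xL zS i by simp
    finally have "Y = ?X [^]\<^bsub>?S Mod L\<^esub> i" using X by simp
    then show ?thesis by blast
  qed
  moreover have "range (\<lambda>i::int. ?X [^]\<^bsub>?S Mod L\<^esub> i) \<subseteq> carrier (?S Mod L)" using X by auto
  ultimately have cyc: "cyclic_group (?S Mod L)" using Q.cyclic_group X by blast
  obtain k N where N: "N 0 = {\<one>}" "N k = L" "\<forall>i\<le>k. N i \<lhd> G"
    "\<forall>i<k. N i \<subseteq> N (Suc i) \<and> cyclic_group (G\<lparr>carrier := N (Suc i)\<rparr> Mod N i)"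
    using L unfolding cyclic_series_def by blast
  define N' where "N' = N(Suc k := ?L)"
  have "N' 0 = {\<one>}" "N' (Suc k) = ?L" using N(1) by (auto simp: N'_def)
  moreover have "N' i \<lhd> G" if "i \<le> Suc k" for i
    using that N(3) L' by (cases "i = Suc k") (auto simp: N'_def)
  moreover have "N' i \<subseteq> N' (Suc i) \<and> cyclic_group (G\<lparr>carrier := N' (Suc i)\<rparr> Mod N' i)"
    if "i < Suc k" for i
    using that N(2,4) sub cyc by (cases "i = k") (auto simp: N'_def)
  ultimately show ?thesis unfolding cyclic_series_def by blast
qed

text \<open>Above \<open>L\<close> every subgroup is normal, so the series can be continued by one arbitrary element at a time.\<close>

lemma supersolvable_if_abelian_above:
  assumes fin: "finite (carrier G)" and L: "cyclic_series G L"
    and comm: "\<And>x y. x \<in> carrier G \<Longrightarrow> y \<in> carrier G \<Longrightarrow> x \<otimes> y \<otimes> inv x \<otimes> inv y \<in> L"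
  shows "supersolvable G"
proof -
  define Q where "Q = (\<lambda>M. cyclic_series G M \<and> L \<subseteq> M)"
  have "Q L" using L by (simp add: Q_def)
  moreover have "\<forall>M. Q M \<longrightarrow> card M < Suc (card (carrier G))"
    using card_mono[OF fin] cyclic_series_normal normal_imp_subgroup subgroup.subset
    unfolding Q_def less_Suc_eq_le by metis
  ultimately obtain M where M: "Q M" "\<And>M'. Q M' \<Longrightarrow> card M' \<le> card M"
    using ex_has_greatest_nat[of Q L card] by metis
  interpret M: normal M G using M(1) cyclic_series_normal by (auto simp: Q_def)
  have "M = carrier G"
  proof (rule ccontr)
    assume "M \<noteq> carrier G"
    then obtain x where x: "x \<in> carrier G" "x \<notin> M" using M.subset by blast
    let ?M = "M <#> generate G {x}"
    have gx: "subgroup (generate G {x}) G" using x by (intro generate_is_subgroup) auto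
    have sM: "subgroup ?M G" using mult_norm_subgroup[OF M.normal_axioms gx] .
    have sub: "M \<subseteq> ?M"
    proof
      fix a assume a: "a \<in> M"
      have "a \<otimes> \<one> \<in> ?M" using a subgroup.one_closed[OF gx] unfolding set_mult_def by blast
      then show "a \<in> ?M" using a by simp
    qed
    have "\<one> \<otimes> x \<in> ?M"
      using M.one_closed generate.incl[of x "{x}" G] unfolding set_mult_def by blast
    then have xM: "x \<in> ?M" using x by simp
    have "?M \<lhd> G"
    proof (rule normal_invI[OF sM])
      fix g y assume g: "g \<in> carrier G" and y: "y \<in> ?M"
      have yc: "y \<in> carrier G" using y subgroup.mem_carrier[OF sM] by blast
      have "g \<otimes> y \<otimes> inv g = (g \<otimes> y \<otimes> inv g \<otimes> inv y) \<otimes> y" using g yc by (simp add: m_assoc)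
      moreover have "g \<otimes> y \<otimes> inv g \<otimes> inv y \<in> ?M"
        using comm[OF g yc] M(1) sub by (auto simp: Q_def)
      ultimately show "g \<otimes> y \<otimes> inv g \<in> ?M" using subgroup.m_closed[OF sM] y by metis
    qed
    then have "Q ?M" using cyclic_series_extend x(1) M(1) sub by (auto simp: Q_def)
    then have "card ?M \<le> card M" by (rule M(2))
    moreover have "finite ?M" using fin sM subgroup.subset finite_subset by blast
    ultimately have "M = ?M" using sub card_seteq by blast
    then show False using x xM by simp
  qed
  then show ?thesis using M(1) by (simp add: Q_def supersolvable_iff)
qed

end

section \<open>The Frattini quotient of a split extension\<close>

context split_extension
begin

abbreviation "\<Phi> \<equiv> frattini G"
abbreviation "Gbar \<equiv> G Mod \<Phi>"
abbreviation "Pbar \<equiv> Gbar\<lparr>carrier := quotient_image \<Phi>\<rparr>"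
abbreviation "\<rho> \<equiv> conj_action Gbar (\<lambda>h. \<Phi> #> \<iota> h)"

sublocale \<Phi>: normal \<Phi> G by (rule frattini_normal)
sublocale \<pi>: group_hom G Gbar "\<lambda>x. \<Phi> #> x" by (rule proj_hom[OF frattini_normal])
sublocale A: coprime_action Pbar p H \<rho> by (rule quotient_action[OF frattini_elementary])

lemma subgroup_\<Phi>_P: "subgroup (\<Phi> \<inter> P) G"
  using subgroups_Inter_pair[OF \<Phi>.is_subgroup P.is_subgroup] .

lemma card_fibre:
  assumes "x \<in> P"
  shows "card {y \<in> P. \<Phi> #> y = \<Phi> #> x} = card (\<Phi> \<inter> P)"
proof -
  have xc: "x \<in> carrier G" using assms P_mem by blast
  have "{y \<in> P. \<Phi> #> y = \<Phi> #> x} = (\<lambda>z. z \<otimes> x) ` (\<Phi> \<inter> P)"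
  proof (intro equalityI subsetI)
    fix y assume "y \<in> {y \<in> P. \<Phi> #> y = \<Phi> #> x}"
    then have y: "y \<in> P" "\<Phi> #> y = \<Phi> #> x" by auto
    then have "y \<otimes> inv x \<in> \<Phi> \<inter> P" using \<Phi>.rcoset_eq_iff[of y x] xc P_mem assms by auto
    moreover have "y = (y \<otimes> inv x) \<otimes> x" using y P_mem xc by (simp add: m_assoc)
    ultimately show "y \<in> (\<lambda>z. z \<otimes> x) ` (\<Phi> \<inter> P)" by blast
  next
    fix y assume "y \<in> (\<lambda>z. z \<otimes> x) ` (\<Phi> \<inter> P)"
    then obtain z where z: "z \<in> \<Phi>" "z \<in> P" "y = z \<otimes> x" by auto
    then have "y \<otimes> inv x = z" using xc P_mem by (simp add: m_assoc)
    then show "y \<in> {y \<in> P. \<Phi> #> y = \<Phi> #> x}"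
      using z \<Phi>.rcoset_eq_iff[of y x] xc P_mem assms by auto
  qed
  moreover have "inj_on (\<lambda>z. z \<otimes> x) (\<Phi> \<inter> P)" using xc P_mem by (auto intro!: inj_onI)
  ultimately show ?thesis by (simp add: card_image)
qed

lemma card_preimage:
  assumes "Y \<subseteq> quotient_image \<Phi>"
  shows "card {x \<in> P. \<Phi> #> x \<in> Y} = card Y * card (\<Phi> \<inter> P)"
proof -
  have finY: "finite Y" using assms finite_P by (auto simp: quotient_image_def intro: finite_subset)
  have "{x \<in> P. \<Phi> #> x \<in> Y} = (\<Union>y\<in>Y. {x \<in> P. \<Phi> #> x = y})" by auto
  also have "card \<dots> = (\<Sum>y\<in>Y. card {x \<in> P. \<Phi> #> x = y})"
    using finY finite_P by (intro card_UN_disjoint) auto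
  also have "\<dots> = (\<Sum>y\<in>Y. card (\<Phi> \<inter> P))"
    using assms card_fibre by (intro sum.cong) (auto simp: quotient_image_def)
  finally show ?thesis by simp
qed

lemma act_image: "h \<in> carrier H \<Longrightarrow> x \<in> P \<Longrightarrow> \<rho> h (\<Phi> #> x) = \<Phi> #> (\<iota> h \<otimes> x \<otimes> inv (\<iota> h))"
  using P_mem by (simp add: conj_action_def)

text \<open>The group generated by \<open>h\<close> acts on each coset of \<open>\<Phi>(G) \<inter> P\<close> in \<open>P\<close>, and its order \<open>q\<close> does not divide the
\<open>p\<close>-power that is the size of the coset. A fixed point in each coset means that the centraliser \<open>C\<close> of \<open>h\<close>
supplements \<open>\<Phi>(G) \<inter> P\<close> in \<open>P\<close>.\<close>

lemma prime_order_faithful: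
  assumes q: "prime q" "\<iota>.G.ord h = q" and h: "h \<in> carrier H"
    and fixed: "\<And>X. X \<in> quotient_image \<Phi> \<Longrightarrow> \<rho> h X = X"
  shows False
proof -
  have "q dvd Coset.order H" using \<iota>.G.ord_dvd_group_order[OF h] q(2) by simp
  then have qp: "q \<noteq> p"
    using coprime_common_divisor[OF coprime_H, of p] prime_p by auto
  define C where "C = {x \<in> P. \<iota> h \<otimes> x \<otimes> inv (\<iota> h) = x}"
  let ?c = "\<lambda>k x. \<iota> k \<otimes> x \<otimes> inv (\<iota> k)"
  have conj: "?c (k \<otimes>\<^bsub>H\<^esub> l) x = ?c k (?c l x)" if "k \<in> carrier H" "l \<in> carrier H" "x \<in> P" for k l x
    using that P_mem by (simp add: m_assoc inv_mult_group)
  have cP: "?c k x \<in> P" if "k \<in> carrier H" "x \<in> P" for k x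
    using that P.inv_op_closed2 by simp
  have "subgroup C (G\<lparr>carrier := P\<rparr>)"
  proof (rule PG.subgroupI)
    have hc: "\<iota> h \<in> carrier G" using h by simp
    show "C \<noteq> {}" using hc by (auto simp: C_def intro!: exI[of _ \<one>])
    show "inv\<^bsub>G\<lparr>carrier := P\<rparr>\<^esub> x \<in> C" if x: "x \<in> C" for x
    proof -
      have xP: "x \<in> P" "x \<in> carrier G" using x P_mem by (auto simp: C_def)
      have "\<iota> h \<otimes> inv x \<otimes> inv (\<iota> h) = inv (\<iota> h \<otimes> x \<otimes> inv (\<iota> h))"
        using hc xP by (simp add: inv_mult_group m_assoc)
      then show ?thesis using x xP by (simp add: C_def m_inv_consistent[OF P.is_subgroup])
    qed
    show "x \<otimes>\<^bsub>G\<lparr>carrier := P\<rparr>\<^esub> y \<in> C" if xy: "x \<in> C" "y \<in> C" for x y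
    proof -
      have c: "x \<in> P" "x \<in> carrier G" "y \<in> P" "y \<in> carrier G" using xy P_mem by (auto simp: C_def)
      have "\<iota> h \<otimes> (x \<otimes> y) \<otimes> inv (\<iota> h) = (\<iota> h \<otimes> x \<otimes> inv (\<iota> h)) \<otimes> (\<iota> h \<otimes> y \<otimes> inv (\<iota> h))"
        using hc c by (simp add: m_assoc) (simp add: m_assoc[symmetric])
      then show ?thesis using xy c by (simp add: C_def)
    qed
  qed (auto simp: C_def)
  moreover have "\<exists>y\<in>\<Phi> \<inter> P. \<exists>k\<in>C. x = y \<otimes> k" if x: "x \<in> P" for x
  proof -
    let ?K = "generate H {h}"
    have sK: "subgroup ?K H" using h by (intro \<iota>.G.generate_is_subgroup) auto
    interpret K: group "H\<lparr>carrier := ?K\<rparr>" by (rule subgroup.subgroup_is_group[OF sK \<iota>.G.is_group])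
    have Kc: "k \<in> carrier H" if "k \<in> ?K" for k using that subgroup.mem_carrier[OF sK] by blast
    have fixK: "\<rho> k X = X" if k: "k \<in> ?K" and X: "X \<in> quotient_image \<Phi>" for k X
    proof -
      obtain i :: nat where i: "k = h [^]\<^bsub>H\<^esub> i"
        using k \<iota>.G.generate_pow_nat[OF h] \<iota>.G.ord_ge_1[OF finite_H h] by auto
      have "\<rho> (h [^]\<^bsub>H\<^esub> j) X = X" for j :: nat
        using X fixed by (induction j) (simp_all add: A.act_comp A.act_id h)
      then show ?thesis by (simp add: i)
    qed
    define E where "E = {y \<in> P. \<Phi> #> y = \<Phi> #> x}"
    have finE: "finite E" using finite_P by (simp add: E_def)
    have "q dvd card (E - {y \<in> E. \<forall>k\<in>carrier (H\<lparr>carrier := ?K\<rparr>). ?c k y = y})"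
    proof (rule K.prime_dvd_card_not_fixed[OF q(1) _ finE])
      show "Coset.order (H\<lparr>carrier := ?K\<rparr>) = q ^ 1"
        using \<iota>.G.generate_pow_card[OF h] q(2) by (simp add: Coset.order_def)
      show "?c k y \<in> E" if "k \<in> carrier (H\<lparr>carrier := ?K\<rparr>)" "y \<in> E" for k y
      proof -
        have k: "k \<in> ?K" "k \<in> carrier H" and y: "y \<in> P" "\<Phi> #> y = \<Phi> #> x"
          using that Kc by (auto simp: E_def)
        have "\<Phi> #> (?c k y) = \<Phi> #> x"
          using act_image[OF k(2) y(1)] fixK[OF k(1), of "\<Phi> #> x"] y(2) x by (simp add: quotient_image_def)
        then show ?thesis using cP[OF k(2) y(1)] by (simp add: E_def)
      qed
      show "?c (k \<otimes>\<^bsub>H\<lparr>carrier := ?K\<rparr>\<^esub> l) y = ?c k (?c l y)"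
        if "k \<in> carrier (H\<lparr>carrier := ?K\<rparr>)" "l \<in> carrier (H\<lparr>carrier := ?K\<rparr>)" "y \<in> E" for k l y
        using that conj Kc by (simp add: E_def)
      show "?c \<one>\<^bsub>H\<lparr>carrier := ?K\<rparr>\<^esub> y = y" if "y \<in> E" for y
        using that P_mem by (simp add: E_def)
    qed
    moreover have "\<not> q dvd card E"
    proof
      assume dvd: "q dvd card E"
      have "card (\<Phi> \<inter> P) dvd p ^ n"
        using PG.lagrange[OF subgroup_incl[OF subgroup_\<Phi>_P P.is_subgroup]] order_P
        by (metis dvd_triv_right inf_le2)
      then have "q dvd p ^ n" using dvd card_fibre[OF x] by (auto simp: E_def)
      then show False using q(1) prime_p qp by (metis prime_dvd_power primes_dvd_imp_eq)
    qed
    ultimately have "E - {y \<in> E. \<forall>k\<in>carrier (H\<lparr>carrier := ?K\<rparr>). ?c k y = y} \<noteq> E" by metis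
    then obtain y where y: "y \<in> E" "?c h y = y" using generate.incl[of h "{h}" H] by auto
    then have yP: "y \<in> P" "y \<in> carrier G" "x \<in> carrier G" using x P_mem by (auto simp: E_def)
    have "y \<in> C" using y yP by (simp add: C_def)
    moreover have "x \<otimes> inv y \<in> \<Phi>" using \<Phi>.rcoset_eq_iff[of x y] y(1) yP by (simp add: E_def)
    moreover have "x \<otimes> inv y \<in> P" using x yP by simp
    moreover have "x = (x \<otimes> inv y) \<otimes> y" using yP by (simp add: m_assoc)
    ultimately show ?thesis by blast
  qed
  ultimately have "C = P" by (rule P_nongenerator)
  then have "h = \<one>\<^bsub>H\<^esub>" using h by (intro faithful) (auto simp: C_def)
  then show False using q \<iota>.G.ord_eq_1[OF h] by auto
qed

text \<open>A nontrivial kernel contains elements of prime order.\<close>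

lemma faithful_quotient:
  assumes h: "h \<in> carrier H" and fixed: "\<And>X. X \<in> quotient_image \<Phi> \<Longrightarrow> \<rho> h X = X"
  shows "h = \<one>\<^bsub>H\<^esub>"
proof (rule ccontr)
  assume "h \<noteq> \<one>\<^bsub>H\<^esub>"
  then have "\<iota>.G.ord h \<noteq> 1" using \<iota>.G.ord_eq_1[OF h] by simp
  then obtain q where q: "prime q" "q dvd \<iota>.G.ord h" using prime_factor_nat by blast
  then obtain k where k: "\<iota>.G.ord h = q * k" by (elim dvdE)
  have "\<iota>.G.ord h \<noteq> 0" using \<iota>.G.ord_ge_1[OF finite_H h] by simp
  then have "k dvd \<iota>.G.ord h" "k \<noteq> 0" using k by auto
  then have ord: "\<iota>.G.ord (h [^]\<^bsub>H\<^esub> k) = q" using \<iota>.G.ord_pow[OF h] k by simp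
  have fix_pow: "\<rho> (h [^]\<^bsub>H\<^esub> j) X = X" if "X \<in> quotient_image \<Phi>" for j :: nat and X
    using that fixed by (induction j) (simp_all add: A.act_comp A.act_id h)
  show False
    by (rule prime_order_faithful[OF q(1) ord _ fix_pow]) (use h in simp_all)
qed

end

context split_extension
begin

text \<open>A complement \<open>K\<close> of the full preimage \<open>X\<close> meets \<open>P\<close> in a subgroup normalised by \<open>K\<close>. Its image is also normalised by
the image of \<open>X\<close>, because \<open>Pbar\<close> is abelian, and therefore by \<open>G = X K\<close>.\<close>

lemma complement_descends:
  assumes U: "subgroup U Pbar"
    and compl: "complemented_in {x \<in> P. \<Phi> #> x \<in> U} G"
  shows "\<exists>W. A.invariant W \<and> U \<inter> W = {\<one>\<^bsub>Pbar\<^esub>} \<and> U <#>\<^bsub>Pbar\<^esub> W = carrier Pbar"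
proof -
  define X where "X = {x \<in> P. \<Phi> #> x \<in> U}"
  obtain K where K: "subgroup K G" "carrier G = X <#> K" "X \<inter> K = {\<one>}"
    using compl by (auto simp: complemented_in_def X_def)
  note Kc = subgroup.mem_carrier[OF K(1)]
  have Xc: "x \<in> P" "x \<in> carrier G" "\<Phi> #> x \<in> U" if "x \<in> X" for x using that P_mem by (auto simp: X_def)
  have factor: "\<exists>x\<in>X. \<exists>k\<in>K. g = x \<otimes> k" if g: "g \<in> carrier G" for g
  proof -
    have "g \<in> X <#> K" using g K(2) by simp
    then show ?thesis by (auto simp: set_mult_def)
  qed
  define W where "W = (\<lambda>x. \<Phi> #> x) ` (K \<inter> P)"
  have sKP: "subgroup (K \<inter> P) G" using subgroups_Inter_pair[OF K(1) P.is_subgroup] .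
  have Wsub: "W \<subseteq> quotient_image \<Phi>" by (auto simp: W_def quotient_image_def)
  have sI: "subgroup (quotient_image \<Phi>) Gbar"
    using normal_imp_subgroup[OF image_normal[OF frattini_normal]] .
  have sW: "subgroup W Pbar"
    using \<pi>.H.subgroup_incl[OF \<pi>.subgroup_img_is_subgroup[OF sKP] sI] Wsub by (simp add: W_def)
  have "\<rho> h Y \<in> W" if h: "h \<in> carrier H" and Y: "Y \<in> W" for h Y
  proof -
    obtain w where w: "w \<in> K" "w \<in> P" "Y = \<Phi> #> w" using Y by (auto simp: W_def)
    obtain x k where xk: "x \<in> X" "k \<in> K" "\<iota> h = x \<otimes> k" using factor[of "\<iota> h"] h by auto
    define z where "z = k \<otimes> w \<otimes> inv k"
    have z: "z \<in> K" "z \<in> P"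
      using xk(2) w P.inv_op_closed2[OF Kc[OF xk(2)] w(2)] subgroup.m_closed[OF K(1)]
        subgroup.m_inv_closed[OF K(1)] by (auto simp: z_def)
    have c: "x \<in> carrier G" "k \<in> carrier G" "w \<in> carrier G" "z \<in> carrier G" "x \<in> P"
      using Xc[OF xk(1)] Kc xk(2) w z P_mem by auto
    have "\<iota> h \<otimes> w \<otimes> inv (\<iota> h) = x \<otimes> z \<otimes> inv x"
      unfolding xk(3) z_def using c by (simp add: m_assoc inv_mult_group)
    then have "\<rho> h Y = (\<Phi> #> x) \<otimes>\<^bsub>Gbar\<^esub> (\<Phi> #> z) \<otimes>\<^bsub>Gbar\<^esub> inv\<^bsub>Gbar\<^esub> (\<Phi> #> x)"
      using act_image[OF h w(2)] w(3) c by simp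
    also have "(\<Phi> #> x) \<otimes>\<^bsub>Gbar\<^esub> (\<Phi> #> z) = (\<Phi> #> z) \<otimes>\<^bsub>Gbar\<^esub> (\<Phi> #> x)"
      using A.m_comm[of "\<Phi> #> x" "\<Phi> #> z"] c(5) z(2) by (simp add: quotient_image_def)
    also have "(\<Phi> #> z) \<otimes>\<^bsub>Gbar\<^esub> (\<Phi> #> x) \<otimes>\<^bsub>Gbar\<^esub> inv\<^bsub>Gbar\<^esub> (\<Phi> #> x) = \<Phi> #> z"
      using \<pi>.hom_closed[OF c(1)] \<pi>.hom_closed[OF c(4)] by (simp add: \<pi>.H.m_assoc del: \<pi>.hom_mult)
    finally show ?thesis using z by (auto simp: W_def)
  qed
  then have iW: "A.invariant W" using sW by (simp add: A.invariant_def)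
  have "U \<inter> W \<subseteq> {\<one>\<^bsub>Pbar\<^esub>}"
  proof
    fix Y assume Y: "Y \<in> U \<inter> W"
    then obtain w where w: "w \<in> K" "w \<in> P" "Y = \<Phi> #> w" by (auto simp: W_def)
    then have "w \<in> X \<inter> K" using Y by (auto simp: X_def)
    then have "w = \<one>" using K(3) by blast
    then show "Y \<in> {\<one>\<^bsub>Pbar\<^esub>}" using w(3) \<pi>.hom_one by simp
  qed
  then have "U \<inter> W = {\<one>\<^bsub>Pbar\<^esub>}"
    using subgroup.one_closed[OF U] subgroup.one_closed[OF sW] by blast
  moreover have "U <#>\<^bsub>Pbar\<^esub> W = carrier Pbar"
  proof
    show "U <#>\<^bsub>Pbar\<^esub> W \<subseteq> carrier Pbar"
      using A.set_mult_closed[OF subgroup.subset[OF U] subgroup.subset[OF sW]] .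
    show "carrier Pbar \<subseteq> U <#>\<^bsub>Pbar\<^esub> W"
    proof
      fix Y assume "Y \<in> carrier Pbar"
      then obtain y where y: "y \<in> P" "Y = \<Phi> #> y" by (auto simp: quotient_image_def)
      obtain x k where xk: "x \<in> X" "k \<in> K" "y = x \<otimes> k" using factor[OF P_mem[OF y(1)]] by blast
      have c: "x \<in> carrier G" "k \<in> carrier G" using Xc[OF xk(1)] Kc xk(2) by auto
      have "k = inv x \<otimes> y" using xk(3) c by (simp add: m_assoc[symmetric])
      moreover have "inv x \<otimes> y \<in> P" using Xc(1)[OF xk(1)] y(1) by simp
      ultimately have "k \<in> K \<inter> P" using xk(2) by simp
      then have "\<Phi> #> k \<in> W" by (auto simp: W_def)
      then have "(\<Phi> #> x) \<otimes>\<^bsub>Pbar\<^esub> (\<Phi> #> k) \<in> U <#>\<^bsub>Pbar\<^esub> W"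
        using Xc(3)[OF xk(1)] by (intro A.set_multI)
      then show "Y \<in> U <#>\<^bsub>Pbar\<^esub> W" using y(2) xk(3) c by simp
    qed
  qed
  ultimately show ?thesis using iW by blast
qed

context
  fixes s d :: nat
  assumes s_le: "s \<le> n" and card_image: "card (quotient_image \<Phi>) = p ^ (n - s)"
    and d_pos: "0 < d" and d_less: "d < n"
    and C_grp: "C_group p d G"
begin

lemma card_\<Phi>_P: "card (\<Phi> \<inter> P) = p ^ s"
proof -
  have "{x \<in> P. \<Phi> #> x \<in> quotient_image \<Phi>} = P" by (auto simp: quotient_image_def)
  then have "p ^ n = p ^ (n - s) * card (\<Phi> \<inter> P)"
    using card_preimage[of "quotient_image \<Phi>"] card_P card_image by simp
  moreover have "p ^ n = p ^ (n - s) * p ^ s" using s_le by (simp add: power_add[symmetric])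
  ultimately show ?thesis using prime_gt_0_nat[OF prime_p] by simp
qed

text \<open>Otherwise \<open>\<Phi>(G) \<inter> P\<close> has a subgroup of order \<open>p^d\<close>, and a subgroup of \<open>\<Phi>(G)\<close> has no complement unless it is trivial.\<close>

lemma s_less_d: "s < d"
proof (rule ccontr)
  assume "\<not> s < d"
  then have ds: "d \<le> s" by simp
  let ?N = "G\<lparr>carrier := \<Phi> \<inter> P\<rparr>"
  interpret N: group ?N by (rule subgroup.subgroup_is_group[OF subgroup_\<Phi>_P is_group])
  have "Coset.order ?N = p ^ d * p ^ (s - d)"
    using ds card_\<Phi>_P by (simp add: Coset.order_def power_add[symmetric])
  moreover have "finite (carrier ?N)" using finite_P by simp
  ultimately obtain X where X: "subgroup X ?N" "card X = p ^ d"
    using sylow_thm[OF prime_p N.is_group] by blast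
  have sX: "subgroup X G" using incl_subgroup[OF subgroup_\<Phi>_P X(1)] .
  have X\<Phi>: "X \<subseteq> \<Phi>" using subgroup.subset[OF X(1)] by auto
  obtain K where K: "subgroup K G" "carrier G = X <#> K" "X \<inter> K = {\<one>}"
    using C_grp sX X(2) by (auto simp: C_group_def complemented_in_def)
  have "K = carrier G"
  proof (rule frattini_nongenerator[OF finite_G K(1) X\<Phi>])
    fix g assume "g \<in> carrier G"
    then have "g \<in> X <#> K" using K(2) by simp
    then show "\<exists>x\<in>X. \<exists>k\<in>K. g = x \<otimes> k" by (auto simp: set_mult_def)
  qed
  then have "X = {\<one>}" using K(3) subgroup.subset[OF sX] by blast
  then have "p ^ d = 1" using X(2) by simp
  then show False using one_less_power[OF prime_gt_1_nat[OF prime_p] d_pos] by linarith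
qed

lemma complemented: "complemented_action Pbar p H \<rho> (n - s) (d - s)"
proof (rule complemented_action.intro[OF A.coprime_action_axioms], unfold_locales)
  show "card (carrier Pbar) = p ^ (n - s)" using card_image by simp
  show "0 < d - s" "d - s < n - s" using s_less_d d_less by auto
  fix U assume U: "subgroup U Pbar" and cU: "card U = p ^ (d - s)"
  let ?X = "{x \<in> P. \<Phi> #> x \<in> U}"
  have UI: "U \<subseteq> quotient_image \<Phi>" using subgroup.subset[OF U] by simp
  have sUG: "subgroup U Gbar"
    using \<pi>.H.incl_subgroup[OF normal_imp_subgroup[OF image_normal[OF frattini_normal]] U] .
  have "subgroup ?X G"
  proof (rule subgroupI)
    show "?X \<noteq> {}" using subgroup.one_closed[OF sUG] \<pi>.hom_one by (auto intro!: exI[of _ \<one>])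
    show "inv x \<in> ?X" if "x \<in> ?X" for x
      using that P_mem subgroup.m_inv_closed[OF sUG] by (auto simp: \<pi>.hom_inv)
    show "x \<otimes> y \<in> ?X" if "x \<in> ?X" "y \<in> ?X" for x y
      using that P_mem subgroup.m_closed[OF sUG] by auto
  qed (use P_mem in auto)
  moreover have "card ?X = p ^ d"
    using card_preimage[OF UI] cU card_\<Phi>_P s_less_d by (simp add: power_add[symmetric])
  ultimately have "complemented_in ?X G" using C_grp by (simp add: C_group_def)
  then show "\<exists>W. A.invariant W \<and> U \<inter> W = {\<one>\<^bsub>Pbar\<^esub>} \<and> U <#>\<^bsub>Pbar\<^esub> W = carrier Pbar"
    by (rule complement_descends[OF U])
qed

end

text \<open>A series with factors of order \<open>p\<close> reaches \<open>Pbar\<close>, since irreducible submodules have order \<open>p\<close>. Above it the group is a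
quotient of the abelian group \<open>H\<close>.\<close>

lemma supersolvable_quotient:
  assumes cards: "\<And>S. A.irreducible_sub S \<Longrightarrow> card S = p"
    and comm: "\<And>h k. h \<in> carrier H \<Longrightarrow> k \<in> carrier H \<Longrightarrow> h \<otimes>\<^bsub>H\<^esub> k = k \<otimes>\<^bsub>H\<^esub> h"
  shows "supersolvable Gbar"
proof -
  have nI: "quotient_image \<Phi> \<lhd> Gbar" using image_normal[OF frattini_normal] .
  note sI = normal_imp_subgroup[OF nI]
  define Q where "Q = (\<lambda>L. cyclic_series Gbar L \<and> A.invariant L)"
  have "Q {\<one>\<^bsub>Gbar\<^esub>}" using \<pi>.H.cyclic_series_triv A.invariant_triv by (simp add: Q_def)
  moreover have "\<forall>L. Q L \<longrightarrow> card L < Suc (card (carrier Pbar))"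
    using card_mono[OF A.finite_carrier] A.invariant_sub subgroup.subset
    unfolding Q_def less_Suc_eq_le by metis
  ultimately obtain L where L: "Q L" "\<And>L'. Q L' \<Longrightarrow> card L' \<le> card L"
    using ex_has_greatest_nat[of Q "{\<one>\<^bsub>Gbar\<^esub>}" card] by metis
  have iL: "A.invariant L" and cL: "cyclic_series Gbar L" using L(1) by (auto simp: Q_def)
  have "L = carrier Pbar"
  proof (rule ccontr)
    assume "L \<noteq> carrier Pbar"
    then obtain T where T: "A.irreducible_sub T" "L \<inter> T = {\<one>\<^bsub>Pbar\<^esub>}" using A.irr_outside[OF iL] by blast
    note iT = A.irr_invariant[OF T(1)]
    obtain t where t: "t \<in> T" "t \<noteq> \<one>\<^bsub>Pbar\<^esub>" using A.irr_elem[OF T(1)] by blast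
    have tc: "t \<in> carrier Pbar" using A.invariant_mem[OF iT t(1)] .
    have "generate Pbar {t} = T"
      using A.generate_singleton_sub[OF A.invariant_sub[OF iT] t(1)] A.card_generate_singleton[OF tc t(2)]
        cards[OF T(1)] A.finite_sub[OF A.invariant_sub[OF iT]] by (intro card_subset_eq) auto
    then have gT: "generate Gbar {t} = T"
      using \<pi>.H.generate_consistent[of "{t}" "quotient_image \<Phi>"] sI tc by simp
    have iLT: "A.invariant (L <#>\<^bsub>Pbar\<^esub> T)" using A.invariant_set_mult[OF iL iT] .
    then have "L <#>\<^bsub>Gbar\<^esub> generate Gbar {t} \<lhd> Gbar"
      using invariant_imp_normal(1)[OF frattini_elementary iLT] gT by simp
    moreover have "t \<in> carrier Gbar" using tc subgroup.mem_carrier[OF sI] by simp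
    ultimately have "cyclic_series Gbar (L <#>\<^bsub>Gbar\<^esub> generate Gbar {t})"
      using \<pi>.H.cyclic_series_extend[OF cL] by blast
    then have "Q (L <#>\<^bsub>Pbar\<^esub> T)" using iLT gT by (simp add: Q_def)
    then have "card (L <#>\<^bsub>Pbar\<^esub> T) \<le> card L" by (rule L(2))
    moreover have "card (L <#>\<^bsub>Pbar\<^esub> T) = card L * p"
      using A.card_product[OF iL iT T(2)] cards[OF T(1)] by simp
    ultimately show False
      using A.card_sub_pos[OF A.invariant_sub[OF iL]] A.p_gt1 by simp
  qed
  then have series: "cyclic_series Gbar (quotient_image \<Phi>)" using cL by simp
  show ?thesis
  proof (rule \<pi>.H.supersolvable_if_abelian_above[OF _ series])
    show "finite (carrier Gbar)" using finite_G by (simp add: carrier_FactGroup)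
    fix X Y assume "X \<in> carrier Gbar" "Y \<in> carrier Gbar"
    then obtain g k where g: "g \<in> carrier G" "X = \<Phi> #> g" and k: "k \<in> carrier G" "Y = \<Phi> #> k"
      by (auto simp: carrier_FactGroup)
    interpret \<pi>P: group_hom G "G Mod P" "\<lambda>x. P #> x" by (rule proj_hom[OF normal_P])
    have red: "\<exists>h\<in>carrier H. P #> g = P #> \<iota> h" if g: "g \<in> carrier G" for g
    proof -
      obtain x h where xh: "x \<in> P" "h \<in> carrier H" "g = x \<otimes> \<iota> h" using split[OF g] by blast
      then have "g \<otimes> inv (\<iota> h) \<in> P" using P_mem by (simp add: m_assoc)
      then show ?thesis using P.rcoset_eq_iff[of g "\<iota> h"] xh(2) g by auto
    qed
    obtain a where a: "a \<in> carrier H" "P #> g = P #> \<iota> a" using red[OF g(1)] by blast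
    obtain b where b: "b \<in> carrier H" "P #> k = P #> \<iota> b" using red[OF k(1)] by blast
    have "P #> (g \<otimes> k) = P #> (\<iota> a \<otimes> \<iota> b)" using g k a b by simp
    also have "\<iota> a \<otimes> \<iota> b = \<iota> b \<otimes> \<iota> a"
      using comm[OF a(1) b(1)] a(1) b(1) by (metis \<iota>.hom_mult)
    also have "P #> (\<iota> b \<otimes> \<iota> a) = P #> (k \<otimes> g)" using g k a b by simp
    finally have "(g \<otimes> k) \<otimes> inv (k \<otimes> g) \<in> P" using P.rcoset_eq_iff[of "g \<otimes> k" "k \<otimes> g"] g k by simp
    then have "g \<otimes> k \<otimes> inv g \<otimes> inv k \<in> P" using g k by (simp add: inv_mult_group m_assoc)
    then have "\<Phi> #> (g \<otimes> k \<otimes> inv g \<otimes> inv k) \<in> quotient_image \<Phi>" by (simp add: quotient_image_def)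
    then show "X \<otimes>\<^bsub>Gbar\<^esub> Y \<otimes>\<^bsub>Gbar\<^esub> inv\<^bsub>Gbar\<^esub> X \<otimes>\<^bsub>Gbar\<^esub> inv\<^bsub>Gbar\<^esub> Y \<in> quotient_image \<Phi>"
      using g k by simp
  qed
qed

end

section \<open>Elementary abelian groups as modules\<close>

lemma (in vectorspace) card_eq_power_dim:
  assumes "finite (carrier V)"
  shows "card (carrier V) = card (carrier K) ^ dim"
proof -
  have "gen_set (carrier V)"
    using in_own_span[of "carrier V"] span_is_subset2[of "carrier V"] by blast
  then have "fin_dim" using assms by (auto simp: fin_dim_def)
  then obtain B where B: "finite B" "basis B" using finite_basis_exists by blast
  then have BV: "B \<subseteq> carrier V" by (simp add: basis_def)
  have ex: "\<exists>!a. a \<in> B \<rightarrow>\<^sub>E carrier K \<and> lincomb a B = v" if "v \<in> carrier V" for v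
    using basis_criterion[OF B(1) BV] B(2) that by blast
  have closed: "lincomb a B \<in> carrier V" if "a \<in> B \<rightarrow>\<^sub>E carrier K" for a
    using that BV by (intro lincomb_closed) auto
  have "bij_betw (\<lambda>a. lincomb a B) (B \<rightarrow>\<^sub>E carrier K) (carrier V)"
    unfolding bij_betw_def
  proof
    show "inj_on (\<lambda>a. lincomb a B) (B \<rightarrow>\<^sub>E carrier K)"
      using ex closed by (intro inj_onI) blast
    show "(\<lambda>a. lincomb a B) ` (B \<rightarrow>\<^sub>E carrier K) = carrier V"
    proof
      show "carrier V \<subseteq> (\<lambda>a. lincomb a B) ` (B \<rightarrow>\<^sub>E carrier K)"
      proof
        fix v assume "v \<in> carrier V"
        then obtain a where "a \<in> B \<rightarrow>\<^sub>E carrier K" "lincomb a B = v" using ex by blast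
        then show "v \<in> (\<lambda>a. lincomb a B) ` (B \<rightarrow>\<^sub>E carrier K)" by blast
      qed
    qed (use closed in blast)
  qed
  then have "card (carrier V) = card (B \<rightarrow>\<^sub>E carrier K)" using bij_betw_same_card by metis
  then show ?thesis using dim_basis[OF B] B(1) by (simp add: card_funcsetE)
qed

context coprime_action
begin

abbreviation "K \<equiv> prime_field p"
abbreviation "V \<equiv> additive_module A"
abbreviation "sub W \<equiv> V\<lparr>carrier := W\<rparr>"

lemma module_simps:
  "carrier V = carrier A" "\<zero>\<^bsub>V\<^esub> = \<one>" "x \<oplus>\<^bsub>V\<^esub> y = x \<otimes> y" "k \<odot>\<^bsub>V\<^esub> x = x [^] k"
  by (simp_all add: additive_module_def)

lemma sub_simps:
  "carrier (sub W) = W" "\<zero>\<^bsub>sub W\<^esub> = \<one>" "x \<oplus>\<^bsub>sub W\<^esub> y = x \<otimes> y" "k \<odot>\<^bsub>sub W\<^esub> x = x [^] k"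
  by (simp_all add: additive_module_def)

lemma sub_carrier: "sub (carrier A) = V"
  by (simp add: additive_module_def)

lemma field_simps_K:
  "carrier K = {0..int p - 1}" "\<one>\<^bsub>K\<^esub> = 1" "a \<otimes>\<^bsub>K\<^esub> b = (a * b) mod int p" "a \<oplus>\<^bsub>K\<^esub> b = (a + b) mod int p"
  by (simp_all add: residue_ring_def)

lemma field_K: "field K"
  using residues_prime.is_field[OF residues_prime.intro[OF prime_p]] .

lemma card_K: "card (carrier K) = p"
  using p_gt1 by (simp add: field_simps_K)

lemma int_pow_mod:
  assumes "x \<in> carrier A"
  shows "x [^] (k mod int p) = x [^] (k :: int)"
proof -
  have "x [^] k = x [^] (int p * (k div int p) + k mod int p)" by simp
  also have "\<dots> = (x [^] int p) [^] (k div int p) \<otimes> x [^] (k mod int p)"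
    using assms by (simp only: int_pow_mult int_pow_pow)
  also have "x [^] int p = \<one>" using exponent[OF assms] by (simp add: int_pow_int)
  finally show ?thesis using assms by simp
qed

lemma vectorspace_sub:
  assumes "subgroup W A"
  shows "vectorspace K (sub W)"
proof (rule vs_criteria[OF field_K], unfold sub_simps field_simps_K)
  note m = subgroup.mem_carrier[OF assms]
  show "\<one> \<in> W" using assms by (rule subgroup.one_closed)
  show "\<forall>v w. v \<in> W \<and> w \<in> W \<longrightarrow> v \<otimes> w \<in> W" using assms subgroup.m_closed by metis
  show "\<forall>v\<in>W. \<exists>n\<in>W. v \<otimes> n = \<one>"
    using m subgroup.m_inv_closed[OF assms] r_inv by blast
  show "\<forall>c v. c \<in> {0..int p - 1} \<and> v \<in> W \<longrightarrow> v [^] c \<in> W"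
    using subgroup_int_pow_closed[OF assms] by blast
  show "\<forall>v w. v \<in> W \<and> w \<in> W \<longrightarrow> v \<otimes> w = w \<otimes> v" using m m_comm by blast
  show "\<forall>v w x. v \<in> W \<and> w \<in> W \<and> x \<in> W \<longrightarrow> v \<otimes> w \<otimes> x = v \<otimes> (w \<otimes> x)" using m m_assoc by blast
  show "\<forall>v\<in>W. v \<otimes> \<one> = v" using m by simp
  show "\<forall>a b v. a \<in> {0..int p - 1} \<and> b \<in> {0..int p - 1} \<and> v \<in> W \<longrightarrow>
      v [^] (a * b mod int p) = (v [^] b) [^] a"
    using m by (auto simp: int_pow_mod int_pow_pow mult.commute)
  show "\<forall>v\<in>W. v [^] (1::int) = v" using m by simp
  show "\<forall>a b v. a \<in> {0..int p - 1} \<and> b \<in> {0..int p - 1} \<and> v \<in> W \<longrightarrow>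
      v [^] ((a + b) mod int p) = v [^] a \<otimes> v [^] b"
    using m by (auto simp: int_pow_mod int_pow_mult)
  show "\<forall>a v w. a \<in> {0..int p - 1} \<and> v \<in> W \<and> w \<in> W \<longrightarrow> (v \<otimes> w) [^] a = v [^] a \<otimes> w [^] a"
    using m by (auto simp: int_pow_distrib)
qed

lemma group_module_sub:
  assumes "invariant W"
  shows "group_module K H (sub W) \<rho>"
proof -
  note m = invariant_mem[OF assms]
  have "\<rho> h (x [^] k) = \<rho> h x [^] k" if hxk: "h \<in> carrier H" "x \<in> W" "k \<in> {0..int p - 1}" for h x k
  proof -
    obtain j where "k = int j" using hxk(3) by (auto dest: zero_le_imp_eq_int)
    then show ?thesis using act_pow[OF hxk(1) m[OF hxk(2)]] by (simp add: int_pow_int)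
  qed
  then have "\<rho> h \<in> module_hom K (sub W) (sub W)" if "h \<in> carrier H" for h
    using that invariant_act[OF assms that] m act_mult
    by (auto simp: module_hom_def sub_simps module_simps field_simps_K)
  then show ?thesis
    using vectorspace_sub[OF invariant_sub[OF assms]] H.is_group m act_comp act_id
    by (simp add: group_module_def group_module_axioms_def sub_simps)
qed

text \<open>Closure under inverses comes from the scalar \<open>p - 1\<close>.\<close>

lemma group_submodule_iff:
  assumes "invariant D"
  shows "group_submodule K H (sub D) \<rho> W \<longleftrightarrow> invariant W \<and> W \<subseteq> D"
proof
  assume W: "group_submodule K H (sub D) \<rho> W"
  then have sub: "submodule K W (sub D)" by (simp add: group_submodule_def subspace_def)
  have WD: "W \<subseteq> D" using submodule.subset[OF sub] by (simp add: sub_simps)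
  have m: "x \<in> carrier A" if "x \<in> W" for x using that WD assms invariant_mem by blast
  have "subgroup W A"
  proof (rule subgroupI)
    show "W \<noteq> {}" using submodule.zero_closed[OF sub] by auto
    show "x \<otimes> y \<in> W" if "x \<in> W" "y \<in> W" for x y
      using submodule.m_closed[OF sub that] by (simp only: sub_simps)
    show "inv x \<in> W" if x: "x \<in> W" for x
    proof -
      have "(int p - 1) \<odot>\<^bsub>sub D\<^esub> x \<in> W"
        using p_gt1 x by (intro submodule.smult_closed[OF sub]) (auto simp: field_simps_K)
      then have "x [^] (int p - 1) \<in> W" by (simp only: sub_simps)
      moreover have "x [^] (int p - 1) = inv x"
      proof -
        have "x [^] (int p - 1) = x [^] ((int p - 1) - int p)"
          using int_pow_mod[OF m[OF x], of "int p - 1 - int p"] int_pow_mod[OF m[OF x], of "int p - 1"]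
          by simp
        then show ?thesis using m[OF x] by (simp add: int_pow_neg)
      qed
      ultimately show ?thesis by simp
    qed
  qed (use m in auto)
  then show "invariant W \<and> W \<subseteq> D" using W WD by (simp add: group_submodule_def invariant_def)
next
  assume W: "invariant W \<and> W \<subseteq> D"
  have vs: "vectorspace K (sub D)" using vectorspace_sub invariant_sub assms by blast
  then have "module K (sub D)" by (simp add: vectorspace_def)
  then have "submodule K W (sub D)"
    using W subgroup.m_closed[OF invariant_sub[of W]] invariant_one[of W]
      subgroup_int_pow_closed[OF invariant_sub[of W]]
    by (intro submodule.intro) (auto simp: sub_simps module_simps)
  then show "group_submodule K H (sub D) \<rho> W"
    using vs W invariant_act by (auto simp: group_submodule_def subspace_def)
qed

lemma irreducible_submodule_iff: "irreducible_submodule K H V \<rho> W \<longleftrightarrow> irreducible_sub W"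
proof -
  have eq: "group_submodule K H V \<rho> W \<longleftrightarrow> invariant W"
    using group_submodule_iff[OF invariant_carrier, of W] sub_carrier
      subgroup.subset[OF invariant_sub[of W]] by auto
  show ?thesis
    by (auto simp: irreducible_submodule_def irreducible_group_module_def irreducible_sub_def eq sub_simps
      group_submodule_iff group_module_sub)
qed

lemma dim_sub:
  assumes "invariant W" "card W = p ^ e"
  shows "vectorspace.dim K (sub W) = e"
proof -
  interpret W: vectorspace K "sub W" using vectorspace_sub invariant_sub assms(1) by blast
  have "card W = p ^ W.dim"
    using W.card_eq_power_dim finite_sub[OF invariant_sub[OF assms(1)]] by (simp add: sub_simps card_K)
  then show ?thesis using assms(2) p_gt1 by simp
qed

lemma isomorphic_sub:
  assumes "equivariant_iso S T" "invariant S" "invariant T"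
  shows "isomorphic_group_modules K H (sub S) \<rho> (sub T) \<rho>"
proof -
  obtain f where f: "f \<in> equiv_hom S T" "bij_betw f S T" using assms(1) by (auto simp: equivariant_iso_def)
  have pow: "f (x [^] (j::nat)) = f x [^] j" if x: "x \<in> S" for x j
  proof (induction j)
    case (Suc j)
    have "x [^] j \<in> S" for j :: nat
      using subgroup_int_pow_closed[OF invariant_sub[OF assms(2)] x, of "int j"] by (simp add: int_pow_int)
    then show ?case using Suc equiv_homD(2)[OF f(1)] x by simp
  qed (use equiv_hom_one[OF f(1) assms(2,3)] in simp)
  have "f (x [^] k) = f x [^] k" if xk: "x \<in> S" "k \<in> {0..int p - 1}" for x and k :: int
  proof -
    obtain j where "k = int j" using xk(2) by (auto dest: zero_le_imp_eq_int)
    then show ?thesis using pow[OF xk(1)] by (simp add: int_pow_int)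
  qed
  then have "f \<in> module_hom K (sub S) (sub T)"
    using equiv_homD(1,2)[OF f(1)] by (auto simp: module_hom_def sub_simps module_simps field_simps_K)
  then show ?thesis
    using f(2) equiv_homD(3)[OF f(1)]
    unfolding isomorphic_group_modules_def sub_simps by blast
qed

lemma finsum_V: "finsum V w I = finprod A w I"
  by (simp add: finsum_def finprod_def additive_module_def)

lemma homogeneous_module:
  assumes "\<And>S T. irreducible_sub S \<Longrightarrow> irreducible_sub T \<Longrightarrow> equivariant_iso S T"
  shows "homogeneous K H V \<rho>"
proof -
  obtain k W where kW: "direct_decomposition (carrier A) k W"
    using decomposition[OF invariant_carrier] by blast
  then have irreducible_sub: "\<forall>i<k. irreducible_sub (W i)" by (simp add: direct_decomposition_def)
  have "group_module K H V \<rho>" using group_module_sub[OF invariant_carrier] by (simp add: sub_carrier)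
  moreover have "\<forall>i<k. irreducible_submodule K H V \<rho> (W i)"
    using irreducible_sub by (simp add: irreducible_submodule_iff)
  moreover have "\<forall>i<k. \<forall>j<k. isomorphic_group_modules K H (sub (W i)) \<rho> (sub (W j)) \<rho>"
    by (intro allI impI isomorphic_sub assms irr_invariant) (simp_all add: irreducible_sub)
  moreover have "internal_direct_sum V {..<k} W"
    using kW by (simp add: internal_direct_sum_def direct_decomposition_def module_simps finsum_V)
  ultimately show ?thesis unfolding homogeneous_def by blast
qed

end

section \<open>The semidirect product\<close>

lemma split_extension_semidirect:
  fixes H :: "('a, 'm) monoid_scheme" and P :: "('b, 'k) monoid_scheme"
  assumes "prime p" "group H" "finite (carrier H)" "coprime (Coset.order H) p"
    and "group P" "finite (carrier P)" "Coset.order P = p ^ n"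
    and \<phi>: "group_hom H (AutoGroup P) \<phi>" "inj_on \<phi> (carrier H)"
  shows "split_extension (semidirect H P \<phi>) H (\<lambda>h. (h, \<one>\<^bsub>P\<^esub>)) ({\<one>\<^bsub>H\<^esub>} \<times> carrier P) p n"
proof -
  interpret H: group H by fact
  interpret P: group P by fact
  let ?G = "semidirect H P \<phi>"
  interpret G: group ?G by (rule group_semidirect) fact+
  interpret \<phi>: group_hom H "AutoGroup P" \<phi> by fact
  note act = hom_AutoGroup[OF \<phi>(1)]
  have carrier: "carrier ?G = carrier H \<times> carrier P" by (simp add: semidirect_def)
  have one: "\<one>\<^bsub>?G\<^esub> = (\<one>\<^bsub>H\<^esub>, \<one>\<^bsub>P\<^esub>)" by (simp add: semidirect_def)
  have mult: "(h, x) \<otimes>\<^bsub>?G\<^esub> (k, y) = (h \<otimes>\<^bsub>H\<^esub> k, x \<otimes>\<^bsub>P\<^esub> \<phi> h y)" for h k x y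
    by (simp add: semidirect_def)
  have act_one: "\<phi> h \<one>\<^bsub>P\<^esub> = \<one>\<^bsub>P\<^esub>" if "h \<in> carrier H" for h
    using act(1,2)[OF that P.one_closed] P.one_closed by (metis P.l_one P.r_cancel_one')
  let ?\<iota> = "\<lambda>h. (h, \<one>\<^bsub>P\<^esub>)" and ?P = "{\<one>\<^bsub>H\<^esub>} \<times> carrier P"
  have \<iota>: "group_hom H ?G ?\<iota>"
    by (unfold_locales, rule homI) (auto simp: carrier mult act_one)
  interpret fst: group_hom ?G H fst
    by (unfold_locales, rule homI) (auto simp: carrier mult)
  have kernel: "?P = kernel ?G H fst" by (auto simp: kernel_def carrier)
  have conj: "?\<iota> h \<otimes>\<^bsub>?G\<^esub> (\<one>\<^bsub>H\<^esub>, x) \<otimes>\<^bsub>?G\<^esub> inv\<^bsub>?G\<^esub> (?\<iota> h) = (\<one>\<^bsub>H\<^esub>, \<phi> h x)"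
    if "h \<in> carrier H" "x \<in> carrier P" for h x
  proof -
    have "?\<iota> h \<otimes>\<^bsub>?G\<^esub> (\<one>\<^bsub>H\<^esub>, x) = (\<one>\<^bsub>H\<^esub>, \<phi> h x) \<otimes>\<^bsub>?G\<^esub> ?\<iota> h"
      by (rule semidirect_conj) fact+
    moreover have "(\<one>\<^bsub>H\<^esub>, \<phi> h x) \<in> carrier ?G" "?\<iota> h \<in> carrier ?G"
      using that act by (auto simp: carrier)
    ultimately show ?thesis by (simp add: G.m_assoc)
  qed
  show ?thesis
  proof (intro split_extension.intro split_extension_axioms.intro)
    show "?P \<lhd> ?G" unfolding kernel by (rule fst.normal_kernel)
    show "card ?P = p ^ n" using assms(7) by (simp add: Coset.order_def card_cartesian_product)
    show "\<exists>x\<in>?P. \<exists>h\<in>carrier H. g = x \<otimes>\<^bsub>?G\<^esub> ?\<iota> h" if "g \<in> carrier ?G" for g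
    proof -
      obtain h x where g: "g = (h, x)" "h \<in> carrier H" "x \<in> carrier P"
        using \<open>g \<in> carrier ?G\<close> by (auto simp: carrier)
      then have "g = (\<one>\<^bsub>H\<^esub>, x) \<otimes>\<^bsub>?G\<^esub> ?\<iota> h" using act by (simp add: mult)
      then show ?thesis using g by blast
    qed
    show "h = \<one>\<^bsub>H\<^esub>"
      if h: "h \<in> carrier H" and fixed: "\<And>x. x \<in> ?P \<Longrightarrow> ?\<iota> h \<otimes>\<^bsub>?G\<^esub> x \<otimes>\<^bsub>?G\<^esub> inv\<^bsub>?G\<^esub> (?\<iota> h) = x" for h
    proof -
      have fx: "\<phi> h x = \<phi> \<one>\<^bsub>H\<^esub> x" if x: "x \<in> carrier P" for x
        using fixed[of "(\<one>\<^bsub>H\<^esub>, x)"] conj[OF h x] x act(4)[OF h x] by simp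
      have "\<phi> h \<in> extensional (carrier P)" "\<phi> \<one>\<^bsub>H\<^esub> \<in> extensional (carrier P)"
        using \<phi>.hom_closed[OF h] \<phi>.hom_closed[OF H.one_closed]
        by (auto simp: AutoGroup_def auto_def Bij_def)
      then have "\<phi> h = \<phi> \<one>\<^bsub>H\<^esub>" using fx by (rule extensionalityI)
      then show ?thesis using \<phi>(2) h by (simp add: inj_on_def)
    qed
  qed (use assms G.is_group \<iota> in \<open>auto simp: carrier\<close>)
qed

theorem corollaryC:
  fixes p n d s :: nat
    and H :: "('a, 'm) monoid_scheme" and P :: "('b, 'k) monoid_scheme"
    and \<phi> :: "'a \<Rightarrow> 'b \<Rightarrow> 'b"
  defines "G \<equiv> semidirect H P \<phi>"
  defines "Gbar \<equiv> G Mod frattini G"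
  defines "Pbar \<equiv> (\<lambda>x. frattini G #>\<^bsub>G\<^esub> (\<one>\<^bsub>H\<^esub>, x)) ` carrier P"
  defines "V \<equiv> additive_module (Gbar\<lparr>carrier := Pbar\<rparr>)"
  defines "\<rho> \<equiv> conj_action Gbar (\<lambda>h. frattini G #>\<^bsub>G\<^esub> (h, \<one>\<^bsub>P\<^esub>))"
  assumes "prime p"
    and "group H" "finite (carrier H)" "coprime (order H) p"
    and "group P" "finite (carrier P)" "order P = p ^ n"
    and "group_hom H (AutoGroup P) \<phi>" "inj_on \<phi> (carrier H)"
    and "s \<le> n" "card Pbar = p ^ (n - s)"
    and "0 < d" "d < n"
    and "nontrivial_C_group p d G"
  shows "supersolvable Gbar \<or>
    (cyclic_group H \<and> homogeneous (prime_field p) H V \<rho> \<and>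
     (\<exists>e::nat. e > 1 \<and>
        (\<forall>W. irreducible_submodule (prime_field p) H V \<rho> W \<longrightarrow>
           vectorspace.dim (prime_field p) (V\<lparr>carrier := W\<rparr>) = e) \<and>
        int e dvd gcd (int d - int s) (int n - int s)))"
proof -
  interpret E: split_extension G H "\<lambda>h. (h, \<one>\<^bsub>P\<^esub>)" "{\<one>\<^bsub>H\<^esub>} \<times> carrier P" p n
    unfolding G_def by (rule split_extension_semidirect) fact+
  have Pbar: "E.quotient_image (frattini G) = Pbar"
    by (force simp: E.quotient_image_def Pbar_def)
  have C: "C_group p d G" using assms by (simp add: nontrivial_C_group_def)
  have cI: "card (E.quotient_image (frattini G)) = p ^ (n - s)" using assms Pbar by simp
  have sd: "s < d" by (rule E.s_less_d[OF \<open>s \<le> n\<close> cI \<open>0 < d\<close> \<open>d < n\<close> C])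
  interpret A: complemented_action "Gbar\<lparr>carrier := Pbar\<rparr>" p H \<rho> "n - s" "d - s"
    using E.complemented[OF \<open>s \<le> n\<close> cI \<open>0 < d\<close> \<open>d < n\<close> C] Pbar by (simp add: Gbar_def \<rho>_def)
  have faithful: "h = \<one>\<^bsub>H\<^esub>"
    if "h \<in> carrier H" "\<And>x. x \<in> carrier (Gbar\<lparr>carrier := Pbar\<rparr>) \<Longrightarrow> \<rho> h x = x" for h
    using E.faithful_quotient[OF that(1)] that(2) Pbar by (simp add: Gbar_def \<rho>_def)
  from A.dichotomy show ?thesis
  proof
    assume cards: "\<forall>S. A.irreducible_sub S \<longrightarrow> card S = p"
    then have "h \<otimes>\<^bsub>H\<^esub> k = k \<otimes>\<^bsub>H\<^esub> h" if "h \<in> carrier H" "k \<in> carrier H" for h k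
      using that by (intro A.abelian_acting_group faithful) auto
    then have "supersolvable Gbar"
      using E.supersolvable_quotient cards Pbar by (simp add: Gbar_def \<rho>_def)
    then show ?thesis by blast
  next
    assume "\<exists>e>1. (\<forall>S. A.irreducible_sub S \<longrightarrow> card S = p ^ e) \<and> (\<forall>S T. A.irreducible_sub S \<longrightarrow> A.irreducible_sub T \<longrightarrow> A.equivariant_iso S T)"
    then obtain e where e: "e > 1" and cards: "\<And>S. A.irreducible_sub S \<Longrightarrow> card S = p ^ e"
      and isos: "\<And>S T. A.irreducible_sub S \<Longrightarrow> A.irreducible_sub T \<Longrightarrow> A.equivariant_iso S T" by blast
    have "e dvd n - s" "e dvd d - s" using A.dimension_dvd[OF cards] by blast+
    then have "int e dvd int (n - s)" "int e dvd int (d - s)" by simp_all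
    then have "int e dvd gcd (int d - int s) (int n - int s)"
      using sd \<open>d < n\<close> by (simp add: of_nat_diff)
    moreover have "cyclic_group H" by (rule A.cyclic_acting_group[OF cards isos faithful])
    moreover have "homogeneous (prime_field p) H V \<rho>"
      unfolding V_def by (rule A.homogeneous_module[OF isos])
    moreover have "vectorspace.dim (prime_field p) (V\<lparr>carrier := W\<rparr>) = e"
      if "irreducible_submodule (prime_field p) H V \<rho> W" for W
    proof -
      have "A.irreducible_sub W" using that by (simp add: V_def A.irreducible_submodule_iff)
      then show ?thesis unfolding V_def using A.dim_sub A.irr_invariant cards by blast
    qed
    ultimately show ?thesis using e by blast
  qed
qed

end
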